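(* Let $p\geq 3$ and let $f:2\mathbb{T}^p\to 2\mathbb{T}^p$ be a continuous map such that $f(\mathbb{T}^p_1)\subset\mathbb{T}^p_1$, $f(\mathbb{T}^p_2)\subset\mathbb{T}^p_2$ and $f(S^{p-1})\subset S^{p-1}$. Then $$N(f;\overline{\mathbb{T}^p_1}\cup\overline{\mathbb{T}^p_2})\geq|\varLambda(\tilde f_1,\mathbb{T}^p)|+|\varLambda(\tilde f_2,\mathbb{T}^p)|-3.$$
   Context: $\mathbb{T}^p=S^1\times\cdots\times S^1$ ($p$ factors) is the $p$-torus and $2\mathbb{T}^p$ is the connected sum of two $p$-tori. It is described as the disjoint union of a sphere $S^{p-1}$ (the connecting sphere) and two open subsets $\mathbb{T}^p_1$, $\mathbb{T}^p_2$, each of which is a $p$-torus with a (closed) $p$-disk removed; $\overline{\mathbb{T}^p_i}=\mathbb{T}^p_i\cup S^{p-1}$ is the closure of $\mathbb{T}^p_i$ in $2\mathbb{T}^p$. For $i=1,2$, $\tilde f_i:\mathbb{T}^p\to\mathbb{T}^p$ is the extension of $f_{|\mathbb{T}^p_i}$ to the one-point (Alexandroff) compactification of $\mathbb{T}^p_i$, which is the $p$-torus $\mathbb{T}^p=\overline{\mathbb{T}^p_i}/S^{p-1}$; the point at infinity is fixed. $\varLambda(\cdot,\mathbb{T}^p)$ is the usual Lefschetz number. For a suitable simplicial complex $X=A_1\cup A_2$ with subcomplexes $A_1,A_2$, and a map $f:X\to X$ with $f(A_i)\subset A_i$ for $i=1,2$, $N(f;A_1\cup A_2)$ is the Nielsen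 number of a triad (H. Schirmer): the minimum number of fixed points of maps homotopic to $f$ under a homotopy that preserves $A_1$ and $A_2$ (i.e. every stage maps $A_1$ into $A_1$ and $A_2$ into $A_2$). *)

theory Defs
  imports "HOL-Analysis.Analysis" "HOL-Homology.Homology" "HOL-Library.Extended_Real"
begin

definition torus :: "nat \<Rightarrow> (nat \<Rightarrow> complex) topology"
  where "torus p = product_topology (\<lambda>i. top_of_set (sphere 0 1)) {..<p}"

definition open_disk :: "nat \<Rightarrow> (nat \<Rightarrow> real) set"
  where "open_disk p = {x \<in> topspace (Euclidean_space p). (\<Sum>i<p. (x i)\<^sup>2) < 1}"

definition disk_boundary :: "nat \<Rightarrow> (nat \<Rightarrow> real) set"
  where "disk_boundary p = {x \<in> topspace (Euclidean_space p). (\<Sum>i<p. (x i)\<^sup>2) = 1}"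

text \<open>
  The subspace \<open>T \<union> S\<close> of \<open>X\<close> is a torus minus an open disk, with \<open>S\<close> as its boundary sphere;
  hence \<open>T\<close> is a torus minus a closed disk. The disk is the image of the unit disk under an
  embedding \<open>e\<close> of the whole of Euclidean space, so that it has a collar; wildly embedded disks,
  which are not allowed in a connected sum, are thereby excluded.
\<close>

definition punctured_torus :: "nat \<Rightarrow> 'a topology \<Rightarrow> 'a set \<Rightarrow> 'a set \<Rightarrow> bool"
  where "punctured_torus p X T S \<longleftrightarrow>
    (\<exists>e h. embedding_map (Euclidean_space p) (torus p) e \<and>
           homeomorphic_map (subtopology (torus p) (topspace (torus p) - e ` open_disk p))
                            (subtopology X (T \<union> S)) h \<and>
           h ` e ` disk_boundary p = S)"

text \<open>
  \<open>X\<close> is a connected sum of two \<open>p\<close>-tori, with connecting sphere \<open>S\<close> and open summands \<open>T1\<close>, \<open>T2\<close>.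
  Since \<open>T1 \<union> S\<close> and \<open>T2 \<union> S\<close> are closed, \<open>X\<close> has the topology of the space obtained by gluing these
  two pieces along \<open>S\<close>. The gluing homeomorphism need not reverse orientation: the torus has
  orientation-reversing self-homeomorphisms, so both choices give the same space.
\<close>

definition connected_sum_of_tori ::
    "nat \<Rightarrow> 'a topology \<Rightarrow> 'a set \<Rightarrow> 'a set \<Rightarrow> 'a set \<Rightarrow> bool"
  where "connected_sum_of_tori p X T1 S T2 \<longleftrightarrow>
    topspace X = T1 \<union> S \<union> T2 \<and>
    T1 \<inter> S = {} \<and> T2 \<inter> S = {} \<and> T1 \<inter> T2 = {} \<and>
    openin X T1 \<and> openin X T2 \<and>
    punctured_torus p X T1 S \<and> punctured_torus p X T2 S"

definition torsion_elements :: "('g, 'm) monoid_scheme \<Rightarrow> 'g set"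
  where "torsion_elements G = {x \<in> carrier G. \<exists>n::nat. n > 0 \<and> x [^]\<^bsub>G\<^esub> n = \<one>\<^bsub>G\<^esub>}"

text \<open>
  For an abelian group \<open>G\<close>, \<open>c\<close> is a vector of integer coordinates of \<open>x\<close> with respect to the images
  of the elements of \<open>B\<close> in the quotient of \<open>G\<close> by its torsion subgroup.
\<close>

definition coordinates_mod_torsion ::
    "('g, 'm) monoid_scheme \<Rightarrow> 'g set \<Rightarrow> 'g \<Rightarrow> ('g \<Rightarrow> int) \<Rightarrow> bool"
  where "coordinates_mod_torsion G B x c \<longleftrightarrow>
    c \<in> B \<rightarrow>\<^sub>E UNIV \<and>
    x \<otimes>\<^bsub>G\<^esub> inv\<^bsub>G\<^esub> (finprod G (\<lambda>b. b [^]\<^bsub>G\<^esub> c b) B) \<in> torsion_elements G"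

definition basis_mod_torsion :: "('g, 'm) monoid_scheme \<Rightarrow> 'g set \<Rightarrow> bool"
  where "basis_mod_torsion G B \<longleftrightarrow>
    finite B \<and> B \<subseteq> carrier G \<and> (\<forall>x \<in> carrier G. \<exists>!c. coordinates_mod_torsion G B x c)"

text \<open>
  Trace of the endomorphism induced by \<open>\<phi>\<close> on \<open>G\<close> modulo torsion, that is, of \<open>\<phi>\<close> tensored with
  the rationals. It does not depend on \<open>B\<close>; it is meaningful only if a finite \<open>B\<close> exists.
\<close>

definition endo_trace :: "('g, 'm) monoid_scheme \<Rightarrow> ('g \<Rightarrow> 'g) \<Rightarrow> int"
  where "endo_trace G \<phi> =
    (THE t. \<exists>B. basis_mod_torsion G B \<and>
                t = (\<Sum>b\<in>B. (THE c. coordinates_mod_torsion G B (\<phi> b) c) b))"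

text \<open>
  The sum is over all degrees; \<open>Sum_any\<close> is meaningful because only finitely many homology groups of
  a space such as a torus have a nonzero trace.
\<close>

definition lefschetz_number :: "'a topology \<Rightarrow> ('a \<Rightarrow> 'a) \<Rightarrow> int"
  where "lefschetz_number X f =
    Sum_any (\<lambda>k::nat. (-1) ^ k *
      endo_trace (homology_group (int k) X) (hom_induced (int k) X {} X {} f))"

definition fixed_points :: "'a topology \<Rightarrow> ('a \<Rightarrow> 'a) \<Rightarrow> 'a set"
  where "fixed_points X g = {x \<in> topspace X. g x = x}"

text \<open>
  Minimum number of fixed points over all maps homotopic to \<open>f\<close> through maps preserving \<open>A1\<close> and
  \<open>A2\<close>; maps with infinitely many fixed points count as \<open>\<infinity>\<close>.
\<close>

definition triad_nielsen_number ::
    "'a topology \<Rightarrow> 'a set \<Rightarrow> 'a set \<Rightarrow> ('a \<Rightarrow> 'a) \<Rightarrow> enat"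
  where "triad_nielsen_number X A1 A2 f =
    (INF g \<in> {g. homotopic_with (\<lambda>h. h ` A1 \<subseteq> A1 \<and> h ` A2 \<subseteq> A2) X X f g}.
       if finite (fixed_points X g) then enat (card (fixed_points X g)) else \<infinity>)"

text \<open>
  For \<open>f\<close> mapping \<open>T\<close> into itself, the restriction of \<open>f\<close> to \<open>T\<close> extended to the one-point
  compactification; \<open>None\<close> is the point at infinity and is fixed by \<open>map_option f\<close>. When \<open>T\<close> is a
  torus minus a closed disk, this compactification is a torus.
\<close>

definition compactified_lefschetz_number :: "'a topology \<Rightarrow> 'a set \<Rightarrow> ('a \<Rightarrow> 'a) \<Rightarrow> int"
  where "compactified_lefschetz_number X T f =
    lefschetz_number (Alexandroff_compactification (subtopology X T)) (map_option f)"

end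

theory Submission
  imports Defs
begin

text \<open>
  A map homotopic to \<open>f\<close> through maps of the triad preserves the connecting sphere, hence descends to
  each summand with that sphere collapsed to a point. This quotient is again a torus, and the fixed
  points of the induced map are the collapse point and the fixed points in the open summand. So it
  suffices that a self-map \<open>g\<close> of a torus has at least \<open>\<bar>\<Lambda>(g)\<bar>\<close> fixed points.

  Up to a null-homotopic perturbation, \<open>g\<close> is induced by an integer matrix \<open>A\<close>. The degree of a
  linear map on a torus is multiplicative and additive in columns, hence equals the determinant;
  as \<open>H\<^sub>k\<close> of a torus has a basis given by the \<open>k\<close>-dimensional coordinate subtori, detected by the
  coordinate projections, the trace of \<open>g\<close> in degree \<open>k\<close> is the sum of the principal \<open>k\<close>-minors
  of \<open>A\<close>, and \<open>\<Lambda>(g) = det (1 - A)\<close>. Lifting to Euclidean space, each coset of the lattice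
  \<open>(1 - A) \<int>\<^sup>p\<close> in \<open>\<int>\<^sup>p\<close> yields a fixed point by Brouwer's theorem, and there are \<open>\<bar>det (1 - A)\<bar>\<close>
  such cosets.
\<close>

section \<open>Homology of a product with the circle\<close>

text \<open>The quotient by the connecting sphere is a torus because the disk embedding extends over
  all of Euclidean space: stretching the shell between radii 1 and 2 over the ball of radius 2
  collapses the unit ball and changes nothing farther out. A map homotopic to \<open>f\<close> in
  the triad may push points of a summand onto the sphere, so the induced map has to send such points
  to infinity and is not simply a \<open>map_option\<close>.

  Homology enters through a natural surjection from \<open>H_k(Y x circle)\<close> to
  \<open>H_(k-1)(Y)\<close> whose kernel comes from \<open>Y\<close>; no splitting or product
  structure is chosen. It makes the projections to coordinate subtori jointly injective, and the
  subtori are dual to them because two different ones of equal dimension meet in a smaller one.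

  Three statements about an integer matrix (number of cosets, degree of its torus map, solvability
  of the perturbed system) are reduced to diagonal matrices along row and column additions, which
  preserve the determinant.

  Each summand loses one fixed point, the point at infinity, so the argument costs 2 in total, one
  less than the 3 in the statement.\<close>

abbreviation circle :: "complex topology"
  where "circle \<equiv> top_of_set (sphere 0 1)"

abbreviation slab :: "'a topology \<Rightarrow> complex set \<Rightarrow> ('a \<times> complex) set"
  where "slab Y K \<equiv> topspace Y \<times> K"

abbreviation cyl :: "'a topology \<Rightarrow> ('a \<times> complex) topology"
  where "cyl Y \<equiv> prod_topology Y circle"

abbreviation strip :: "'a topology \<Rightarrow> complex set \<Rightarrow> ('a \<times> complex) topology"
  where "strip Y K \<equiv> subtopology (cyl Y) (slab Y K)"

section \<open>Strips over arcs and their deformations\<close>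

lemma strip_eq: "K \<subseteq> sphere 0 1 \<Longrightarrow> strip Y K = prod_topology Y (top_of_set K)"
  by (metis inf.absorb_iff2 prod_topology_subtopology(2) subtopology_subtopology)

lemma subtopology_strip: "subtopology (strip Y K) (slab Y L) = strip Y (K \<inter> L)"
  by (simp add: subtopology_subtopology Times_Int_Times)

lemma topspace_strip: "K \<subseteq> sphere 0 1 \<Longrightarrow> topspace (strip Y K) = slab Y K"
  by (auto simp: strip_eq)

text \<open>The homotopy runs along the straight segment from \<open>c\<close> to \<open>z\<close>,
  projected radially back to the circle by \<open>sgn\<close>. Keeping \<open>slab Y K'\<close>
  invariant at every stage makes it a homotopy of pairs.\<close>

lemma homotopic_with_chord:
  assumes K: "K \<subseteq> sphere 0 1" and c: "c \<in> K"
    and star: "\<And>z t. \<lbrakk>z \<in> K; 0 \<le> t; t \<le> 1\<rbrakk> \<Longrightarrow> t *\<^sub>R z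
        + (1-t) *\<^sub>R c \<noteq> 0 \<and> sgn (t *\<^sub>R z + (1-t) *\<^sub>R c) \<in> K"
    and star': "\<And>z t. \<lbrakk>z \<in> K'; 0 \<le> t; t \<le> 1\<rbrakk> \<Longrightarrow> sgn (t
        *\<^sub>R z + (1-t) *\<^sub>R c) \<in> K'"
    and K': "K' \<subseteq> K"
  shows "homotopic_with (\<lambda>h. h ` (slab Y K') \<subseteq> slab Y K') (strip Y K) (strip Y K)
      (\<lambda>(y,z). (y,c)) id"
proof -
  define k where "k = (\<lambda>(t::real,z::complex). sgn (t *\<^sub>R z + (1-t) *\<^sub>R c))"
  have contk: "continuous_map (top_of_set ({0..1} \<times> K)) (top_of_set K) k"
    unfolding k_def case_prod_unfold continuous_map_in_subtopology
    using star by (auto intro!: continuous_intros simp: split_def)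
  have *: "continuous_map (prod_topology (top_of_set {0..1}) (prod_topology Y (top_of_set K)))
     (top_of_set ({0..1} \<times> K)) (\<lambda>(t,(y,z)). (t,z))"
    unfolding prod_topology_subtopology_eu[symmetric] case_prod_unfold
    by (intro continuous_map_pairedI continuous_map_fst continuous_map_compose[OF continuous_map_snd
        continuous_map_snd, unfolded o_def])
  have "continuous_map (prod_topology (top_of_set {0..1}) (prod_topology Y (top_of_set K))) 
         (prod_topology Y (top_of_set K)) (\<lambda>(t,(y,z)). (y, k (t,z)))"
    unfolding case_prod_unfold
    apply (intro continuous_map_pairedI)
    subgoal by (rule continuous_map_compose[OF continuous_map_snd continuous_map_fst, unfolded o_def])
    subgoal using continuous_map_compose[OF * contk] by (simp add: o_def case_prod_unfold)
    done
  moreover have "k (0,z) = c" for z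
    using c K by (auto simp: k_def sgn_if sgn_div_norm)
  moreover have "k (1,z) = z" if "z \<in> K" for z
    using that K by (auto simp: k_def sgn_if sgn_div_norm)
  ultimately show ?thesis
    unfolding strip_eq[OF K]
    apply (subst homotopic_with)
    subgoal premises prems for h k
    proof -
      have "h ` (slab Y K') = k ` (slab Y K')"
        by (rule image_cong) (use prems K' in auto)
      then show ?thesis by simp
    qed
    apply (rule exI[of _ "\<lambda>(t,(y,z)). (y, k (t,z))"])
    using star' by (auto simp: k_def)
qed

text \<open>Since \<open>c\<close> lies in \<open>K'\<close>, the retraction onto the slice at
  \<open>c\<close> maps the whole strip into \<open>slab Y K'\<close>; the identity of the pair is
  thus homotopic to a map that factors through a pair with vanishing homology.\<close>

lemma trivial_relative_homology_strip:
  assumes K: "K \<subseteq> sphere 0 1" and c: "c \<in> K'" and K': "K' \<subseteq> K"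
    and star: "\<And>z t. \<lbrakk>z \<in> K; 0 \<le> t; t \<le> 1\<rbrakk> \<Longrightarrow> t *\<^sub>R z
        + (1-t) *\<^sub>R c \<noteq> 0 \<and> sgn (t *\<^sub>R z + (1-t) *\<^sub>R c) \<in> K"
    and star': "\<And>z t. \<lbrakk>z \<in> K'; 0 \<le> t; t \<le> 1\<rbrakk> \<Longrightarrow> sgn (t
        *\<^sub>R z + (1-t) *\<^sub>R c) \<in> K'"
  shows "trivial_group (relative_homology_group p (strip Y K) (slab Y K'))"
proof (rule trivial_relative_homology_group_alt)
  show "homotopic_with (\<lambda>k. k ` (slab Y K') \<subseteq> slab Y K') (strip Y K) (strip Y K)
      (\<lambda>(y,z). (y,c)) id"
    using assms by (intro homotopic_with_chord) auto
  have "continuous_map (strip Y K) (strip Y K) (\<lambda>(y,z). (y,c))"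
    using \<open>homotopic_with (\<lambda>k. k ` (slab Y K') \<subseteq> slab Y K') (strip Y K) (strip Y K)
        (\<lambda>(y,z). (y,c)) id\<close> homotopic_with_imp_continuous_maps by blast
  then show "continuous_map (strip Y K) (subtopology (strip Y K) (slab Y K')) (\<lambda>(y,z). (y,c))"
    unfolding continuous_map_in_subtopology using K c by (auto simp: topspace_strip)
qed

lemma iso_homology_strip:
  assumes K: "K \<subseteq> sphere 0 1" and c: "c \<in> K"
    and star: "\<And>z t. \<lbrakk>z \<in> K; 0 \<le> t; t \<le> 1\<rbrakk> \<Longrightarrow> t *\<^sub>R z
        + (1-t) *\<^sub>R c \<noteq> 0 \<and> sgn (t *\<^sub>R z + (1-t) *\<^sub>R c) \<in> K"
  shows "hom_induced p (strip Y K) {} Y {} fst \<in> iso (homology_group p (strip Y K)) (homology_group p Y)"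
    and "hom_induced p Y {} (strip Y K) {} (\<lambda>y. (y,c)) \<in> iso (homology_group p Y)
        (homology_group p (strip Y K))"
proof -
  have h: "homotopic_with (\<lambda>h. True) (strip Y K) (strip Y K) (\<lambda>(y,z). (y,c)) id"
    using homotopic_with_chord[OF K c star, where K'=K and Y=Y] star
    by (auto elim: homotopic_with_mono)
  have c1: "continuous_map Y (strip Y K) (\<lambda>y. (y,c))"
    using c by (auto simp: strip_eq[OF K] intro!: continuous_intros)
  have c2: "continuous_map (strip Y K) Y fst"
    by (simp add: continuous_map_subtopology_fst)
  have e: "(\<lambda>y. (y,c)) \<circ> fst = (\<lambda>(y,z). (y,c))" "fst \<circ> (\<lambda>y. (y,c)) = id"
    by auto
  show "hom_induced p (strip Y K) {} Y {} fst \<in> iso (homology_group p (strip Y K)) (homology_group p Y)"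
    by (rule homotopy_equivalence_homology_group_isomorphism[OF c2 c1]) (use h in \<open>auto simp: e\<close>)
  show "hom_induced p Y {} (strip Y K) {} (\<lambda>y. (y,c)) \<in> iso (homology_group p Y)
      (homology_group p (strip Y K))"
    by (rule homotopy_equivalence_homology_group_isomorphism[OF c1 c2]) (use h in \<open>auto simp: e\<close>)
qed

text \<open>
  The right and left arcs cover the circle and overlap in the upper and lower arcs. All but the right
  arc are cut out by half-planes through the origin, so they contain their normalized chords; the
  right arc contains those ending in 1.
\<close>

definition right_arc where "right_arc = {z::complex. norm z = 1 \<and> Re z + \<bar>Im z\<bar> > 0}"
definition left_arc where "left_arc = {z::complex. norm z = 1 \<and> Re z < 0}"
definition upper_arc where "upper_arc = {z::complex. norm z = 1 \<and> Re z < 0 \<and> Re z + Im z > 0}"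
definition lower_arc where "lower_arc = {z::complex. norm z = 1 \<and> Re z < 0 \<and> Re z - Im z > 0}"
definition cut_arcs where "cut_arcs = upper_arc \<union> lower_arc"

lemma arc_subsets:
  "right_arc \<subseteq> sphere 0 1" "left_arc \<subseteq> sphere 0 1" "cut_arcs \<subseteq> sphere 0 1"
      "upper_arc \<subseteq> sphere 0 1" "lower_arc \<subseteq> sphere 0 1"
  "upper_arc \<subseteq> cut_arcs" "lower_arc \<subseteq> cut_arcs" "cut_arcs \<subseteq> left_arc"
      "cut_arcs \<subseteq> right_arc" "lower_arc \<subseteq> left_arc" "upper_arc \<inter> lower_arc = {}"
  by (auto simp: right_arc_def left_arc_def cut_arcs_def upper_arc_def lower_arc_def)

lemma arc_eqs: "left_arc \<inter> right_arc = cut_arcs" "left_arc \<inter> cut_arcs = cut_arcs" "cut_arcs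
    \<inter> upper_arc = upper_arc"
  by (auto simp: right_arc_def left_arc_def cut_arcs_def upper_arc_def lower_arc_def)

definition halfplane :: "real \<Rightarrow> real \<Rightarrow> complex \<Rightarrow> bool"
  where "halfplane a b z \<longleftrightarrow> a * Re z + b * Im z > 0"

text \<open>A linear functional positive at both ends is positive along the segment, so the segment
  misses 0, and normalization only divides by a positive norm.\<close>

lemma halfplane_chord:
  assumes "halfplane a b z" "halfplane a b c" "0 \<le> t" "t \<le> 1"
  shows "t *\<^sub>R z + (1-t) *\<^sub>R c \<noteq> 0" "norm (sgn (t *\<^sub>R z + (1-t) *\<^sub>R c)) = 1"
    "halfplane a b (sgn (t *\<^sub>R z + (1-t) *\<^sub>R c))"
proof -
  define w where "w = t *\<^sub>R z + (1-t) *\<^sub>R c"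
  have "t * (a * Re z + b * Im z) + (1-t) * (a * Re c + b * Im c) > 0"
    using assms unfolding halfplane_def by (smt (verit, best) mult_nonneg_nonneg mult_pos_pos)
  then have pos: "a * Re w + b * Im w > 0"
    unfolding w_def by (simp add: algebra_simps)
  then have w: "w \<noteq> 0" by auto
  have "a * Re (sgn w) + b * Im (sgn w) = (a * Re w + b * Im w) / norm w"
    by (simp add: add_divide_distrib)
  then show "w \<noteq> 0" "norm (sgn w) = 1" "halfplane a b (sgn w)"
    using pos w by (simp_all add: norm_sgn halfplane_def)
qed

lemma arc_halfplanes:
  "z \<in> left_arc \<longleftrightarrow> norm z = 1 \<and> halfplane (-1) 0 z"
  "z \<in> upper_arc \<longleftrightarrow> norm z = 1 \<and> halfplane (-1) 0 z \<and> halfplane 1 1 z"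
  "z \<in> lower_arc \<longleftrightarrow> norm z = 1 \<and> halfplane (-1) 0 z \<and> halfplane 1 (-1) z"
  "z \<in> right_arc \<longleftrightarrow> norm z = 1 \<and> (halfplane 1 1 z \<or> halfplane 1 (-1) z)"
  by (auto simp: right_arc_def left_arc_def upper_arc_def lower_arc_def halfplane_def)

lemma star_arcs:
  assumes "0 \<le> t" "t \<le> 1"
  shows "\<lbrakk>z \<in> left_arc; c \<in> left_arc\<rbrakk> \<Longrightarrow> t *\<^sub>R z + (1-t)
      *\<^sub>R c \<noteq> 0 \<and> sgn (t *\<^sub>R z + (1-t) *\<^sub>R c) \<in> left_arc"
    and "\<lbrakk>z \<in> upper_arc; c \<in> upper_arc\<rbrakk> \<Longrightarrow> t *\<^sub>R z + (1-t)
        *\<^sub>R c \<noteq> 0 \<and> sgn (t *\<^sub>R z + (1-t) *\<^sub>R c) \<in> upper_arc"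
    and "\<lbrakk>z \<in> lower_arc; c \<in> lower_arc\<rbrakk> \<Longrightarrow> t *\<^sub>R z + (1-t)
        *\<^sub>R c \<noteq> 0 \<and> sgn (t *\<^sub>R z + (1-t) *\<^sub>R c) \<in> lower_arc"
    and "z \<in> right_arc \<Longrightarrow> t *\<^sub>R z + (1-t) *\<^sub>R 1 \<noteq> 0 \<and> sgn (t
        *\<^sub>R z + (1-t) *\<^sub>R 1) \<in> right_arc"
proof -
  \<comment> \<open>The point 1 lies in both half-planes whose union cuts out the right arc, so the
    chord from \<open>z\<close> stays in whichever of them contains \<open>z\<close>.\<close>
  have "halfplane 1 1 1" "halfplane 1 (-1) 1" by (auto simp: halfplane_def)
  then show "z \<in> right_arc \<Longrightarrow> t *\<^sub>R z + (1-t) *\<^sub>R 1 \<noteq> 0 \<and> sgn (t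
      *\<^sub>R z + (1-t) *\<^sub>R 1) \<in> right_arc"
    using halfplane_chord[OF _ _ assms] unfolding arc_halfplanes by blast
qed (unfold arc_halfplanes, (intro conjI; elim conjE; rule halfplane_chord[OF _ _ assms]; assumption)+)

text \<open>The points come from the triple 3, 4, 5, so that having norm 1 is rational
  arithmetic.\<close>

lemma arc_points: "1 \<in> right_arc" "Complex (-3/5) (-4/5) \<in> lower_arc" "Complex (-3/5) (4/5) \<in>
    upper_arc"
  by (auto simp: right_arc_def upper_arc_def lower_arc_def cmod_def power2_eq_square)

text \<open>The excised set is the closed right half circle. It lies in the open right arc, which
  reaches beyond it on both sides, and its complement in the circle is the left arc.\<close>

lemma excision_circle:
  "hom_induced p (strip Y left_arc) (slab Y cut_arcs) (cyl Y) (slab Y right_arc) id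
    \<in> iso (relative_homology_group p (strip Y left_arc) (slab Y cut_arcs))
          (relative_homology_group p (cyl Y) (slab Y right_arc))"
proof -
  define U where "U = {z::complex. norm z = 1 \<and> Re z \<ge> 0}"
  have U: "closedin circle U"
  proof -
    have "U = sphere 0 1 \<inter> {z. Re z \<ge> 0}" by (auto simp: U_def)
    then show ?thesis by (simp add: closedin_closed_Int closed_halfspace_Re_ge)
  qed
  have L: "openin circle right_arc"
  proof -
    have "right_arc = sphere 0 1 \<inter> {z. Re z + \<bar>Im z\<bar> > 0}" by (auto simp: right_arc_def)
    moreover have "open {z. Re z + \<bar>Im z\<bar> > 0}"
      by (intro open_Collect_less continuous_intros)
    ultimately show ?thesis using openin_open by blast
  qed
  have UL: "U \<subseteq> right_arc"
  proof
    fix z assume z: "z \<in> U"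
    have "z \<noteq> 0" using z by (auto simp: U_def)
    then have "Re z = 0 \<Longrightarrow> Im z \<noteq> 0" by (auto simp: complex_eq_iff)
    then show "z \<in> right_arc" using z by (cases "Re z = 0") (auto simp: U_def right_arc_def)
  qed
  have "cyl Y closure_of (slab Y U) \<subseteq> cyl Y interior_of (slab Y right_arc)"
    using U L UL by (auto simp: closure_of_Times interior_of_Times closure_of_closedin interior_of_openin)
  then have "hom_induced p (subtopology (cyl Y) (topspace Y \<times> sphere 0 1 - slab Y U)) (slab Y
      right_arc - slab Y U) 
     (subtopology (cyl Y) (topspace Y \<times> sphere 0 1)) (slab Y right_arc) id
    \<in> iso (relative_homology_group p (subtopology (cyl Y) (topspace Y \<times> sphere 0 1 - slab Y U))
        (slab Y right_arc - slab Y U))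
          (relative_homology_group p (subtopology (cyl Y) (topspace Y \<times> sphere 0 1)) (slab Y right_arc))"
    by (rule homology_excision_axiom) (use arc_subsets in auto)
  moreover have "topspace Y \<times> sphere 0 1 - slab Y U = slab Y left_arc"
    by (auto simp: U_def left_arc_def)
  moreover have "slab Y right_arc - slab Y U = slab Y cut_arcs"
    unfolding arc_eqs(1)[symmetric] by (auto simp: U_def left_arc_def right_arc_def)
  moreover have "subtopology (cyl Y) (topspace Y \<times> sphere 0 1) = cyl Y"
    by (metis topspace_prod_topology topspace_euclidean_subtopology subtopology_topspace)
  ultimately show ?thesis by simp
qed

text \<open>The two components of the cut are separated by the sign of the imaginary part, so
  \<open>lower_arc\<close> is open and closed in \<open>cut_arcs\<close> and can be excised
  entirely.\<close>

lemma excision_arcs: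
  "hom_induced p (strip Y upper_arc) {} (strip Y cut_arcs) (slab Y lower_arc) id
    \<in> iso (homology_group p (strip Y upper_arc)) (relative_homology_group p (strip Y cut_arcs) (slab Y
        lower_arc))"
proof -
  have 1: "lower_arc = cut_arcs \<inter> {z. Im z < 0}" "lower_arc = cut_arcs \<inter> {z. Im z \<le> 0}"
    by (auto simp: cut_arcs_def upper_arc_def lower_arc_def)
  have "openin (top_of_set cut_arcs) lower_arc" "closedin (top_of_set cut_arcs) lower_arc"
    unfolding 1(1) apply (simp add: openin_open_Int open_halfspace_Im_lt)
    unfolding 1(1)[symmetric] unfolding 1(2) by (simp add: closedin_closed_Int closed_halfspace_Im_le)
  then have "strip Y cut_arcs closure_of (slab Y lower_arc) \<subseteq> strip Y cut_arcs interior_of (slab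
      Y lower_arc)"
    unfolding strip_eq[OF arc_subsets(3)]
    by (auto simp: closure_of_Times interior_of_Times closure_of_closedin interior_of_openin)
  then have "hom_induced p (subtopology (strip Y cut_arcs) (slab Y cut_arcs - slab Y lower_arc)) (slab Y
      lower_arc - slab Y lower_arc) 
     (subtopology (strip Y cut_arcs) (slab Y cut_arcs)) (slab Y lower_arc) id
    \<in> iso (relative_homology_group p (subtopology (strip Y cut_arcs) (slab Y cut_arcs - slab Y
        lower_arc)) (slab Y lower_arc - slab Y lower_arc))
          (relative_homology_group p (subtopology (strip Y cut_arcs) (slab Y cut_arcs)) (slab Y lower_arc))"
    by (rule homology_excision_axiom) (use arc_subsets in auto)
  moreover have "slab Y cut_arcs - slab Y lower_arc = slab Y upper_arc"
    using arc_subsets by (auto simp: cut_arcs_def)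
  ultimately show ?thesis by (simp add: subtopology_strip arc_eqs)
qed

lemma exact_iso_middle:
  assumes "exact_seq ([D,C,B,A], [h,g,f])" "trivial_group A" "trivial_group D"
  shows "g \<in> iso B C"
proof -
  have "group A" "group B" "group C" "group D" and f: "f \<in> hom A B" and g: "g \<in> hom B C" and h: "h
      \<in> hom C D" 
    and e: "f ` carrier A = kernel B C g" "g ` carrier B = kernel C D h"
    using assms by (auto simp: group_hom_def group_hom_axioms_def)
  have "kernel B C g = {\<one>\<^bsub>B\<^esub>}"
    using assms(2) f e(1) \<open>group A\<close> \<open>group B\<close> by (metis hom_one image_empty
        image_insert trivial_group_def)
  then have "inj_on g (carrier B)"
    using \<open>group B\<close> \<open>group C\<close> g by (metis group_hom.inj_iff_trivial_ker
        group_hom.intro group_hom_axioms.intro)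
  moreover have "g ` carrier B = carrier C"
    unfolding e(2) kernel_def using assms(3) h unfolding trivial_group_def hom_def by auto
  ultimately show ?thesis using g by (auto simp: iso_def bij_betw_def)
qed

text \<open>The left and the lower strip both contract to the slice at a point of the lower arc, so
  the pair they form has no homology, and the exact sequence of the triple left, cut, lower isolates
  the boundary map.\<close>

lemma relboundary_circle_iso:
  "hom_relboundary p (strip Y left_arc) (slab Y cut_arcs) (slab Y lower_arc)
    \<in> iso (relative_homology_group p (strip Y left_arc) (slab Y cut_arcs))
          (relative_homology_group (p-1) (strip Y cut_arcs) (slab Y lower_arc))"
proof (rule exact_iso_middle)
  have T: "slab Y lower_arc \<subseteq> slab Y cut_arcs" using arc_subsets by auto
  show "exact_seq ([relative_homology_group(p-1) (strip Y left_arc) (slab Y lower_arc),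
                     relative_homology_group (p-1) (strip Y cut_arcs) (slab Y lower_arc), 
                     relative_homology_group p (strip Y left_arc) (slab Y cut_arcs), 
                     relative_homology_group p (strip Y left_arc) (slab Y lower_arc)],
                    [hom_induced (p-1) (strip Y cut_arcs) (slab Y lower_arc) (strip Y left_arc) (slab Y
                        lower_arc) id,
                    hom_relboundary p (strip Y left_arc) (slab Y cut_arcs) (slab Y lower_arc), 
                     hom_induced p (strip Y left_arc) (slab Y lower_arc) (strip Y left_arc) (slab Y cut_arcs) id])"
    using homology_exactness_triple_1[OF T, of p "strip Y left_arc"] homology_exactness_triple_2[OF T, of p
        "strip Y left_arc"]
    by (simp add: subtopology_strip arc_eqs)
  have left_arc: "Complex (-3/5) (-4/5) \<in> left_arc" using arc_points arc_subsets by blast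
  have triv: "trivial_group (relative_homology_group p (strip Y left_arc) (slab Y lower_arc))" for p
    by (rule trivial_relative_homology_strip[OF arc_subsets(2) arc_points(2) arc_subsets(10)])
      (use star_arcs left_arc arc_points in blast)+
  show "trivial_group (relative_homology_group p (strip Y left_arc) (slab Y lower_arc))"
    "trivial_group (relative_homology_group (p-1) (strip Y left_arc) (slab Y lower_arc))"
    by (fact triv)+
qed

text \<open>
  The composite \<open>H\<^sub>p(Y \<times> S\<^sup>1) \<rightarrow> H\<^sub>p(Y \<times> S\<^sup>1, Y
      \<times> right) \<cong> H\<^sub>p(Y \<times> left, Y \<times> cut) \<cong>
      H\<^sub>p\<^sub>-\<^sub>1(Y \<times> cut, Y \<times> lower)
  \<cong> H\<^sub>p\<^sub>-\<^sub>1(Y \<times> upper) \<cong> H\<^sub>p\<^sub>-\<^sub>1(Y)\<close>: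
      excision, the boundary of a triple, excision, projection.
\<close>

definition circle_slant :: "int \<Rightarrow> 'a topology \<Rightarrow> ('a \<times> complex) chain set
    \<Rightarrow> 'a chain set"
  where "circle_slant p Y =
    hom_induced (p-1) (strip Y upper_arc) {} Y {} fst \<circ>
    inv_into (carrier (homology_group (p-1) (strip Y upper_arc)))
      (hom_induced (p-1) (strip Y upper_arc) {} (strip Y cut_arcs) (slab Y lower_arc) id) \<circ>
    hom_relboundary p (strip Y left_arc) (slab Y cut_arcs) (slab Y lower_arc) \<circ>
    inv_into (carrier (relative_homology_group p (strip Y left_arc) (slab Y cut_arcs)))
      (hom_induced p (strip Y left_arc) (slab Y cut_arcs) (cyl Y) (slab Y right_arc) id) \<circ>
    hom_induced p (cyl Y) {} (cyl Y) (slab Y right_arc) id"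

text \<open>Everything after relativization is an isomorphism, so kernel and surjectivity of the
  slant map are decided by its first factor.\<close>

lemma circle_slant_decompose:
  obtains \<psi> where "\<psi> \<in> iso (relative_homology_group p (cyl Y) (slab Y right_arc))
      (homology_group (p-1) Y)"
    "circle_slant p Y = \<psi> \<circ> hom_induced p (cyl Y) {} (cyl Y) (slab Y right_arc) id"
proof -
  have i4: "hom_induced (p-1) (strip Y upper_arc) {} Y {} fst \<in> iso (homology_group (p-1) (strip Y
      upper_arc)) (homology_group (p-1) Y)"
    by (rule iso_homology_strip[OF _ arc_points(3)]) (use arc_points star_arcs arc_subsets in auto)
  note i1 = group.iso_set_sym[OF group_relative_homology_group excision_circle[of p Y]]
  note i2 = relboundary_circle_iso[of p Y]
  note i3 = group.iso_set_sym[OF group_relative_homology_group excision_arcs[of "p-1" Y]]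
  note iso_set_trans[OF iso_set_trans[OF iso_set_trans[OF i1 i2] i3] i4]
  then show thesis
    by (intro that) (auto simp: circle_slant_def o_assoc)
qed

lemma hom_circle_slant: "circle_slant p Y \<in> hom (homology_group p (cyl Y)) (homology_group (p-1) Y)"
proof (rule circle_slant_decompose[of p Y])
  fix \<psi> assume "\<psi> \<in> iso (relative_homology_group p (cyl Y) (slab Y right_arc))
      (homology_group (p-1) Y)"
    "circle_slant p Y = \<psi> \<circ> hom_induced p (cyl Y) {} (cyl Y) (slab Y right_arc) id"
  then show ?thesis
    by (auto intro!: hom_compose[OF hom_induced_hom] simp: iso_def)
qed

text \<open>The right strip retracts onto the slice at 1, which gives the kernel. Followed by
  \<open>fst\<close>, the inclusion of that strip is an isomorphism on homology; so the inclusion is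
  injective, the boundary map vanishes and \<open>j\<close> is onto.\<close>

lemma homology_circle_relativization:
  fixes Y :: "'a topology" and p :: int
  defines "j \<equiv> hom_induced p (cyl Y) {} (cyl Y) (slab Y right_arc) id"
  shows "kernel (homology_group p (cyl Y)) (relative_homology_group p (cyl Y) (slab Y right_arc)) j
      = hom_induced p Y {} (cyl Y) {} (\<lambda>y. (y,1)) ` carrier (homology_group p Y)"
    and "j ` carrier (homology_group p (cyl Y)) = carrier (relative_homology_group p (cyl Y) (slab Y right_arc))"
proof -
  let ?P = "cyl Y" and ?L = "slab Y right_arc"
  let ?s = "\<lambda>p. hom_induced p Y {} (strip Y right_arc) {} (\<lambda>y. (y,1))"
  let ?i = "\<lambda>p. hom_induced p (strip Y right_arc) {} ?P {} id"
  have iso: "?s p \<in> iso (homology_group p Y) (homology_group p (strip Y right_arc))" 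
    "hom_induced p (strip Y right_arc) {} Y {} fst \<in> iso (homology_group p (strip Y right_arc))
        (homology_group p Y)" for p
    by (rule iso_homology_strip[OF arc_subsets(1) arc_points(1)]; use star_arcs in blast)+
  have c: "continuous_map Y (strip Y right_arc) (\<lambda>y. (y,1))"
    using arc_points arc_subsets by (auto simp: strip_eq intro!: continuous_intros)
  have "kernel (homology_group p ?P) (relative_homology_group p ?P ?L) j = ?i p ` carrier (homology_group p
      (strip Y right_arc))"
    using homology_exactness_axiom_3[of p ?P ?L] unfolding j_def by simp
  also have "\<dots> = ?i p ` ?s p ` carrier (homology_group p Y)"
    using iso[of p] by (simp add: iso_def bij_betw_def)
  also have "\<dots> = hom_induced p Y {} ?P {} (\<lambda>y. (y,1)) ` carrier (homology_group p Y)"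
    unfolding image_image using c
    by (subst hom_induced_compose') (auto simp: o_def intro: continuous_map_from_subtopology)
  finally show "kernel (homology_group p ?P) (relative_homology_group p ?P ?L) j
      = hom_induced p Y {} ?P {} (\<lambda>y. (y,1)) ` carrier (homology_group p Y)" .
  have "hom_induced (p-1) ?P {} Y {} fst \<circ> ?i (p-1) = hom_induced (p-1) (strip Y right_arc) {} Y {} fst"
    by (subst hom_induced_compose[symmetric]) (auto simp: o_def id_def intro:
        continuous_map_from_subtopology continuous_map_fst)
  then have "inj_on (?i (p-1)) (carrier (homology_group (p-1) (strip Y right_arc)))"
    using iso(2)[of "p-1"] unfolding iso_def bij_betw_def by (metis (no_types, lifting) inj_on_imageI2
        mem_Collect_eq)
  then have "trivial_homomorphism (relative_homology_group p ?P ?L) (homology_group (p-1) (strip Y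
      right_arc)) (hom_boundary p ?P ?L)"
    using exact_seq_mon_eq_triviality by (metis exact_seq_cons_iff homology_exactness_axiom_1
        homology_exactness_axiom_2)
  then show "j ` carrier (homology_group p ?P) = carrier (relative_homology_group p ?P ?L)"
    unfolding j_def using exact_seq_epi_eq_triviality by (metis exact_seq_cons_iff
        homology_exactness_axiom_1 homology_exactness_axiom_2)
qed

lemma kernel_circle_slant:
  "kernel (homology_group p (cyl Y)) (homology_group (p-1) Y) (circle_slant p Y)
    = hom_induced p Y {} (cyl Y) {} (\<lambda>y. (y,1)) ` carrier (homology_group p Y)"
proof (rule circle_slant_decompose[of p Y])
  fix \<psi> assume \<psi>: "\<psi> \<in> iso (relative_homology_group p (cyl Y) (slab Y right_arc))
      (homology_group (p-1) Y)"
    "circle_slant p Y = \<psi> \<circ> hom_induced p (cyl Y) {} (cyl Y) (slab Y right_arc) id"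
  have "\<psi> x = \<one>\<^bsub>homology_group (p-1) Y\<^esub> \<longleftrightarrow> x =
      \<one>\<^bsub>relative_homology_group p (cyl Y) (slab Y right_arc)\<^esub>"
    if "x \<in> carrier (relative_homology_group p (cyl Y) (slab Y right_arc))" for x
    using \<psi>(1) that unfolding iso_iff
    by (metis group_relative_homology_group hom_one inj_on_eq_iff group.is_monoid monoid.one_closed)
  then show ?thesis
    unfolding homology_circle_relativization(1)[symmetric] kernel_def \<psi>(2) by (auto simp: hom_induced_carrier)
qed

lemma surj_circle_slant:
  "circle_slant p Y ` carrier (homology_group p (cyl Y)) = carrier (homology_group (p-1) Y)"
proof (rule circle_slant_decompose[of p Y])
  fix \<psi> assume \<psi>: "\<psi> \<in> iso (relative_homology_group p (cyl Y) (slab Y right_arc))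
      (homology_group (p-1) Y)"
    "circle_slant p Y = \<psi> \<circ> hom_induced p (cyl Y) {} (cyl Y) (slab Y right_arc) id"
  then show ?thesis
    unfolding \<psi>(2) image_comp[symmetric] homology_circle_relativization(2) by (auto simp: iso_def
        bij_betw_def)
qed

text \<open>Carries a commuting square over to inverted isomorphisms, for the two excisions that
  \<open>circle_slant\<close> uses backwards.\<close>

lemma inv_into_iso_square:
  assumes "e \<in> iso G H" "e' \<in> iso G' H'" "y \<in> carrier H" 
    and "\<And>x. x \<in> carrier G \<Longrightarrow> a x \<in> carrier G'"
    and "\<And>x. x \<in> carrier G \<Longrightarrow> e' (a x) = b (e x)"
  shows "inv_into (carrier G') e' (b y) = a (inv_into (carrier G) e y)"
proof -
  obtain x where x: "x \<in> carrier G" "y = e x"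
    using assms(1,3) by (auto simp: iso_def bij_betw_def)
  then show ?thesis
    using assms by (metis bij_betw_def inv_into_f_f iso_iff)
qed

lemma continuous_map_strip:
  assumes "continuous_map Y Z f"
  shows "continuous_map (strip Y K) (strip Z K) (\<lambda>(y,z). (f y, z))"
    "continuous_map (cyl Y) (cyl Z) (\<lambda>(y,z). (f y, z))"
    "(\<lambda>(y,z). (f y, z)) \<in> slab Y K \<rightarrow> slab Z K"
proof -
  show *: "(\<lambda>(y,z). (f y, z)) \<in> slab Y K \<rightarrow> slab Z K" for K :: "complex set"
    using assms by (auto simp: continuous_map_def)
  show c: "continuous_map (cyl Y) (cyl Z) (\<lambda>(y,z). (f y, z))"
    unfolding case_prod_unfold using assms
    by (auto intro!: continuous_intros continuous_map_compose[OF continuous_map_fst, unfolded o_def])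
  have "(\<lambda>(y,z). (f y, z)) ` topspace (strip Y K) \<subseteq> slab Z K"
    using *[of K] by (force simp: topspace_subtopology)
  then show "continuous_map (strip Y K) (strip Z K) (\<lambda>(y,z). (f y, z))"
    unfolding continuous_map_in_subtopology using c by (auto intro: continuous_map_from_subtopology)
qed

text \<open>The product of \<open>f\<close> with the identity of the circle respects every slab, so
  each of the five factors of the slant map has its own naturality square; two of these squares have
  inverted excisions as sides.\<close>

lemma naturality_circle_slant:
  assumes f: "continuous_map Y Z f" and x: "x \<in> carrier (homology_group p (cyl Y))"
  shows "circle_slant p Z (hom_induced p (cyl Y) {} (cyl Z) {} (\<lambda>(y,z). (f y, z)) x)
    = hom_induced (p-1) Y {} Z {} f (circle_slant p Y x)"
proof -
  note c = continuous_map_strip[OF f]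
  let ?F = "\<lambda>(y,z). (f y, z)"
  let ?PY = "cyl Y" and ?PZ = "cyl Z"
  have sub: "id \<in> slab Y cut_arcs \<rightarrow> slab Y right_arc" for Y :: "'z topology" using
      arc_subsets by auto
  have sub2: "id \<in> {} \<rightarrow> slab Y lower_arc" "?F \<in> {} \<rightarrow> {}" for Y :: "'z
      topology" by auto
  have contid: "continuous_map (strip Y left_arc) (cyl Y) id" "continuous_map (strip Y upper_arc) (strip Y
      cut_arcs) id" for Y :: "'z topology"
    using arc_subsets by (auto simp: continuous_map_in_subtopology continuous_map_from_subtopology topspace_strip)
  have 1: "hom_induced p ?PZ {} ?PZ (slab Z right_arc) id (hom_induced p ?PY {} ?PZ {} ?F x) = 
      hom_induced p ?PY (slab Y right_arc) ?PZ (slab Z right_arc) ?F (hom_induced p ?PY {} ?PY (slab Y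
          right_arc) id x)"
    using c by (simp add: hom_induced_compose')
  have 2: "inv_into (carrier (relative_homology_group p (strip Z left_arc) (slab Z cut_arcs)))
      (hom_induced p (strip Z left_arc) (slab Z cut_arcs) ?PZ (slab Z right_arc) id)
      (hom_induced p ?PY (slab Y right_arc) ?PZ (slab Z right_arc) ?F y) = 
     hom_induced p (strip Y left_arc) (slab Y cut_arcs) (strip Z left_arc) (slab Z cut_arcs) ?F
      (inv_into (carrier (relative_homology_group p (strip Y left_arc) (slab Y cut_arcs)))
      (hom_induced p (strip Y left_arc) (slab Y cut_arcs) ?PY (slab Y right_arc) id) y)"
    if "y \<in> carrier (relative_homology_group p ?PY (slab Y right_arc))" for y
    by (rule inv_into_iso_square[OF excision_circle excision_circle that])
      (simp_all only: hom_induced_carrier hom_induced_compose'[OF c(1,3) contid(1) sub]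
        hom_induced_compose'[OF contid(1) sub c(2,3)] comp_id id_comp)
  have 3: "hom_relboundary p (strip Z left_arc) (slab Z cut_arcs) (slab Z lower_arc)
     (hom_induced p (strip Y left_arc) (slab Y cut_arcs) (strip Z left_arc) (slab Z cut_arcs) ?F y) =
     hom_induced (p-1) (strip Y cut_arcs) (slab Y lower_arc) (strip Z cut_arcs) (slab Z lower_arc) ?F
      (hom_relboundary p (strip Y left_arc) (slab Y cut_arcs) (slab Y lower_arc) y)" for y
    using naturality_hom_induced_relboundary[OF c(1,3,3), of p left_arc cut_arcs lower_arc]
    by (simp add: subtopology_strip arc_eqs fun_eq_iff)
  have 4: "inv_into (carrier (homology_group (p-1) (strip Z upper_arc)))
      (hom_induced (p-1) (strip Z upper_arc) {} (strip Z cut_arcs) (slab Z lower_arc) id)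
      (hom_induced (p-1) (strip Y cut_arcs) (slab Y lower_arc) (strip Z cut_arcs) (slab Z lower_arc) ?F y) = 
     hom_induced (p-1) (strip Y upper_arc) {} (strip Z upper_arc) {} ?F
      (inv_into (carrier (homology_group (p-1) (strip Y upper_arc)))
      (hom_induced (p-1) (strip Y upper_arc) {} (strip Y cut_arcs) (slab Y lower_arc) id) y)"
    if "y \<in> carrier (relative_homology_group (p-1) (strip Y cut_arcs) (slab Y lower_arc))" for y
    by (rule inv_into_iso_square[OF excision_arcs excision_arcs that])
      (simp_all only: hom_induced_carrier hom_induced_compose'[OF c(1) sub2(2) contid(2) sub2(1)]
        hom_induced_compose'[OF contid(2) sub2(1) c(1,3)] comp_id id_comp)
  have 5: "hom_induced (p-1) (strip Z upper_arc) {} Z {} fst (hom_induced (p-1) (strip Y upper_arc) {}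
      (strip Z upper_arc) {} ?F y)
     = hom_induced (p-1) Y {} Z {} f (hom_induced (p-1) (strip Y upper_arc) {} Y {} fst y)" for y
    using c f by (simp add: hom_induced_compose' continuous_map_subtopology_fst o_def case_prod_unfold)
  have 6: "hom_relboundary p (strip Y left_arc) (slab Y cut_arcs) (slab Y lower_arc) y
     \<in> carrier (relative_homology_group (p-1) (strip Y cut_arcs) (slab Y lower_arc))" for y
    using hom_relboundary[of p "strip Y left_arc" "slab Y cut_arcs" "slab Y lower_arc" y]
    by (simp add: subtopology_strip arc_eqs)
  show ?thesis
    unfolding circle_slant_def o_def
    by (simp add: 1 2 3 4 5 6 hom_induced_carrier)
qed

section \<open>Traces modulo torsion\<close>

lemma hom_integer_finprod:
  assumes "comm_group G" "h \<in> hom G integer_group" "finite A" "g \<in> A \<rightarrow> carrier G"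
  shows "h (finprod G g A) = (\<Sum>a\<in>A. h (g a))"
  using assms(3,4)
proof (induction A rule: finite_induct)
  interpret G: comm_group G by fact
  case empty
  then show ?case
    using hom_one[OF assms(2)] G.is_group group_integer_group by (simp add: G.finprod_empty)
next
  interpret G: comm_group G by fact
  case (insert a A)
  then show ?case
    using assms(2) by (simp add: G.finprod_insert hom_def Pi_iff G.finprod_closed)
qed

lemma hom_integer_int_pow:
  assumes "group G" "h \<in> hom G integer_group" "x \<in> carrier G"
  shows "h (x [^]\<^bsub>G\<^esub> (n::int)) = n * h x"
proof -
  interpret group_hom G integer_group h
    using assms by (simp add: group_hom_def group_hom_axioms_def)
  show ?thesis
    using hom_int_pow[OF assms(3), of n] by simp
qed

text \<open>The \<open>b k\<close> and \<open>c k\<close> are dual to each other: jointly injective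
  functionals into the integers exclude torsion and make the \<open>b k\<close> a free basis. As
  \<open>endo_trace\<close> quantifies over all bases, independence of the basis has to be shown as
  well.\<close>

lemma endo_trace_eq:
  fixes G :: "('g, 'm) monoid_scheme"
  assumes G: "comm_group G" and \<phi>: "\<phi> \<in> hom G G" and K: "finite K"
    and c: "\<And>k. k \<in> K \<Longrightarrow> c k \<in> hom G integer_group"
    and b: "\<And>k. k \<in> K \<Longrightarrow> b k \<in> carrier G"
    and cb: "\<And>j k. \<lbrakk>j \<in> K; k \<in> K\<rbrakk> \<Longrightarrow> c k (b j) = (if j = k then
        1 else 0)"
    and ker: "\<And>x. \<lbrakk>x \<in> carrier G; \<And>k. k \<in> K \<Longrightarrow> c k x = 0\<rbrakk>
        \<Longrightarrow> x = \<one>\<^bsub>G\<^esub>"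
  shows "endo_trace G \<phi> = (\<Sum>k\<in>K. c k (\<phi> (b k)))"
proof -
  interpret G: comm_group G by fact
  note hfin = hom_integer_finprod[OF G] and hpow = hom_integer_int_pow[OF G.is_group]
  have tors: "torsion_elements G = {\<one>\<^bsub>G\<^esub>}"
  proof -
    have "x = \<one>\<^bsub>G\<^esub>" if "x \<in> carrier G" "(n::nat) > 0" "x [^]\<^bsub>G\<^esub> n =
        \<one>\<^bsub>G\<^esub>" for x n
    proof (rule ker)
      fix k assume k: "k \<in> K"
      have "int n * c k x = c k (x [^]\<^bsub>G\<^esub> int n)" using hpow[OF c[OF k] that(1)] by simp
      also have "\<dots> = 0" using that(3) hom_one[OF c[OF k] G.is_group group_integer_group] by (simp
          add: int_pow_int)
      finally show "c k x = 0" using that(2) by simp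
    qed fact
    then show ?thesis
      unfolding torsion_elements_def by (auto intro!: exI[of _ "1::nat"])
  qed
  have coord_iff: "coordinates_mod_torsion G B x d \<longleftrightarrow> d \<in> B \<rightarrow>\<^sub>E
      UNIV \<and> x = finprod G (\<lambda>b. b [^]\<^bsub>G\<^esub> d b) B"
    if "B \<subseteq> carrier G" "x \<in> carrier G" for B x d
  proof -
    have *: "finprod G (\<lambda>b. b [^]\<^bsub>G\<^esub> d b) B \<in> carrier G"
      using that by (intro G.finprod_closed) auto
    show ?thesis
      unfolding coordinates_mod_torsion_def tors 
      using that(2) * G.inv_solve_right[of "\<one>\<^bsub>G\<^esub>" x "finprod G (\<lambda>b. b
          [^]\<^bsub>G\<^esub> d b) B"] by auto
  qed
  \<comment> \<open>\<open>x\<close> and the combination \<open>?y\<close> take the same value under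
    every \<open>c k\<close>, so joint injectivity identifies them.\<close>
  have expand: "h x = (\<Sum>k\<in>K. c k x * h (b k))" if "h \<in> hom G integer_group" "x \<in> carrier
      G" for h x
  proof -
    let ?y = "finprod G (\<lambda>k. b k [^]\<^bsub>G\<^esub> c k x) K"
    have y: "?y \<in> carrier G" using b by (intro G.finprod_closed) auto
    have hy: "h' ?y = (\<Sum>k\<in>K. c k x * h' (b k))" if "h' \<in> hom G integer_group" for h'
      using b by (subst hfin[OF that K]) (auto intro!: sum.cong hpow[OF that])
    have "x \<otimes>\<^bsub>G\<^esub> inv\<^bsub>G\<^esub> ?y = \<one>\<^bsub>G\<^esub>"
    proof (rule ker)
      fix k assume k: "k \<in> K"
      have "c k ?y = (\<Sum>j\<in>K. c j x * (if j = k then 1 else 0))"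
        unfolding hy[OF c[OF k]] using cb k by (intro sum.cong) auto
      also have "\<dots> = c k x" using K k by (simp add: if_distrib[of "\<lambda>a. _ * a"] cong: if_cong)
      finally have "c k ?y = c k x" .
      moreover have "c k (inv\<^bsub>G\<^esub> ?y) = - c k ?y"
        using hpow[OF c[OF k] y, of "-1"] y by (simp add: G.int_pow_neg G.int_pow_1)
      ultimately show "c k (x \<otimes>\<^bsub>G\<^esub> inv\<^bsub>G\<^esub> ?y) = 0"
        using c[OF k] y that(2) by (simp add: hom_def)
    qed (use y that in auto)
    then have "x = ?y" using y that(2) by (metis G.inv_solve_right G.l_one G.one_closed)
    then show ?thesis using hy[OF that(1)] by metis
  qed
  have injb: "inj_on b K" using cb by (intro inj_onI) (metis zero_neq_one)
  define B0 where "B0 = b ` K"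
  have B0: "B0 \<subseteq> carrier G" "finite B0" using b K by (auto simp: B0_def)
  have B0coord: "coordinates_mod_torsion G B0 x d \<longleftrightarrow> d = (\<lambda>\<beta>\<in>B0. c
      (the_inv_into K b \<beta>) x)" 
    if x: "x \<in> carrier G" for x d
  proof -
    have cd: "c k (finprod G (\<lambda>b. b [^]\<^bsub>G\<^esub> d b) B0) = d (b k)" if "k \<in> K" for k
        and d :: "'g \<Rightarrow> int"
    proof -
      have "c k (finprod G (\<lambda>b. b [^]\<^bsub>G\<^esub> d b) B0) = (\<Sum>\<beta>\<in>B0. d \<beta>
          * c k \<beta>)"
        using B0 by (subst hfin[OF c[OF that]]) (auto intro!: sum.cong hpow[OF c[OF that]])
      also have "\<dots> = (\<Sum>j\<in>K. d (b j) * (if j = k then 1 else 0))"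
        unfolding B0_def using injb cb that by (simp add: sum.reindex cong: sum.cong)
      also have "\<dots> = d (b k)" using K that by (simp add: if_distrib[of "\<lambda>a. _ * a"] cong: if_cong)
      finally show ?thesis .
    qed
    show ?thesis
    proof
      assume "coordinates_mod_torsion G B0 x d"
      then have d: "d \<in> B0 \<rightarrow>\<^sub>E UNIV" "x = finprod G (\<lambda>b. b
          [^]\<^bsub>G\<^esub> d b) B0" using coord_iff[OF B0(1) x] by auto
      show "d = (\<lambda>\<beta>\<in>B0. c (the_inv_into K b \<beta>) x)"
      proof (rule ext)
        fix \<beta> show "d \<beta> = (\<lambda>\<beta>\<in>B0. c (the_inv_into K b \<beta>) x) \<beta>"
          using cd[of _ d] d injb by (auto simp: B0_def the_inv_into_f_f PiE_def extensional_def)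
      qed
    next
      assume d: "d = (\<lambda>\<beta>\<in>B0. c (the_inv_into K b \<beta>) x)"
      let ?y = "finprod G (\<lambda>b. b [^]\<^bsub>G\<^esub> d b) B0"
      have y: "?y \<in> carrier G" using B0 by (intro G.finprod_closed) auto
      have "c k (x \<otimes>\<^bsub>G\<^esub> inv\<^bsub>G\<^esub> ?y) = 0" if k: "k \<in> K" for k
      proof -
        have "c k ?y = c k x"
          using cd[OF k, of d] k injb by (simp add: d B0_def the_inv_into_f_f)
        moreover have "c k (inv\<^bsub>G\<^esub> ?y) = - c k ?y"
          using hpow[OF c[OF k] y, of "-1"] y by (simp add: G.int_pow_neg G.int_pow_1)
        ultimately show ?thesis
          using c[OF k] y x by (simp add: hom_def)
      qed
      then have "x \<otimes>\<^bsub>G\<^esub> inv\<^bsub>G\<^esub> ?y = \<one>\<^bsub>G\<^esub>" using y x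
          by (intro ker) auto
      then have "x = ?y" using y x by (metis G.inv_solve_right G.l_one G.one_closed)
      then show "coordinates_mod_torsion G B0 x d" unfolding coord_iff[OF B0(1) x] using d by auto
    qed
  qed
  \<comment> \<open>This is the identity trace(PQ) = trace(QP) for the two changes of basis: the
    coordinates are expanded over the dual pair twice, and after the sums are swapped the inner sum
    over \<open>B\<close> is \<open>c j (b k)\<close>, a Kronecker delta.\<close>
  have tr: "(\<Sum>\<beta>\<in>B. (THE d. coordinates_mod_torsion G B (\<phi> \<beta>) d) \<beta>) =
      (\<Sum>k\<in>K. c k (\<phi> (b k)))"
    if B: "basis_mod_torsion G B" for B
  proof -
    define C where "C x = (THE d. coordinates_mod_torsion G B x d)" for x
    have Bf: "finite B" "B \<subseteq> carrier G" and ex1: "\<And>x. x \<in> carrier G \<Longrightarrow>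
        \<exists>!d. coordinates_mod_torsion G B x d"
      using B by (auto simp: basis_mod_torsion_def)
    have C: "coordinates_mod_torsion G B x (C x)" if "x \<in> carrier G" for x
      unfolding C_def by (rule theI'[OF ex1[OF that]])
    have Cx: "x = finprod G (\<lambda>\<beta>. \<beta> [^]\<^bsub>G\<^esub> C x \<beta>) B" if "x \<in>
        carrier G" for x
      using C[OF that] coord_iff[OF Bf(2) that] by blast
    have Cadd: "C (x \<otimes>\<^bsub>G\<^esub> y) = (\<lambda>\<beta>\<in>B. C x \<beta> + C y \<beta>)"
        if "x \<in> carrier G" "y \<in> carrier G" for x y
    proof -
      have "finprod G (\<lambda>\<beta>. \<beta> [^]\<^bsub>G\<^esub> (\<lambda>\<beta>\<in>B. C x \<beta>
          + C y \<beta>) \<beta>) B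
          = finprod G (\<lambda>\<beta>. \<beta> [^]\<^bsub>G\<^esub> C x \<beta>
              \<otimes>\<^bsub>G\<^esub> \<beta> [^]\<^bsub>G\<^esub> C y \<beta>) B"
        using Bf by (intro G.finprod_cong') (auto simp: G.int_pow_mult)
      also have "\<dots> = x \<otimes>\<^bsub>G\<^esub> y"
        using Bf Cx[OF that(1)] Cx[OF that(2)] by (subst G.finprod_multf) auto
      finally have "coordinates_mod_torsion G B (x \<otimes>\<^bsub>G\<^esub> y) (\<lambda>\<beta>\<in>B. C
          x \<beta> + C y \<beta>)"
        using coord_iff[OF Bf(2)] that by simp
      then show ?thesis using C[of "x \<otimes>\<^bsub>G\<^esub> y"] ex1[of "x \<otimes>\<^bsub>G\<^esub>
          y"] that by blast
    qed
    have Chom: "(\<lambda>x. C x \<beta>) \<in> hom G integer_group" if "\<beta> \<in> B" for \<beta>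
      using that Cadd by (auto simp: hom_def)
    have cphi: "c k \<circ> \<phi> \<in> hom G integer_group" if "k \<in> K" for k
      using hom_compose[OF \<phi> c[OF that]] .
    have \<phi>c: "\<phi> x \<in> carrier G" if "x \<in> carrier G" for x using \<phi> that by (auto simp: hom_def)
    have cexp: "c j x = (\<Sum>\<beta>\<in>B. C x \<beta> * c j \<beta>)" if "x \<in> carrier G" "j \<in>
        K" for x j
    proof -
      have "c j x = c j (finprod G (\<lambda>\<beta>. \<beta> [^]\<^bsub>G\<^esub> C x \<beta>) B)" using
          Cx[OF that(1)] by simp
      also have "\<dots> = (\<Sum>\<beta>\<in>B. C x \<beta> * c j \<beta>)"
        using Bf by (subst hfin[OF c[OF that(2)]]) (auto intro!: sum.cong hpow[OF c[OF that(2)]])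
      finally show ?thesis .
    qed
    have "(\<Sum>\<beta>\<in>B. C (\<phi> \<beta>) \<beta>) = (\<Sum>\<beta>\<in>B. \<Sum>k\<in>K. c k
        (\<phi> \<beta>) * C (b k) \<beta>)"
      using Bf by (intro sum.cong refl expand[OF Chom]) (auto intro: \<phi>c)
    also have "\<dots> = (\<Sum>\<beta>\<in>B. \<Sum>k\<in>K. (\<Sum>j\<in>K. c j \<beta> * c k (\<phi> (b
        j))) * C (b k) \<beta>)"
    proof -
      have "c k (\<phi> \<beta>) = (\<Sum>j\<in>K. c j \<beta> * c k (\<phi> (b j)))" if "k \<in> K"
          "\<beta> \<in> B" for k \<beta>
        using expand[OF cphi[OF that(1)], of \<beta>] Bf that(2) by (auto simp: o_def)
      then show ?thesis by simp
    qed
    also have "\<dots> = (\<Sum>\<beta>\<in>B. \<Sum>k\<in>K. \<Sum>j\<in>K. c k (\<phi> (b j)) * (C (b k)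
        \<beta> * c j \<beta>))"
      by (simp add: sum_distrib_left sum_distrib_right mult_ac)
    also have "\<dots> = (\<Sum>k\<in>K. \<Sum>\<beta>\<in>B. \<Sum>j\<in>K. c k (\<phi> (b j)) * (C (b k)
        \<beta> * c j \<beta>))"
      by (rule sum.swap)
    also have "\<dots> = (\<Sum>k\<in>K. \<Sum>j\<in>K. \<Sum>\<beta>\<in>B. c k (\<phi> (b j)) * (C (b k)
        \<beta> * c j \<beta>))"
      by (rule sum.cong[OF refl]) (rule sum.swap)
    also have "\<dots> = (\<Sum>k\<in>K. \<Sum>j\<in>K. c k (\<phi> (b j)) * c j (b k))"
      by (intro sum.cong refl) (simp add: cexp[OF b] sum_distrib_left)
    also have "\<dots> = (\<Sum>k\<in>K. \<Sum>j\<in>K. c k (\<phi> (b j)) * (if k = j then 1 else 0))"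
      by (intro sum.cong refl) (simp add: cb)
    also have "\<dots> = (\<Sum>k\<in>K. c k (\<phi> (b k)))"
      using K by (simp add: if_distrib[of "\<lambda>a. _ * a"] cong: if_cong)
    finally show ?thesis by (simp add: C_def)
  qed
  have "basis_mod_torsion G B0"
    unfolding basis_mod_torsion_def using B0 B0coord by auto
  then show ?thesis
    unfolding endo_trace_def using tr by (intro the_equality) (metis, metis)
qed

section \<open>Homology of tori\<close>

text \<open>
  The coordinates outside \<open>I\<close> are 1 rather than \<open>undefined\<close>, so that \<open>J
      \<subseteq> I\<close> gives \<open>Tor J \<subseteq> Tor I\<close>.
\<close>

definition Tor :: "nat set \<Rightarrow> (nat \<Rightarrow> complex) set"
  where "Tor I = {z. (\<forall>i. norm (z i) = 1) \<and> (\<forall>i. i \<notin> I \<longrightarrow> z i = 1)}"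

abbreviation Top_Tor :: "nat set \<Rightarrow> (nat \<Rightarrow> complex) topology"
  where "Top_Tor I \<equiv> top_of_set (Tor I)"

definition proj :: "nat set \<Rightarrow> (nat \<Rightarrow> complex) \<Rightarrow> nat \<Rightarrow> complex"
  where "proj J z = (\<lambda>i. if i \<in> J then z i else 1)"

abbreviation H_Tor where "H_Tor k I \<equiv> homology_group k (Top_Tor I)"
abbreviation map_Tor where "map_Tor k I J f \<equiv> hom_induced k (Top_Tor I) {} (Top_Tor J) {} f"

lemma Tor_mono: "J \<subseteq> I \<Longrightarrow> Tor J \<subseteq> Tor I"
  by (auto simp: Tor_def)

lemma continuous_on_coord [continuous_intros]: "continuous_on S (\<lambda>z. z i)" for z :: "'i
    \<Rightarrow> 'b::topological_space"
  by (rule continuous_on_subset[OF continuous_on_product_coordinates]) auto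

lemma continuous_map_Top_Tor:
  "continuous_map (Top_Tor I) (Top_Tor J) f \<longleftrightarrow> (\<forall>i. continuous_on (Tor I)
      (\<lambda>z. f z i)) \<and> f \<in> Tor I \<rightarrow> Tor J"
  using continuous_on_coordinatewise_then_product continuous_on_product_then_coordinatewise
  by (auto simp: continuous_map_subtopology_eu)

lemma continuous_map_proj: 
  assumes "J \<inter> I \<subseteq> K"
  shows "continuous_map (Top_Tor I) (Top_Tor K) (proj J)"
  unfolding continuous_map_Top_Tor
proof (intro conjI allI)
  show "continuous_on (Tor I) (\<lambda>z. proj J z i)" for i
    by (cases "i \<in> J") (simp_all add: proj_def continuous_intros)
  show "proj J \<in> Tor I \<rightarrow> Tor K"
  proof
    fix z assume z: "z \<in> Tor I"
    have "proj J z i = 1" if "i \<notin> K" for i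
      using that assms z by (cases "i \<in> J") (auto simp: proj_def Tor_def)
    then show "proj J z \<in> Tor K" using z by (auto simp: proj_def Tor_def)
  qed
qed

lemma continuous_map_incl: "J \<subseteq> I \<Longrightarrow> continuous_map (Top_Tor J) (Top_Tor I) id"
  using Tor_mono[of J I] by (simp add: continuous_map_subtopology_eu continuous_on_id Pi_iff subset_iff)

lemma proj_eq: "z \<in> Tor I \<Longrightarrow> I \<subseteq> J \<Longrightarrow> proj J z = z"
  by (auto simp: Tor_def proj_def fun_eq_iff)

lemma hom_induced_compose_empty':
  assumes "continuous_map X Y f" "continuous_map Y Z g"
  shows "hom_induced p Y {} Z {} g (hom_induced p X {} Y {} f x) = hom_induced p X {} Z {} (g \<circ> f) x"
  using hom_induced_compose_empty[OF assms, of p] by simp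

lemmas map_Tor_compose = hom_induced_compose_empty'[where X = "Top_Tor _" and Y = "Top_Tor _" and Z = "Top_Tor _"]

lemma map_Tor_eq: "(\<And>z. z \<in> Tor I \<Longrightarrow> f z = g z) \<Longrightarrow> map_Tor k I J f =
    map_Tor k I J g"
  by (rule hom_induced_eq) auto

lemma map_Tor_id: "x \<in> carrier (H_Tor k I) \<Longrightarrow> (\<And>z. z \<in> Tor I \<Longrightarrow>
    f z = z) \<Longrightarrow> map_Tor k I I f x = x"
  using map_Tor_eq[of I f id k I] by (simp add: hom_induced_id)

lemma map_Tor_one [simp]: "map_Tor k I J f \<one>\<^bsub>H_Tor k I\<^esub> = \<one>\<^bsub>H_Tor k J\<^esub>"
  using hom_one[OF hom_induced_empty_hom] by simp

lemma torus_split: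
  assumes "a \<notin> I"
  shows "homeomorphic_maps (Top_Tor (insert a I)) (cyl (Top_Tor I)) (\<lambda>z. (z(a := 1), z a))
      (\<lambda>(x,w). x(a := w))"
proof -
  have "continuous_on (Tor (insert a I)) (\<lambda>z. (z(a := 1), z a))"
  proof (intro continuous_intros continuous_on_coordinatewise_then_product)
    show "continuous_on (Tor (insert a I)) (\<lambda>z. (z(a := 1)) i)" for i
      by (cases "i = a") (simp_all add: continuous_intros)
  qed
  moreover have "continuous_on (Tor I \<times> sphere 0 1) (\<lambda>xw. (fst xw)(a := snd xw))"
  proof (intro continuous_on_coordinatewise_then_product)
    show "continuous_on (Tor I \<times> sphere 0 1) (\<lambda>xw. ((fst xw)(a := snd xw)) i)" for i
      using continuous_on_compose2[OF continuous_on_coord[of UNIV i] continuous_on_fst[OF continuous_on_id]]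
      by (cases "i = a") (auto intro!: continuous_on_snd)
  qed
  ultimately show ?thesis
    using assms unfolding homeomorphic_maps_def prod_topology_subtopology_eu 
    by (auto simp: continuous_map_subtopology_eu Tor_def case_prod_unfold)
qed

definition torus_slant :: "int \<Rightarrow> nat set \<Rightarrow> nat \<Rightarrow> (nat \<Rightarrow>
    complex) chain set \<Rightarrow> (nat \<Rightarrow> complex) chain set"
  where "torus_slant k I a = circle_slant k (Top_Tor I) \<circ>
    hom_induced k (Top_Tor (insert a I)) {} (cyl (Top_Tor I)) {} (\<lambda>z. (z(a := 1), z a))"

lemma torus_split_iso:
  assumes "a \<notin> I"
  shows "hom_induced k (Top_Tor (insert a I)) {} (cyl (Top_Tor I)) {} (\<lambda>z. (z(a := 1), z a))
    \<in> iso (H_Tor k (insert a I)) (homology_group k (cyl (Top_Tor I)))"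
  using homeomorphic_map_homology_iso torus_split[OF assms] homeomorphic_map_maps by blast

lemma continuous_torus_split:
  "a \<notin> I \<Longrightarrow> continuous_map (Top_Tor (insert a I)) (cyl (Top_Tor I)) (\<lambda>z. (z(a
      := 1), z a))"
  using torus_split homeomorphic_maps_def by blast

lemma hom_torus_slant: "a \<notin> I \<Longrightarrow> torus_slant k I a \<in> hom (H_Tor k (insert a I))
    (H_Tor (k-1) I)"
  unfolding torus_slant_def by (rule hom_compose[OF hom_induced_hom hom_circle_slant])

lemma surj_torus_slant: "a \<notin> I \<Longrightarrow> torus_slant k I a ` carrier (H_Tor k (insert a I))
    = carrier (H_Tor (k-1) I)"
  unfolding torus_slant_def image_comp[symmetric] using torus_split_iso[of a I k] surj_circle_slant[of k
      "Top_Tor I"]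
  by (simp add: iso_def bij_betw_def)

text \<open>A class killed by the slant map comes from the slice where coordinate \<open>a\<close>
  is 1, and that slice is \<open>Tor I\<close>.\<close>

lemma kernel_torus_slant:
  assumes a: "a \<notin> I" and x: "x \<in> carrier (H_Tor k (insert a I))" and one: "torus_slant k I a x =
      \<one>\<^bsub>H_Tor (k-1) I\<^esub>"
  obtains u where "u \<in> carrier (H_Tor k I)" "x = map_Tor k I (insert a I) id u"
proof -
  let ?P = "cyl (Top_Tor I)"
  let ?e = "hom_induced k (Top_Tor (insert a I)) {} ?P {} (\<lambda>z. (z(a := 1), z a))"
  have "?e x \<in> kernel (homology_group k ?P) (H_Tor (k-1) I) (circle_slant k (Top_Tor I))"
    using one unfolding kernel_def torus_slant_def by (simp add: hom_induced_carrier)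
  then obtain u where u: "u \<in> carrier (H_Tor k I)" "?e x = hom_induced k (Top_Tor I) {} ?P {}
      (\<lambda>y. (y,1)) u"
    unfolding kernel_circle_slant by auto
  have "?e (map_Tor k I (insert a I) id u) = hom_induced k (Top_Tor I) {} ?P {} ((\<lambda>z. (z(a := 1), z
      a)) \<circ> id) u"
    by (rule hom_induced_compose_empty'[OF continuous_map_incl continuous_torus_split[OF a]]) auto
  also have "hom_induced k (Top_Tor I) {} ?P {} ((\<lambda>z. (z(a := 1), z a)) \<circ> id) = hom_induced k
      (Top_Tor I) {} ?P {} (\<lambda>y. (y,1))"
    by (rule hom_induced_eq) (use a in \<open>auto simp: Tor_def\<close>)
  finally have eq: "?e (map_Tor k I (insert a I) id u) = ?e x" unfolding u(2)[symmetric] .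
  have inj: "inj_on ?e (carrier (H_Tor k (insert a I)))"
    using torus_split_iso[OF a, of k, unfolded iso_iff] by blast
  have "x = map_Tor k I (insert a I) id u"
    by (rule inj_onD[OF inj eq[symmetric] x hom_induced_carrier])
  then show thesis using that u by blast
qed

text \<open>Once coordinate \<open>a\<close> is split off, the projection becomes
  \<open>proj J\<close> times the identity of the circle, the case covered by
  \<open>naturality_circle_slant\<close>.\<close>

lemma torus_slant_proj:
  assumes a: "a \<notin> I" and J: "J \<subseteq> I" and x: "x \<in> carrier (H_Tor k (insert a I))"
  shows "torus_slant k J a (map_Tor k (insert a I) (insert a J) (proj (insert a J)) x) = map_Tor (k-1) I J
      (proj J) (torus_slant k I a x)"
proof -
  let ?P = "\<lambda>I. cyl (Top_Tor I)"
  let ?e = "\<lambda>I. hom_induced k (Top_Tor (insert a I)) {} (?P I) {} (\<lambda>z. (z(a := 1), z a))"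
  have aJ: "a \<notin> J" using a J by auto
  have cp: "continuous_map (Top_Tor I) (Top_Tor J) (proj J)" by (rule continuous_map_proj) auto
  have "?e J (map_Tor k (insert a I) (insert a J) (proj (insert a J)) x) = 
      hom_induced k (Top_Tor (insert a I)) {} (?P J) {} ((\<lambda>z. (z(a := 1), z a)) \<circ> proj
          (insert a J)) x"
    by (rule hom_induced_compose_empty'[OF continuous_map_proj continuous_torus_split[OF aJ]]) auto
  also have "hom_induced k (Top_Tor (insert a I)) {} (?P J) {} ((\<lambda>z. (z(a := 1), z a)) \<circ> proj
      (insert a J))
    = hom_induced k (Top_Tor (insert a I)) {} (?P J) {} ((\<lambda>(y,z). (proj J y, z)) \<circ>
        (\<lambda>z. (z(a := 1), z a)))"
    using aJ by (intro hom_induced_eq) (auto simp: proj_def fun_eq_iff)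
  also have "\<dots> x = hom_induced k (?P I) {} (?P J) {} (\<lambda>(y,z). (proj J y, z)) (?e I x)"
    by (rule hom_induced_compose_empty'[OF continuous_torus_split[OF a] continuous_map_strip(2)[OF cp], symmetric])
  finally have e: "?e J (map_Tor k (insert a I) (insert a J) (proj (insert a J)) x)
    = hom_induced k (?P I) {} (?P J) {} (\<lambda>(y,z). (proj J y, z)) (?e I x)" .
  show ?thesis
    unfolding torus_slant_def o_apply e by (rule naturality_circle_slant[OF cp hom_induced_carrier])
qed

text \<open>
  Induction on \<open>I\<close>: the slant product with the new circle commutes with the projections, so it kills
  \<open>x\<close>, and its kernel is the homology of the smaller torus.
\<close>

lemma torus_detect:
  assumes "finite I" "x \<in> carrier (H_Tor k I)"
    and "\<And>J. J \<subseteq> I \<Longrightarrow> int (card J) = k \<Longrightarrow> map_Tor k I J (proj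
        J) x = \<one>\<^bsub>H_Tor k J\<^esub>"
  shows "x = \<one>\<^bsub>H_Tor k I\<^esub>"
  using assms
proof (induction I arbitrary: k x rule: finite_induct)
  case empty
  show ?case
  proof (cases "k = 0")
    case True
    then show ?thesis using empty(2)[of "{}"] empty(1) map_Tor_id[of x k "{}" "proj {}"] proj_eq[of _ "{}"
        "{}"] by auto
  next
    case False
    have "topspace (Top_Tor {}) = {\<lambda>i. 1}" by (auto simp: Tor_def)
    from homology_dimension_axiom[OF this False] show ?thesis using empty(1) by (auto simp: trivial_group_def)
  qed
next
  case (insert a I)
  have fJ: "finite J" if "J \<subseteq> I" for J using that insert(1) finite_subset by blast
  have "torus_slant k I a x = \<one>\<^bsub>H_Tor (k-1) I\<^esub>"
  proof (rule insert.IH)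
    show "torus_slant k I a x \<in> carrier (H_Tor (k-1) I)"
      using hom_torus_slant[OF insert(2)] insert(4) by (auto simp: hom_def)
    fix J assume J: "J \<subseteq> I" "int (card J) = k - 1"
    then have "a \<notin> J" using insert(2) by auto
    then have "map_Tor k (insert a I) (insert a J) (proj (insert a J)) x = \<one>\<^bsub>H_Tor k (insert a
        J)\<^esub>"
      using J fJ by (intro insert.prems) auto
    then have "map_Tor (k-1) I J (proj J) (torus_slant k I a x) = torus_slant k J a \<one>\<^bsub>H_Tor k
        (insert a J)\<^esub>"
      using torus_slant_proj[OF insert(2) J(1) insert(4)] by simp
    also have "\<dots> = \<one>\<^bsub>H_Tor (k-1) J\<^esub>"
      using hom_one[OF hom_torus_slant[OF \<open>a \<notin> J\<close>]] by simp
    finally show "map_Tor (k-1) I J (proj J) (torus_slant k I a x) = \<one>\<^bsub>H_Tor (k-1) J\<^esub>" .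
  qed
  then obtain u where u: "u \<in> carrier (H_Tor k I)" "x = map_Tor k I (insert a I) id u"
    using kernel_torus_slant[OF insert(2,4)] by metis
  have "u = \<one>\<^bsub>H_Tor k I\<^esub>"
  proof (rule insert.IH)
    fix J assume J: "J \<subseteq> I" "int (card J) = k"
    have "map_Tor k I J (proj J) u = map_Tor k (insert a I) J (proj J) x"
      unfolding u(2) by (subst map_Tor_compose[OF continuous_map_incl continuous_map_proj]) auto
    also have "\<dots> = \<one>\<^bsub>H_Tor k J\<^esub>" using J by (intro insert.prems) auto
    finally show "map_Tor k I J (proj J) u = \<one>\<^bsub>H_Tor k J\<^esub>" .
  qed (use u in auto)
  then show ?case using u by simp
qed

text \<open>Detection is vacuous here: \<open>I\<close> has no subset with \<open>k\<close>
  elements.\<close>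

lemma torus_vanish:
  assumes "finite I" "x \<in> carrier (H_Tor k I)" "int (card I) < k"
  shows "x = \<one>\<^bsub>H_Tor k I\<^esub>"
proof (rule torus_detect[OF assms(1,2)])
  fix J assume "J \<subseteq> I" "int (card J) = k"
  then show "map_Tor k I J (proj J) x = \<one>\<^bsub>H_Tor k J\<^esub>" using card_mono[OF assms(1), of J]
      assms(3) by auto
qed

text \<open>In top degree the kernel of the slant map comes from a torus of too small dimension and
  is zero, so the slant map is an isomorphism; iterating it leads to the homology of a point in
  degree 0.\<close>

lemma torus_top: "finite I \<Longrightarrow> H_Tor (int (card I)) I \<cong> integer_group"
proof (induction I rule: finite_induct)
  case empty
  have "topspace (Top_Tor {}) = {\<lambda>i. 1}" by (auto simp: Tor_def)
  from homology_coefficients[OF this] show ?case by (simp only: card.empty of_nat_0)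
next
  case (insert a I)
  let ?k = "int (card (insert a I))"
  have k: "?k - 1 = int (card I)" using insert by simp
  have "x = \<one>\<^bsub>H_Tor ?k (insert a I)\<^esub>" if xt: "x \<in> carrier (H_Tor ?k (insert a I))"
      "torus_slant ?k I a x = \<one>\<^bsub>H_Tor (?k-1) I\<^esub>" for x
  proof -
    obtain u where u: "u \<in> carrier (H_Tor ?k I)" "x = map_Tor ?k I (insert a I) id u"
      using kernel_torus_slant[OF insert(2) xt] by metis
    have ueq: "u = \<one>\<^bsub>H_Tor ?k I\<^esub>" by (rule torus_vanish[OF insert(1) u(1)]) (use insert in simp)
    show ?thesis unfolding u(2) ueq by (rule map_Tor_one)
  qed
  then have "inj_on (torus_slant ?k I a) (carrier (H_Tor ?k (insert a I)))"
    unfolding inj_on_one_iff'[OF hom_torus_slant[OF insert(2)] group_relative_homology_group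
        group_relative_homology_group]
    by blast
  then have "torus_slant ?k I a \<in> iso (H_Tor ?k (insert a I)) (H_Tor (?k-1) I)"
    unfolding iso_iff using hom_torus_slant[OF insert(2)] surj_torus_slant[OF insert(2)] by blast
  then show ?case using insert.IH unfolding k is_iso_def using iso_set_trans by blast
qed

lemma torus_factor_trivial:
  assumes "continuous_map (Top_Tor I) (Top_Tor K) f" "continuous_map (Top_Tor K) (Top_Tor J) g" "finite K"
      "int (card K) < k"
    and "x \<in> carrier (H_Tor k I)"
  shows "map_Tor k I J (g \<circ> f) x = \<one>\<^bsub>H_Tor k J\<^esub>"
proof -
  have "map_Tor k I J (g \<circ> f) x = map_Tor k K J g (map_Tor k I K f x)" using map_Tor_compose[OF
      assms(1,2)] by simp
  also have "map_Tor k I K f x = \<one>\<^bsub>H_Tor k K\<^esub>" by (rule torus_vanish) (use assms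
      hom_induced_carrier in auto)
  also have "map_Tor k K J g \<one>\<^bsub>H_Tor k K\<^esub> = \<one>\<^bsub>H_Tor k J\<^esub>" by (rule
      map_Tor_one)
  finally show ?thesis .
qed

section \<open>Fundamental classes and degrees\<close>

definition orientation_Tor :: "nat set \<Rightarrow> (nat \<Rightarrow> complex) chain set \<Rightarrow> int"
  where "orientation_Tor I = (SOME z. z \<in> iso (H_Tor (int (card I)) I) integer_group)"

definition class_Tor :: "nat set \<Rightarrow> (nat \<Rightarrow> complex) chain set"
  where "class_Tor I = inv_into (carrier (H_Tor (int (card I)) I)) (orientation_Tor I) 1"

text \<open>The choice of generator and the reading of its image use the same
  \<open>orientation_Tor I\<close>, so the arbitrary sign of that isomorphism cancels.\<close>

definition deg_Tor :: "nat set \<Rightarrow> ((nat \<Rightarrow> complex) \<Rightarrow> nat \<Rightarrow>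
    complex) \<Rightarrow> int"
  where "deg_Tor I f = orientation_Tor I (map_Tor (int (card I)) I I f (class_Tor I))"

lemma orientation_Tor: "finite I \<Longrightarrow> orientation_Tor I \<in> iso (H_Tor (int (card I)) I)
    integer_group"
  using torus_top[of I] unfolding orientation_Tor_def is_iso_def by (metis ex_in_conv someI_ex)

lemma class_Tor: 
  assumes "finite I" shows "class_Tor I \<in> carrier (H_Tor (int (card I)) I)" "orientation_Tor I
      (class_Tor I) = 1"
proof -
  have "1 \<in> orientation_Tor I ` carrier (H_Tor (int (card I)) I)" using orientation_Tor[OF assms] by
      (simp add: iso_iff)
  then show "class_Tor I \<in> carrier (H_Tor (int (card I)) I)" "orientation_Tor I (class_Tor I) = 1"
    unfolding class_Tor_def by (auto intro: inv_into_into f_inv_into_f)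
qed

lemma class_Tor_generates:
  assumes "finite I" "x \<in> carrier (H_Tor (int (card I)) I)"
  shows "x = class_Tor I [^]\<^bsub>H_Tor (int (card I)) I\<^esub> orientation_Tor I x"
proof -
  let ?G = "H_Tor (int (card I)) I"
  interpret group ?G by simp
  have h: "orientation_Tor I \<in> hom ?G integer_group" "inj_on (orientation_Tor I) (carrier ?G)" using
      orientation_Tor[OF assms(1)] by (auto simp: iso_iff)
  have "orientation_Tor I (class_Tor I [^]\<^bsub>?G\<^esub> orientation_Tor I x) = orientation_Tor I x *
      orientation_Tor I (class_Tor I)"
  proof -
    interpret group_hom ?G integer_group "orientation_Tor I" using h by (simp add: group_hom_def
        group_hom_axioms_def)
    show ?thesis using hom_int_pow[OF class_Tor(1)[OF assms(1)]] by simp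
  qed
  then show ?thesis using h(2) assms class_Tor[OF assms(1)] by (auto dest!: inj_onD)
qed

lemma orientation_Tor_map_Tor:
  assumes "finite I" "x \<in> carrier (H_Tor (int (card I)) I)"
  shows "orientation_Tor I (map_Tor (int (card I)) I I f x) = deg_Tor I f * orientation_Tor I x"
proof -
  let ?G = "H_Tor (int (card I)) I"
  let ?h = "orientation_Tor I \<circ> map_Tor (int (card I)) I I f"
  have "orientation_Tor I \<in> hom ?G integer_group" using orientation_Tor[OF assms(1)] by (auto simp: iso_iff)
  then have "?h \<in> hom ?G integer_group" by (intro hom_compose[OF hom_induced_hom]) 
  then interpret group_hom ?G integer_group ?h by (simp add: group_hom_def group_hom_axioms_def)
  have "?h x = ?h (class_Tor I [^]\<^bsub>?G\<^esub> orientation_Tor I x)" using class_Tor_generates[OF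
      assms] by simp
  also have "\<dots> = orientation_Tor I x * ?h (class_Tor I)" using hom_int_pow[OF class_Tor(1)[OF
      assms(1)]] by simp
  finally show ?thesis by (simp add: deg_Tor_def)
qed

lemma deg_Tor_compose:
  assumes "finite I" "continuous_map (Top_Tor I) (Top_Tor I) f" "continuous_map (Top_Tor I) (Top_Tor I) g"
  shows "deg_Tor I (g \<circ> f) = deg_Tor I g * deg_Tor I f"
  using assms class_Tor[OF assms(1)] unfolding deg_Tor_def[of I "g \<circ> f"] deg_Tor_def[of I f]
  by (simp add: map_Tor_compose[OF assms(2,3), symmetric] orientation_Tor_map_Tor hom_induced_carrier)

lemma deg_Tor_id: "finite I \<Longrightarrow> (\<And>z. z \<in> Tor I \<Longrightarrow> f z = z)
    \<Longrightarrow> deg_Tor I f = 1"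
  unfolding deg_Tor_def using class_Tor by (simp add: map_Tor_id)

lemma deg_Tor_cong: "(\<And>z. z \<in> Tor I \<Longrightarrow> f z = g z) \<Longrightarrow> deg_Tor I f =
    deg_Tor I g"
  unfolding deg_Tor_def using map_Tor_eq[of I f g] by metis

lemma deg_Tor_homotopic: "homotopic_with (\<lambda>h. True) (Top_Tor I) (Top_Tor I) f g \<Longrightarrow>
    deg_Tor I f = deg_Tor I g"
  unfolding deg_Tor_def using homology_homotopy_empty by metis

lemma deg_Tor_factor:
  assumes "continuous_map (Top_Tor I) (Top_Tor K) f" "continuous_map (Top_Tor K) (Top_Tor I) g" "finite K"
      "card K < card I" "finite I"
  shows "deg_Tor I (g \<circ> f) = 0"
proof -
  have "orientation_Tor I \<in> hom (H_Tor (int (card I)) I) integer_group" using orientation_Tor[OF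
      assms(5)] by (auto simp: iso_iff)
  from hom_one[OF this] show ?thesis
    unfolding deg_Tor_def using torus_factor_trivial[OF assms(1-3), of "int (card I)" "class_Tor I"] assms
        class_Tor by simp
qed

text \<open>Placed between \<open>b J\<close> and \<open>c J\<close>, the map \<open>f\<close> turns
  each diagonal coefficient into the degree of a self-map of \<open>Tor J\<close>. The homeomorphism
  is kept explicit because the lemma is meant for a compactified summand, which is a torus only up
  to homeomorphism.\<close>

lemma endo_trace_torus:
  assumes I: "finite I" and \<theta>: "homeomorphic_maps X (Top_Tor I) \<theta> \<theta>'" and f:
      "continuous_map X X f"
  shows "endo_trace (homology_group (int n) X) (hom_induced (int n) X {} X {} f)
     = (\<Sum>J | J \<subseteq> I \<and> card J = n. deg_Tor J (proj J \<circ> \<theta> \<circ> f \<circ>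
         \<theta>'))"
proof -
  have c\<theta>: "continuous_map X (Top_Tor I) \<theta>" "continuous_map (Top_Tor I) X \<theta>'"
    using \<theta> by (auto simp: homeomorphic_maps_def)
  have \<theta>inv: "\<And>x. x \<in> topspace X \<Longrightarrow> \<theta>' (\<theta> x) = x" "\<And>z. z
      \<in> Tor I \<Longrightarrow> \<theta> (\<theta>' z) = z"
    using \<theta> by (auto simp: homeomorphic_maps_def)
  define K where "K = {J. J \<subseteq> I \<and> card J = n}"
  let ?G = "homology_group (int n) X"
  define c where "c J = orientation_Tor J \<circ> hom_induced (int n) X {} (Top_Tor J) {} (proj J \<circ>
      \<theta>)" for J
  define b where "b J = hom_induced (int n) (Top_Tor J) {} X {} \<theta>' (class_Tor J)" for J
  have c_apply: "c J x = orientation_Tor J (hom_induced (int n) X {} (Top_Tor J) {} (proj J \<circ>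
      \<theta>) x)" for J x
    by (simp only: c_def comp_apply)
  have fin: "finite J" "J \<subseteq> I" "card J = n" if "J \<in> K" for J
    using that I finite_subset by (auto simp: K_def)
  have cp: "continuous_map X (Top_Tor J) (proj J \<circ> \<theta>)" for J
    by (rule continuous_map_compose[OF c\<theta>(1) continuous_map_proj]) auto
  have ci: "continuous_map (Top_Tor J) X \<theta>'" if "J \<subseteq> I" for J
    using continuous_map_compose[OF continuous_map_incl[OF that] c\<theta>(2)] by simp
  have gen: "class_Tor J \<in> carrier (H_Tor (int n) J)" "orientation_Tor J (class_Tor J) = 1" 
    "orientation_Tor J \<in> iso (H_Tor (int n) J) integer_group" if "J \<in> K" for J
    using class_Tor[OF fin(1)[OF that]] orientation_Tor[OF fin(1)[OF that]] fin(3)[OF that] by simp_all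
  have tor1: "orientation_Tor J \<one>\<^bsub>H_Tor (int n) J\<^esub> = 0" if "J \<in> K" for J
    using hom_one[of "orientation_Tor J" "H_Tor (int n) J" integer_group] gen(3)[OF that] by (simp add: iso_iff)
  have "endo_trace ?G (hom_induced (int n) X {} X {} f) = (\<Sum>J\<in>K. c J (hom_induced (int n) X {} X
      {} f (b J)))"
  proof (rule endo_trace_eq)
    show "comm_group ?G" by (rule abelian_homology_group)
    show "hom_induced (int n) X {} X {} f \<in> hom ?G ?G" by (rule hom_induced_hom)
    show "finite K" using I by (simp add: K_def)
    show "c J \<in> hom ?G integer_group" if "J \<in> K" for J
      unfolding c_def using gen(3)[OF that] by (intro hom_compose[OF hom_induced_hom]) (simp add: iso_iff)
    show "b J \<in> carrier ?G" for J
      unfolding b_def by (rule hom_induced_carrier)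
    show "c L (b J) = (if J = L then 1 else 0)" if J: "J \<in> K" and L: "L \<in> K" for J L
    proof -
      have "c L (b J) = orientation_Tor L (hom_induced (int n) (Top_Tor J) {} (Top_Tor L) {} (proj L
          \<circ> \<theta> \<circ> \<theta>') (class_Tor J))"
        unfolding c_apply b_def hom_induced_compose_empty'[OF ci[OF fin(2)[OF J]] cp] ..
      \<comment> \<open>Projecting a point of \<open>Tor J\<close> to \<open>L\<close> leaves only
        the coordinates in \<open>J \<inter> L\<close>; for distinct sets of equal size this is a
        torus of smaller dimension, which has no homology in degree \<open>n\<close>.\<close>
      also have "map_Tor (int n) J L (proj L \<circ> \<theta> \<circ> \<theta>') = map_Tor (int n) J L
          (proj L \<circ> proj (J \<inter> L))"
      proof (rule map_Tor_eq)
        fix z assume z: "z \<in> Tor J"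
        then have "z \<in> Tor I" using Tor_mono fin(2)[OF J] by blast
        then show "(proj L \<circ> \<theta> \<circ> \<theta>') z = (proj L \<circ> proj (J \<inter> L)) z"
          using z by (auto simp: \<theta>inv proj_def fun_eq_iff Tor_def)
      qed
      finally have *: "c L (b J) = orientation_Tor L (map_Tor (int n) J L (proj L \<circ> proj (J \<inter>
          L)) (class_Tor J))" .
      show ?thesis
      proof (cases "J = L")
        case True
        have "map_Tor (int n) J J (proj J \<circ> proj (J \<inter> J)) (class_Tor J) = class_Tor J"
          by (rule map_Tor_id[OF gen(1)[OF J]]) (simp add: proj_eq)
        then show ?thesis using True * gen[OF J] by simp
      next
        case False
        then have "J \<inter> L \<subset> J" using fin[OF J] fin[OF L] by (metis Int_lower1 Int_lower2
            card_subset_eq psubsetI)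
        then have "card (J \<inter> L) < n" using fin[OF J] psubset_card_mono by blast
        then have "map_Tor (int n) J L (proj L \<circ> proj (J \<inter> L)) (class_Tor J) =
            \<one>\<^bsub>H_Tor (int n) L\<^esub>"
          by (intro torus_factor_trivial[where K="J \<inter> L"] continuous_map_proj) (use gen[OF J] fin[OF
              J] in auto)
        then show ?thesis using False * tor1[OF L] by simp
      qed
    qed
    show "x = \<one>\<^bsub>?G\<^esub>" if x: "x \<in> carrier ?G" and c0: "\<And>J. J \<in> K
        \<Longrightarrow> c J x = 0" for x
    proof -
      let ?t = "hom_induced (int n) X {} (Top_Tor I) {} \<theta>"
      have "?t x = \<one>\<^bsub>H_Tor (int n) I\<^esub>"
      proof (rule torus_detect[OF I hom_induced_carrier])
        fix J assume "J \<subseteq> I" "int (card J) = int n"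
        then have J: "J \<in> K" by (simp add: K_def)
        have "map_Tor (int n) I J (proj J) (?t x) = hom_induced (int n) X {} (Top_Tor J) {} (proj J \<circ>
            \<theta>) x"
          by (rule hom_induced_compose_empty'[OF c\<theta>(1) continuous_map_proj]) auto
        moreover have "orientation_Tor J (hom_induced (int n) X {} (Top_Tor J) {} (proj J \<circ> \<theta>)
            x) = orientation_Tor J \<one>\<^bsub>H_Tor (int n) J\<^esub>"
          using c0[OF J] tor1[OF J] unfolding c_apply by simp
        moreover have "inj_on (orientation_Tor J) (carrier (H_Tor (int n) J))"
          using gen(3)[OF J] by (simp add: iso_iff)
        ultimately show "map_Tor (int n) I J (proj J) (?t x) = \<one>\<^bsub>H_Tor (int n) J\<^esub>"
          by (metis group.is_monoid group_relative_homology_group hom_induced_carrier inj_on_eq_iff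
              monoid.one_closed)
      qed
      moreover have "hom_induced (int n) (Top_Tor I) {} X {} \<theta>' (?t x) = x"
        using hom_induced_id_gen[OF continuous_map_compose[OF c\<theta>] _ x] \<theta>inv
        by (simp add: hom_induced_compose_empty'[OF c\<theta>])
      moreover have "hom_induced (int n) (Top_Tor I) {} X {} \<theta>' \<one>\<^bsub>H_Tor (int n)
          I\<^esub> = \<one>\<^bsub>?G\<^esub>"
        by (rule hom_one[OF hom_induced_hom]) auto
      ultimately show ?thesis by simp
    qed
  qed
  also have "\<dots> = (\<Sum>J\<in>K. deg_Tor J (proj J \<circ> \<theta> \<circ> f \<circ> \<theta>'))"
  proof (rule sum.cong[OF refl])
    fix J assume J: "J \<in> K"
    have "hom_induced (int n) X {} (Top_Tor J) {} (proj J \<circ> \<theta>) (hom_induced (int n) X {} X {} f (b J))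
      = hom_induced (int n) X {} (Top_Tor J) {} (proj J \<circ> \<theta> \<circ> f) (b J)"
      by (rule hom_induced_compose_empty'[OF f cp])
    also have "\<dots> = map_Tor (int n) J J (proj J \<circ> \<theta> \<circ> f \<circ> \<theta>') (class_Tor J)"
      unfolding b_def by (rule hom_induced_compose_empty'[OF ci continuous_map_compose[OF f cp]]) (use fin
          J in auto)
    finally show "c J (hom_induced (int n) X {} X {} f (b J)) = deg_Tor J (proj J \<circ> \<theta> \<circ>
        f \<circ> \<theta>')"
      unfolding c_apply deg_Tor_def using fin(3)[OF J] by simp
  qed
  finally show ?thesis by (simp add: K_def)
qed

lemma lefschetz_number_torus:
  assumes I: "finite I" and \<theta>: "homeomorphic_maps X (Top_Tor I) \<theta> \<theta>'" and f:
      "continuous_map X X f"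
  shows "lefschetz_number X f = (\<Sum>J\<in>Pow I. (-1) ^ card J * deg_Tor J (proj J \<circ> \<theta>
      \<circ> f \<circ> \<theta>'))"
proof -
  let ?t = "\<lambda>J. deg_Tor J (proj J \<circ> \<theta> \<circ> f \<circ> \<theta>')"
  have "lefschetz_number X f = Sum_any (\<lambda>n. \<Sum>J | J \<subseteq> I \<and> card J = n. (-1) ^
      card J * ?t J)"
    unfolding lefschetz_number_def endo_trace_torus[OF assms] sum_distrib_left
    by (intro Sum_any.cong sum.cong) auto
  also have "\<dots> = (\<Sum>n\<le>card I. \<Sum>J | J \<subseteq> I \<and> card J = n. (-1) ^ card J * ?t J)"
  proof (rule Sum_any.expand_superset)
    \<comment> \<open>No subset of \<open>I\<close> has more than \<open>card I\<close> elements, so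
      the terms of higher degree are empty sums.\<close>
    show "{n. (\<Sum>J | J \<subseteq> I \<and> card J = n. (-1) ^ card J * ?t J) \<noteq> 0} \<subseteq>
        {..card I}"
    proof
      fix n assume "n \<in> {n. (\<Sum>J | J \<subseteq> I \<and> card J = n. (-1) ^ card J * ?t J) \<noteq> 0}"
      then have "{J. J \<subseteq> I \<and> card J = n} \<noteq> {}" by (metis (mono_tags, lifting)
          mem_Collect_eq sum.empty)
      then show "n \<in> {..card I}" using card_mono[OF I] by auto
    qed
  qed simp
  also have "\<dots> = (\<Sum>J\<in>Pow I. (-1) ^ card J * ?t J)"
    using sum.group[of "Pow I" "{..card I}" card "\<lambda>J. (-1) ^ card J * ?t J"] I card_mono[OF I]
    by (auto simp: Pow_def image_subset_iff)
  finally show ?thesis .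
qed

section \<open>Integer matrices\<close>

text \<open>The Leibniz formula over an arbitrary index set, so that a principal minor of
  \<open>A\<close> is \<open>int_det J A\<close> without reindexing.\<close>

definition int_det :: "nat set \<Rightarrow> (nat \<Rightarrow> nat \<Rightarrow> int) \<Rightarrow> int"
  where "int_det I M = (\<Sum>\<pi> | \<pi> permutes I. sign \<pi> * (\<Prod>i\<in>I. M i (\<pi> i)))"

lemma int_det_transpose:
  assumes "finite I"
  shows "int_det I (\<lambda>i j. M j i) = int_det I M"
proof -
  have "int_det I (\<lambda>i j. M j i) = (\<Sum>\<pi> | \<pi> permutes I. sign (inv_into UNIV \<pi>) *
      (\<Prod>i\<in>I. M (inv_into UNIV \<pi> i) i))"
    unfolding int_det_def by (rule sum_permutations_inverse)
  also have "\<dots> = (\<Sum>\<pi> | \<pi> permutes I. sign \<pi> * (\<Prod>i\<in>I. M i (\<pi> i)))"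
  proof (rule sum.cong[OF refl])
    fix \<pi> assume "\<pi> \<in> {\<pi>. \<pi> permutes I}"
    then have p: "\<pi> permutes I" by simp
    have "(\<Prod>i\<in>I. M (inv_into UNIV \<pi> i) i) = (\<Prod>i\<in>I. M (inv_into UNIV \<pi> (\<pi>
        i)) (\<pi> i))"
      using prod.permute[OF p, of "\<lambda>i. M (inv_into UNIV \<pi> i) i"] by (simp add: o_def)
    then show "sign (inv_into UNIV \<pi>) * (\<Prod>i\<in>I. M (inv_into UNIV \<pi> i) i) = sign \<pi> *
        (\<Prod>i\<in>I. M i (\<pi> i))"
      using p sign_inverse[OF permutation_permutes[THEN iffD2]] assms
      by (metis (no_types, lifting) permutes_inverses(2) prod.cong)
  qed
  finally show ?thesis by (simp add: int_det_def)
qed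

lemma int_det_row_add:
  assumes "finite I" "b \<in> I"
  shows "int_det I (M(b := \<lambda>j. u j + c * v j)) = int_det I (M(b := u)) + c * int_det I (M(b := v))"
proof -
  have *: "(\<Prod>i\<in>I. (M(b := w)) i (\<pi> i)) = w (\<pi> b) * (\<Prod>i\<in>I-{b}. M i (\<pi> i))"
      for w \<pi>
    unfolding prod.remove[OF assms] by (auto intro!: arg_cong2[where f="(*)"] prod.cong)
  show ?thesis
    unfolding int_det_def * by (simp add: sum_distrib_left flip: sum.distrib) (simp add: algebra_simps)
qed

text \<open>Reindexing the permutations by composition with the transposition of the two rows
  reverses the sign of every summand, so the determinant is its own negative.\<close>

lemma int_det_equal_rows:
  assumes I: "finite I" and ab: "a \<in> I" "b \<in> I" "a \<noteq> b" and eq: "\<And>j. j \<in> I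
      \<Longrightarrow> M a j = M b j"
  shows "int_det I M = 0"
proof -
  let ?t = "Transposition.transpose a b"
  have t: "?t permutes I" by (rule permutes_swap_id[OF ab(1,2)])
  have "int_det I M = (\<Sum>\<pi> | \<pi> permutes I. sign (\<pi> \<circ> ?t) * (\<Prod>i\<in>I. M i
      ((\<pi> \<circ> ?t) i)))"
    unfolding int_det_def by (rule sum_permutations_compose_right[OF t])
  also have "\<dots> = (\<Sum>\<pi> | \<pi> permutes I. - (sign \<pi> * (\<Prod>i\<in>I. M i (\<pi> i))))"
  proof (rule sum.cong[OF refl])
    fix \<pi> assume "\<pi> \<in> {\<pi>. \<pi> permutes I}"
    then have p: "\<pi> permutes I" by simp
    have "sign (\<pi> \<circ> ?t) = sign \<pi> * sign ?t"
      using p t I by (intro sign_compose) (auto simp: permutation_permutes)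
    then have s: "sign (\<pi> \<circ> ?t) = - sign \<pi>"
      using ab(3) by (simp add: sign_swap_id)
    have "(\<Prod>i\<in>I. M i (\<pi> i)) = (\<Prod>i\<in>I. M (?t i) (\<pi> (?t i)))"
      using prod.permute[OF t, of "\<lambda>i. M i (\<pi> i)"] by (simp add: o_def)
    also have "\<dots> = (\<Prod>i\<in>I. M i ((\<pi> \<circ> ?t) i))"
    proof (rule prod.cong[OF refl])
      fix i assume i: "i \<in> I"
      then have "\<pi> (?t i) \<in> I" using p t by (simp add: permutes_in_image)
      then show "M (?t i) (\<pi> (?t i)) = M i ((\<pi> \<circ> ?t) i)"
        using eq by (auto simp: Transposition.transpose_def)
    qed
    finally show "sign (\<pi> \<circ> ?t) * (\<Prod>i\<in>I. M i ((\<pi> \<circ> ?t) i)) = - (sign \<pi> *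
        (\<Prod>i\<in>I. M i (\<pi> i)))"
      using s by simp
  qed
  also have "\<dots> = - int_det I M" by (simp add: int_det_def sum_negf)
  finally show ?thesis by simp
qed

section \<open>Row and column additions, diagonalization\<close>

definition rowop :: "nat \<Rightarrow> nat \<Rightarrow> int \<Rightarrow> (nat \<Rightarrow> nat
    \<Rightarrow> int) \<Rightarrow> nat \<Rightarrow> nat \<Rightarrow> int"
  where "rowop a b c M = M(b := \<lambda>j. M b j + c * M a j)"

definition colop :: "nat \<Rightarrow> nat \<Rightarrow> int \<Rightarrow> (nat \<Rightarrow> nat
    \<Rightarrow> int) \<Rightarrow> nat \<Rightarrow> nat \<Rightarrow> int"
  where "colop a b c M = (\<lambda>i. (M i)(b := M i b + c * M i a))"

lemma colop_transpose: "colop a b c M = (\<lambda>i j. rowop a b c (\<lambda>i j. M j i) j i)"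
  by (auto simp: rowop_def colop_def fun_eq_iff)

lemma int_det_rowop:
  assumes "finite I" "a \<in> I" "b \<in> I" "a \<noteq> b"
  shows "int_det I (rowop a b c M) = int_det I M"
proof -
  have "int_det I (M(b := M a)) = 0" by (rule int_det_equal_rows[OF assms]) (use assms in auto)
  then show ?thesis using int_det_row_add[OF assms(1,3), of M "M b" c "M a"] by (simp add: rowop_def)
qed

lemma int_det_colop:
  assumes "finite I" "a \<in> I" "b \<in> I" "a \<noteq> b"
  shows "int_det I (colop a b c M) = int_det I M"
  using int_det_transpose[OF assms(1), of "rowop a b c (\<lambda>i j. M j i)"] int_det_transpose[OF assms(1), of M]
    int_det_rowop[OF assms, of c "\<lambda>i j. M j i"] by (simp add: colop_transpose)

lemma int_det_diag:
  assumes I: "finite I" and M: "\<And>i j. \<lbrakk>i \<in> I; j \<in> I; i \<noteq> j\<rbrakk>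
      \<Longrightarrow> M i j = 0"
  shows "int_det I M = (\<Prod>i\<in>I. M i i)"
proof -
  have "int_det I M = (\<Sum>\<pi>\<in>{id}. sign \<pi> * (\<Prod>i\<in>I. M i (\<pi> i)))"
    unfolding int_det_def
  proof (rule sum.mono_neutral_right)
    show "\<forall>\<pi>\<in>{\<pi>. \<pi> permutes I} - {id}. sign \<pi> * (\<Prod>i\<in>I. M i (\<pi> i)) = 0"
    proof
      fix \<pi> assume "\<pi> \<in> {\<pi>. \<pi> permutes I} - {id}"
      then have p: "\<pi> permutes I" "\<pi> \<noteq> id" by auto
      then obtain i where "\<pi> i \<noteq> i" by (auto simp: fun_eq_iff)
      then have "i \<in> I" using p permutes_not_in by metis
      then have "M i (\<pi> i) = 0" using M p \<open>\<pi> i \<noteq> i\<close> by (metis permutes_in_image)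
      then show "sign \<pi> * (\<Prod>i\<in>I. M i (\<pi> i)) = 0" using I \<open>i \<in> I\<close> by
          (auto simp: prod_zero_iff)
    qed
  qed (use I in \<open>auto simp: finite_permutations permutes_id\<close>)
  then show ?thesis by simp
qed

text \<open>Multiply out the product over the rows: \<open>J\<close> collects the rows in which
  \<open>- A\<close> is taken. In the other rows the Kronecker deltas force the permutation to fix
  the index, so only permutations of \<open>J\<close> survive.\<close>

lemma int_det_one_minus:
  assumes I: "finite I"
  shows "(\<Sum>J\<in>Pow I. (-1) ^ card J * int_det J A) = int_det I (\<lambda>i j. (if i = j then 1 else
      0) - A i j)"
proof -
  let ?d = "\<lambda>i j. (if i = j then 1 else 0) :: int"
  have "int_det I (\<lambda>i j. ?d i j - A i j) = (\<Sum>\<pi> | \<pi> permutes I. \<Sum>J\<in>Pow I. 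
      sign \<pi> * ((\<Prod>i\<in>J. - A i (\<pi> i)) * (\<Prod>i\<in>I-J. ?d i (\<pi> i))))"
    unfolding int_det_def
  proof (rule sum.cong[OF refl])
    fix \<pi>
    have "(\<Prod>i\<in>I. ?d i (\<pi> i) - A i (\<pi> i)) = (\<Prod>i\<in>I. - A i (\<pi> i) + ?d i (\<pi>
        i))" by simp
    also have "\<dots> = (\<Sum>J\<in>Pow I. (\<Prod>i\<in>J. - A i (\<pi> i)) * (\<Prod>i\<in>I-J. ?d i
        (\<pi> i)))"
      by (rule prod_add[OF I])
    finally show "sign \<pi> * (\<Prod>i\<in>I. ?d i (\<pi> i) - A i (\<pi> i)) =
       (\<Sum>J\<in>Pow I. sign \<pi> * ((\<Prod>i\<in>J. - A i (\<pi> i)) * (\<Prod>i\<in>I-J. ?d i (\<pi> i))))"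
      by (simp add: sum_distrib_left)
  qed
  also have "\<dots> = (\<Sum>J\<in>Pow I. \<Sum>\<pi> | \<pi> permutes I. sign \<pi> * ((\<Prod>i\<in>J. -
      A i (\<pi> i)) * (\<Prod>i\<in>I-J. ?d i (\<pi> i))))"
    by (rule sum.swap)
  also have "\<dots> = (\<Sum>J\<in>Pow I. (-1) ^ card J * int_det J A)"
  proof (rule sum.cong[OF refl])
    fix J assume "J \<in> Pow I"
    then have J: "J \<subseteq> I" by simp
    have "(\<Sum>\<pi> | \<pi> permutes I. sign \<pi> * ((\<Prod>i\<in>J. - A i (\<pi> i)) *
        (\<Prod>i\<in>I-J. ?d i (\<pi> i))))
        = (\<Sum>\<pi> | \<pi> permutes J. sign \<pi> * ((\<Prod>i\<in>J. - A i (\<pi> i)) *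
            (\<Prod>i\<in>I-J. ?d i (\<pi> i))))"
    proof (rule sum.mono_neutral_right)
      show "\<forall>\<pi>\<in>{\<pi>. \<pi> permutes I} - {\<pi>. \<pi> permutes J}. sign \<pi> *
          ((\<Prod>i\<in>J. - A i (\<pi> i)) * (\<Prod>i\<in>I-J. ?d i (\<pi> i))) = 0"
      proof
        fix \<pi> assume "\<pi> \<in> {\<pi>. \<pi> permutes I} - {\<pi>. \<pi> permutes J}"
        then have p: "\<pi> permutes I" "\<not> \<pi> permutes J" by auto
        then obtain i where i: "i \<in> I - J" "\<pi> i \<noteq> i" using permutes_superset[OF p(1), of J] by blast
        then have "(\<Prod>i\<in>I-J. ?d i (\<pi> i)) = 0" using i I by (intro prod_zero bexI[of _ i]) auto
        then show "sign \<pi> * ((\<Prod>i\<in>J. - A i (\<pi> i)) * (\<Prod>i\<in>I-J. ?d i (\<pi> i))) =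
            0" by simp
      qed
    qed (use I J in \<open>auto simp: finite_permutations intro: permutes_subset\<close>)
    also have "\<dots> = (\<Sum>\<pi> | \<pi> permutes J. (-1) ^ card J * (sign \<pi> * (\<Prod>i\<in>J. A
        i (\<pi> i))))"
    proof (rule sum.cong[OF refl])
      fix \<pi> assume "\<pi> \<in> {\<pi>. \<pi> permutes J}"
      then have "(\<Prod>i\<in>I-J. ?d i (\<pi> i)) = 1" by (intro prod.neutral) (auto simp: permutes_not_in)
      then show "sign \<pi> * ((\<Prod>i\<in>J. - A i (\<pi> i)) * (\<Prod>i\<in>I-J. ?d i (\<pi> i))) =
          (-1) ^ card J * (sign \<pi> * (\<Prod>i\<in>J. A i (\<pi> i)))"
        by (simp only: prod_uminus mult_1_right mult.left_commute)
    qed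
    finally show "(\<Sum>\<pi> | \<pi> permutes I. sign \<pi> * ((\<Prod>i\<in>J. - A i (\<pi> i)) *
        (\<Prod>i\<in>I-J. ?d i (\<pi> i)))) = (-1) ^ card J * int_det J A"
      by (simp add: int_det_def sum_distrib_left)
  qed
  finally show ?thesis by simp
qed

text \<open>Swaps and scalings are left out: additions alone preserve the determinant including its
  sign, and each of them corresponds to a shear of the torus.\<close>

inductive elem_eq :: "nat set \<Rightarrow> (nat \<Rightarrow> nat \<Rightarrow> int) \<Rightarrow> (nat
    \<Rightarrow> nat \<Rightarrow> int) \<Rightarrow> bool" for I M
  where
    elem_refl: "elem_eq I M M"
  | elem_row: "\<lbrakk>elem_eq I M N; a \<in> I; b \<in> I; a \<noteq> b\<rbrakk> \<Longrightarrow>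
      elem_eq I M (rowop a b c N)"
  | elem_col: "\<lbrakk>elem_eq I M N; a \<in> I; b \<in> I; a \<noteq> b\<rbrakk> \<Longrightarrow>
      elem_eq I M (colop a b c N)"

lemma elem_eq_trans: "elem_eq I M N \<Longrightarrow> elem_eq I L M \<Longrightarrow> elem_eq I L N"
  by (induction rule: elem_eq.induct) (auto intro: elem_eq.intros)

lemma elem_eq_mono: "elem_eq I M N \<Longrightarrow> I \<subseteq> J \<Longrightarrow> elem_eq J M N"
  by (induction rule: elem_eq.induct) (auto intro: elem_eq.intros)

lemma rowop_inverse: "a \<noteq> b \<Longrightarrow> rowop a b (-c) (rowop a b c M) = M"
  by (auto simp: rowop_def fun_eq_iff)

lemma colop_inverse: "a \<noteq> b \<Longrightarrow> colop a b (-c) (colop a b c M) = M"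
  by (auto simp: colop_def fun_eq_iff)

lemma elem_eq_sym: "elem_eq I M N \<Longrightarrow> elem_eq I N M"
proof (induction rule: elem_eq.induct)
  case (elem_row N a b c)
  then have "elem_eq I (rowop a b c N) (rowop a b (-c) (rowop a b c N))" by (intro elem_eq.intros)
  then show ?case using elem_row rowop_inverse elem_eq_trans by metis
next
  case (elem_col N a b c)
  then have "elem_eq I (colop a b c N) (colop a b (-c) (colop a b c N))" by (intro elem_eq.intros)
  then show ?case using elem_col colop_inverse elem_eq_trans by metis
qed (rule elem_refl)

text \<open>Columns outside the part already cleared do not change, so the pivot
  \<open>N r r\<close> and the entries still to be cleared keep their values and stay
  divisible.\<close>

lemma elem_eq_clear:
  assumes "finite T" "T \<subseteq> S - {r}" "r \<in> S"
    and "\<And>j. j \<in> T \<Longrightarrow> N r r dvd N r j"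
  shows "\<exists>N'. elem_eq S N N' \<and> (\<forall>i. \<forall>j. j \<notin> T \<longrightarrow> N' i j
      = N i j) \<and> (\<forall>j\<in>T. N' r j = 0)"
  using assms
proof (induction T rule: finite_induct)
  case (insert s T)
  then obtain N' where N': "elem_eq S N N'" "\<And>i j. j \<notin> T \<Longrightarrow> N' i j = N i j"
      "\<And>j. j\<in>T \<Longrightarrow> N' r j = 0"
    by auto
  let ?N = "colop r s (- (N r s div N r r)) N'"
  have "elem_eq S N ?N" using insert.prems by (intro elem_col N') auto
  moreover have "?N i j = N i j" if "j \<notin> insert s T" for i j using that N' by (auto simp: colop_def)
  moreover have "?N r j = 0" if "j \<in> insert s T" for j
  proof -
    have "r \<notin> T" "r \<noteq> s" using insert.prems by auto
    then have "N' r s = N r s" "N' r r = N r r" using N'(2) insert.hyps by auto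
    moreover have "N r r dvd N r s" using insert.prems by auto
    ultimately show ?thesis using that N'(3) by (auto simp: colop_def)
  qed
  ultimately show ?case by blast
qed (auto intro: elem_refl)

lemma elem_eq_transpose: "elem_eq I M N \<Longrightarrow> elem_eq I (\<lambda>i j. M j i) (\<lambda>i j. N j i)"
proof (induction rule: elem_eq.induct)
  case (elem_row N a b c)
  have "(\<lambda>i j. rowop a b c N j i) = colop a b c (\<lambda>i j. N j i)"
    by (auto simp: colop_transpose)
  then show ?case using elem_row elem_col by metis
next
  case (elem_col N a b c)
  have "(\<lambda>i j. colop a b c N j i) = rowop a b c (\<lambda>i j. N j i)"
    by (auto simp: colop_transpose)
  then show ?case using elem_col elem_row by metis
qed (rule elem_refl)

text \<open>Operations inside \<open>S\<close> only combine rows and columns with index in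
  \<open>S\<close>, and outside the block these contain nothing but zeros.\<close>

lemma elem_eq_preserves_block:
  assumes "elem_eq S M N" "S \<subseteq> I"
    and "\<And>i j. \<lbrakk>i \<in> I; j \<in> I; i \<noteq> j; i \<notin> S \<or> j \<notin> S\<rbrakk>
        \<Longrightarrow> M i j = 0"
    and "i \<in> I" "j \<in> I" "i \<noteq> j" "i \<notin> S \<or> j \<notin> S"
  shows "N i j = 0"
  using assms(1,4-7)
proof (induction arbitrary: i j rule: elem_eq.induct)
  case (elem_row N a b c)
  have "N i j = 0" by (rule elem_row.IH) (use elem_row.prems in auto)
  moreover have "N a j = 0" if "i = b"
    by (rule elem_row.IH) (use elem_row.prems elem_row.hyps assms(2) that in auto)
  ultimately show ?case by (auto simp: rowop_def)
next
  case (elem_col N a b c)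
  have "N i j = 0" by (rule elem_col.IH) (use elem_col.prems in auto)
  moreover have "N i a = 0" if "j = b"
    by (rule elem_col.IH) (use elem_col.prems elem_col.hyps assms(2) that in auto)
  ultimately show ?case by (auto simp: colop_def)
qed (use assms in auto)

text \<open>
  The pivot is a nonzero entry of least absolute value among all matrices reachable by elementary
  operations inside the block. Minimality forces it to divide its row and its column.
\<close>

lemma diagonalize_block:
  assumes "finite S" "S \<subseteq> I"
    and "\<And>i j. \<lbrakk>i \<in> I; j \<in> I; i \<noteq> j; i \<notin> S \<or> j \<notin> S\<rbrakk>
        \<Longrightarrow> M i j = 0"
  shows "\<exists>N. elem_eq I M N \<and> (\<forall>i\<in>I. \<forall>j\<in>I. i \<noteq> j
      \<longrightarrow> N i j = 0)"
  using assms
proof (induction "card S" arbitrary: S M rule: less_induct)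
  case less
  show ?case
  proof (cases "\<forall>i\<in>S. \<forall>j\<in>S. M i j = 0")
    case True
    then show ?thesis using less.prems(3) elem_refl by metis
  next
    case False
    define V where "V n \<longleftrightarrow> (\<exists>N r s. elem_eq S M N \<and> r \<in> S \<and> s
        \<in> S \<and> N r s \<noteq> 0 \<and> n = nat \<bar>N r s\<bar>)" for n
    define \<mu> where "\<mu> = (LEAST n. V n)"
    have "\<exists>n. V n" using False elem_refl[of S M] unfolding V_def by blast
    then have "V \<mu>" unfolding \<mu>_def using LeastI_ex by metis
    then obtain N r s where N: "elem_eq S M N" "r \<in> S" "s \<in> S" "N r s \<noteq> 0" "nat \<bar>N r
        s\<bar> = \<mu>"
      unfolding V_def by auto
    have min: "N r s = 0" if "elem_eq S M N" "r \<in> S" "s \<in> S" "nat \<bar>N r s\<bar> < \<mu>" for N r s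
      using that not_less_Least[of "nat \<bar>N r s\<bar>" V] unfolding \<mu>_def V_def by blast
    have modlt: "nat \<bar>x mod y\<bar> < nat \<bar>y\<bar>" if "y \<noteq> 0" for x y :: int
      using abs_mod_less[OF that, of x] by linarith
    obtain P where P: "elem_eq S M P" "P r r \<noteq> 0" "nat \<bar>P r r\<bar> = \<mu>"
    proof (cases "r = s")
      case True
      then show ?thesis using that N by blast
    next
      case False
      let ?N1 = "colop s r (- (N r r div N r s)) N"
      have N1: "elem_eq S M ?N1" using N False by (intro elem_col) auto
      have "?N1 r r = N r r mod N r s" by (simp add: colop_def minus_div_mult_eq_mod)
      then have "?N1 r r = 0" using min[OF N1 N(2,2)] modlt[OF N(4)] N(5) by simp
      moreover have "?N1 r s = N r s" using False by (simp add: colop_def)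
      ultimately have "colop s r 1 ?N1 r r = N r s" using False by (simp add: colop_def)
      moreover have "elem_eq S M (colop s r 1 ?N1)" using N1 N False by (intro elem_col) auto
      ultimately show ?thesis using that N by metis
    qed
    have dvd: "P r r dvd P r j" if "j \<in> S" "j \<noteq> r" for j
    proof -
      let ?N1 = "colop r j (- (P r j div P r r)) P"
      have "elem_eq S M ?N1" using P N that by (intro elem_col) auto
      moreover have "?N1 r j = P r j mod P r r" by (simp add: colop_def minus_div_mult_eq_mod)
      ultimately have "P r j mod P r r = 0"
        using min[of ?N1 r j] modlt[OF P(2), of "P r j"] unfolding P(3) using N(2) that(1) by argo
      then show ?thesis by (rule dvd_eq_mod_eq_0[THEN iffD2])
    qed
    have dvd': "P r r dvd P j r" if "j \<in> S" "j \<noteq> r" for j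
    proof -
      let ?N1 = "rowop r j (- (P j r div P r r)) P"
      have "elem_eq S M ?N1" using P N that by (intro elem_row) auto
      moreover have "?N1 j r = P j r mod P r r" by (simp add: rowop_def minus_div_mult_eq_mod)
      ultimately have "P j r mod P r r = 0"
        using min[of ?N1 j r] modlt[OF P(2), of "P j r"] unfolding P(3) using N(2) that(1) by argo
      then show ?thesis by (rule dvd_eq_mod_eq_0[THEN iffD2])
    qed
    obtain Q where Q: "elem_eq S P Q" "\<And>i j. j \<notin> S - {r} \<Longrightarrow> Q i j = P i j"
        "\<And>j. j \<in> S - {r} \<Longrightarrow> Q r j = 0"
      using elem_eq_clear[of "S - {r}" S r P] dvd less.prems(1) N(2) by auto
    \<comment> \<open>Applied to the transpose, the same lemma clears column \<open>r\<close>.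
      Column \<open>r\<close> of the transpose, which is the row cleared before, is left
      alone.\<close>
    obtain R where R: "elem_eq S (\<lambda>i j. Q j i) R" "\<And>i j. j \<notin> S - {r} \<Longrightarrow>
        R i j = Q j i" "\<And>j. j \<in> S - {r} \<Longrightarrow> R r j = 0"
      using elem_eq_clear[of "S - {r}" S r "\<lambda>i j. Q j i"] dvd' less.prems(1) N(2) Q(2) by auto
    let ?R = "\<lambda>i j. R j i"
    have MR: "elem_eq S M ?R"
      using elem_eq_transpose[OF R(1)] Q(1) P(1) elem_eq_trans by blast
    have "\<exists>N. elem_eq I ?R N \<and> (\<forall>i\<in>I. \<forall>j\<in>I. i \<noteq> j
        \<longrightarrow> N i j = 0)"
    proof (rule less.hyps[of "S - {r}"])
      show "card (S - {r}) < card S" using N(2) less.prems(1) by (meson card_Diff1_less)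
      fix i j assume ij: "i \<in> I" "j \<in> I" "i \<noteq> j" "i \<notin> S - {r} \<or> j \<notin> S - {r}"
      show "R j i = 0"
      proof (cases "i \<notin> S \<or> j \<notin> S")
        case True
        then show ?thesis using elem_eq_preserves_block[OF MR less.prems(2,3) ij(1-3)] by simp
      next
        case False
        then consider "i = r" "j \<in> S - {r}" | "j = r" "i \<in> S - {r}" using ij by auto
        then show ?thesis using R(2,3) Q(3) by cases auto
      qed
    qed (use less.prems in auto)
    then show ?thesis using elem_eq_mono[OF MR less.prems(2)] elem_eq_trans by blast
  qed
qed

text \<open>Elementary operations are reversible, so every matrix is reached from a diagonal one and
  a property only has to survive additions. The rule serves the count of cosets, the degree formula
  and the solution of systems.\<close>

lemma diagonalize_induct [consumes 1, case_names diag row col]: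
  assumes "finite I"
    and diag: "\<And>D. (\<And>i j. \<lbrakk>i \<in> I; j \<in> I; i \<noteq> j\<rbrakk> \<Longrightarrow>
        D i j = 0) \<Longrightarrow> P D"
    and row: "\<And>a b c N. \<lbrakk>P N; a \<in> I; b \<in> I; a \<noteq> b\<rbrakk> \<Longrightarrow> P
        (rowop a b c N)"
    and col: "\<And>a b c N. \<lbrakk>P N; a \<in> I; b \<in> I; a \<noteq> b\<rbrakk> \<Longrightarrow> P
        (colop a b c N)"
  shows "P M"
proof -
  obtain D where D: "elem_eq I M D" "\<And>i j. \<lbrakk>i \<in> I; j \<in> I; i \<noteq> j\<rbrakk>
      \<Longrightarrow> D i j = 0"
    using diagonalize_block[of I I M] assms(1) by auto
  show ?thesis using elem_eq_sym[OF D(1)] diag[OF D(2)]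
    by (induction rule: elem_eq.induct) (auto intro: row col)
qed

text \<open>Representatives of distinct cosets of the lattice spanned by the columns of
  \<open>B\<close>. Pairwise incongruence is all that is claimed, as distinct cosets will give
  distinct fixed points; for determinant 0 the set is empty.\<close>

lemma incongruent_set:
  assumes I: "finite I"
  shows "\<exists>K::(nat \<Rightarrow> int) set. finite K \<and> int (card K) = \<bar>int_det I B\<bar> \<and>
    (\<forall>k\<in>K. \<forall>k'\<in>K. \<forall>m. (\<forall>i\<in>I. k i - k' i = (\<Sum>j\<in>I. B i j
        * m j)) \<longrightarrow> k = k')"
  using I
proof (induction B rule: diagonalize_induct)
  case (diag D)
  \<comment> \<open>A box of remainders: in coordinate \<open>i\<close> two of them differ by less
    than \<open>\<bar>D i i\<bar>\<close>, so a difference that is a multiple of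
    \<open>D i i\<close> must be 0.\<close>
  define K where "K = PiE I (\<lambda>i. {0..<\<bar>D i i\<bar>})"
  have "int (card K) = \<bar>int_det I D\<bar>"
    unfolding K_def using I int_det_diag[OF I, of D] diag by (simp add: card_PiE abs_prod)
  moreover have "k = k'" if k: "k \<in> K" "k' \<in> K" and m: "\<forall>i\<in>I. k i - k' i =
      (\<Sum>j\<in>I. D i j * m j)" for k k' m
  proof (rule PiE_ext)
    show "k \<in> I \<rightarrow>\<^sub>E UNIV" "k' \<in> I \<rightarrow>\<^sub>E UNIV" using k by (auto
        simp: K_def)
    fix i assume i: "i \<in> I"
    have "(\<Sum>j\<in>I. D i j * m j) = (\<Sum>j\<in>{i}. D i j * m j)"
      using I i diag by (intro sum.mono_neutral_right) auto
    then have eq: "k i - k' i = D i i * m i" using m i by simp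
    have "0 \<le> k i" "k i < \<bar>D i i\<bar>" "0 \<le> k' i" "k' i < \<bar>D i i\<bar>" using k i by
        (auto simp: K_def PiE_iff)
    then have "\<bar>k i - k' i\<bar> < \<bar>D i i\<bar>" by linarith
    then have "\<bar>D i i\<bar> * \<bar>m i\<bar> < \<bar>D i i\<bar> * 1" unfolding eq by (simp only:
        abs_mult mult_1_right)
    then have "\<bar>m i\<bar> < 1" by (rule mult_left_less_imp_less) simp
    then have "m i = 0" by simp
    then show "k i = k' i" using eq by simp
  qed
  moreover have "finite K" unfolding K_def using I by (intro finite_PiE) auto
  ultimately show ?case by blast
next
  case (row a b c N)
  from row(1) obtain K where K: "finite K" "int (card K) = \<bar>int_det I N\<bar>"
    and K': "\<forall>k\<in>K. \<forall>k'\<in>K. \<forall>m. (\<forall>i\<in>I. k i - k' i =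
        (\<Sum>j\<in>I. N i j * m j)) \<longrightarrow> k = k'" 
    by (elim exE conjE) (rule that)
  \<comment> \<open>A row addition is a change of coordinates in the space containing the lattice,
    so the representatives are transformed along with it.\<close>
  define e where "e k = k(b := k b + c * k a)" for k :: "nat \<Rightarrow> int"
  have inj: "inj e"
  proof (rule injI)
    fix x y assume "e x = e y"
    then have *: "\<And>i. e x i = e y i" by simp
    then have 1: "x i = y i" if "i \<noteq> b" for i using that *[of i] by (simp add: e_def)
    have "x b = y b" using *[of b] 1[of a] row by (simp add: e_def)
    then have "x i = y i" for i using 1 by (cases "i = b") auto
    then show "x = y" by auto
  qed
  have "e k = e k'" if kk: "k \<in> K" "k' \<in> K" and m: "\<forall>i\<in>I. e k i - e k' i =
      (\<Sum>j\<in>I. rowop a b c N i j * m j)" for k k' m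
  proof -
    have "k i - k' i = (\<Sum>j\<in>I. N i j * m j)" if i: "i \<in> I" for i
    proof (cases "i = b")
      case False
      then show ?thesis using m i by (auto simp: e_def rowop_def)
    next
      case True
      have a: "k a - k' a = (\<Sum>j\<in>I. N a j * m j)" using bspec[OF m row(2)] row(4) by (simp add:
          e_def rowop_def)
      have "k b + c * k a - (k' b + c * k' a) = (\<Sum>j\<in>I. N b j * m j) + c * (\<Sum>j\<in>I. N a j * m j)"
        using bspec[OF m row(3)] by (simp add: e_def rowop_def sum_distrib_left algebra_simps sum.distrib)
      then show ?thesis unfolding a[symmetric] True by (simp add: algebra_simps)
    qed
    then show ?thesis using K'[rule_format, OF kk, of m] by simp
  qed
  moreover have "int (card (e ` K)) = \<bar>int_det I (rowop a b c N)\<bar>"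
    using inj K(2) row I by (simp add: card_image inj_on_subset int_det_rowop)
  ultimately show ?case using K(1) by (intro exI[of _ "e ` K"]) auto
next
  case (col a b c N)
  from col(1) obtain K where K: "finite K" "int (card K) = \<bar>int_det I N\<bar>"
    and K': "\<forall>k\<in>K. \<forall>k'\<in>K. \<forall>m. (\<forall>i\<in>I. k i - k' i =
        (\<Sum>j\<in>I. N i j * m j)) \<longrightarrow> k = k'" 
    by (elim exE conjE) (rule that)
  \<comment> \<open>A column addition changes only the basis of the lattice: the same
    representatives serve, and the coefficient vector \<open>m\<close> is transformed.\<close>
  have "k = k'" if kk: "k \<in> K" "k' \<in> K" and m: "\<forall>i\<in>I. k i - k' i = (\<Sum>j\<in>I.
      colop a b c N i j * m j)" for k k' m
  proof (rule K'[rule_format, OF kk, of "m(a := m a + c * m b)"])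
    fix i assume i: "i \<in> I"
    have "(\<Sum>j\<in>I. colop a b c N i j * m j) = (\<Sum>j\<in>I. N i j * m j + (if j = b then c * N i a
        * m b else 0))"
      by (rule sum.cong) (auto simp: colop_def algebra_simps)
    also have "\<dots> = (\<Sum>j\<in>I. N i j * m j) + c * N i a * m b" using I col by (simp add: sum.distrib)
    also have "\<dots> = (\<Sum>j\<in>I. N i j * m j + (if j = a then N i a * c * m b else 0))" using I col
        by (simp add: sum.distrib)
    also have "\<dots> = (\<Sum>j\<in>I. N i j * (m(a := m a + c * m b)) j)"
      by (rule sum.cong) (auto simp: algebra_simps)
    finally show "k i - k' i = (\<Sum>j\<in>I. N i j * (m(a := m a + c * m b)) j)" using m i by simp
  qed
  moreover have "int (card K) = \<bar>int_det I (colop a b c N)\<bar>"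
    using K(2) col I by (simp add: int_det_colop)
  ultimately show ?case using K(1) by blast
qed

section \<open>Degrees of linear torus maps\<close>

lemma Tor_nonzero: "z \<in> Tor I \<Longrightarrow> z i \<noteq> 0"
  by (auto simp: Tor_def) (metis norm_zero zero_neq_one)

lemma Tor_norm: "z \<in> Tor I \<Longrightarrow> norm (z i) = 1"
  by (simp add: Tor_def)

lemma Tor_out: "z \<in> Tor I \<Longrightarrow> i \<notin> I \<Longrightarrow> z i = 1"
  by (simp add: Tor_def)

lemma continuous_on_Tor_power_int [continuous_intros]: "continuous_on (Tor I) (\<lambda>z. z i powi n)"
  by (intro continuous_intros) (auto dest: Tor_nonzero)

lemma continuous_map_update:
  assumes "continuous_map (Top_Tor I) (Top_Tor J) f" "continuous_on (Tor I) g" "\<And>z. z \<in> Tor I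
      \<Longrightarrow> norm (g z) = 1" "insert b J \<subseteq> K"
  shows "continuous_map (Top_Tor I) (Top_Tor K) (\<lambda>z. (f z)(b := g z))"
proof -
  have f: "\<And>i. continuous_on (Tor I) (\<lambda>z. f z i)" "\<And>z. z \<in> Tor I \<Longrightarrow> f
      z \<in> Tor J"
    using assms(1) unfolding continuous_map_Top_Tor by blast+
  have "continuous_on (Tor I) (\<lambda>z. ((f z)(b := g z)) i)" for i
    using f assms(2) by (cases "i = b") auto
  moreover have "(f z)(b := g z) \<in> Tor K" if "z \<in> Tor I" for z
    using f(2)[OF that] assms(3)[OF that] assms(4) by (auto simp: Tor_def)
  ultimately show ?thesis unfolding continuous_map_Top_Tor by blast
qed

text \<open>A map that ignores coordinate \<open>c\<close> factors through a torus of smaller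
  dimension, whose homology in degree \<open>card I\<close> vanishes.\<close>

lemma map_Tor_indep:
  assumes I: "finite I" "c \<in> I" and g: "continuous_map (Top_Tor I) (Top_Tor K) g" 
    and eq: "\<And>z. z \<in> Tor I \<Longrightarrow> g (z(c := 1)) = g z" and x: "x \<in> carrier (H_Tor
        (int (card I)) I)"
  shows "map_Tor (int (card I)) I K g x = \<one>\<^bsub>H_Tor (int (card I)) K\<^esub>"
proof -
  have "map_Tor (int (card I)) I K g = map_Tor (int (card I)) I K (g \<circ> proj (I - {c}))"
  proof (rule map_Tor_eq)
    fix z assume z: "z \<in> Tor I"
    then have "proj (I - {c}) z = z(c := 1)" by (auto simp: proj_def Tor_def fun_eq_iff)
    then show "g z = (g \<circ> proj (I - {c})) z" using eq[OF z] by simp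
  qed
  moreover have "continuous_map (Top_Tor (I - {c})) (Top_Tor K) g"
    using continuous_map_compose[OF continuous_map_incl g, of "I - {c}"] by simp
  then have "map_Tor (int (card I)) I K (g \<circ> proj (I - {c})) x = \<one>\<^bsub>H_Tor (int (card I))
      K\<^esub>"
    by (intro torus_factor_trivial[where K="I - {c}"] continuous_map_proj)
      (use I x card_Diff1_less[OF I] in auto)
  ultimately show ?thesis by simp
qed

text \<open>
  The map \<open>z \<mapsto> z(b := z a)\<close> pushes the fundamental class to the sum of its images
      under the inclusion
  and under moving coordinate \<open>a\<close> to \<open>b\<close>: every projection to another
      \<open>n\<close>-dimensional coordinate
  torus factors through a torus of smaller dimension.
\<close>

lemma deg_Tor_add:
  assumes I: "finite I" "a \<in> I" "b \<notin> I" and F: "continuous_map (Top_Tor (insert b I)) (Top_Tor I) F"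
  shows "deg_Tor I (\<lambda>z. F (z(b := z a))) = deg_Tor I F + deg_Tor I (\<lambda>z. F (z(a := 1, b := z a)))"
proof -
  let ?n = "int (card I)" and ?I = "insert b I"
  define \<Delta> where "\<Delta> z = z(b := z a)" for z :: "nat \<Rightarrow> complex"
  define s where "s z = z(a := 1, b := z a)" for z :: "nat \<Rightarrow> complex"
  have na: "norm (z a) = 1" if "z \<in> Tor I" for z using that by (simp add: Tor_def)
  have ab: "a \<noteq> b" using I by auto
  have idI: "continuous_map (Top_Tor I) (Top_Tor I) (\<lambda>z. z)" using continuous_map_id[of "Top_Tor
      I"] by (simp add: id_def)
  have c\<Delta>: "continuous_map (Top_Tor I) (Top_Tor ?I) \<Delta>"
    unfolding \<Delta>_def by (rule continuous_map_update[OF idI]) (use na in \<open>auto intro!: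
        continuous_intros\<close>)
  have cs: "continuous_map (Top_Tor I) (Top_Tor ?I) s"
    unfolding s_def by (rule continuous_map_update[OF continuous_map_update[OF idI, where K=I]]) 
      (use na I in \<open>auto intro!: continuous_intros\<close>)
  have ci: "continuous_map (Top_Tor I) (Top_Tor ?I) id" by (rule continuous_map_incl) auto
  let ?x = "class_Tor I"
  have x: "?x \<in> carrier (H_Tor ?n I)" using class_Tor[OF I(1)] by simp
  interpret G: comm_group "H_Tor ?n ?I" by (rule abelian_homology_group)
  let ?d = "map_Tor ?n I ?I \<Delta> ?x" and ?i = "map_Tor ?n I ?I id ?x" and ?s = "map_Tor ?n I ?I s ?x"
  have car: "?d \<in> carrier (H_Tor ?n ?I)" "?i \<in> carrier (H_Tor ?n ?I)" "?s \<in> carrier (H_Tor ?n ?I)"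
    by (auto intro: hom_induced_carrier)
  have "?d \<otimes>\<^bsub>H_Tor ?n ?I\<^esub> inv\<^bsub>H_Tor ?n ?I\<^esub> (?i \<otimes>\<^bsub>H_Tor
      ?n ?I\<^esub> ?s) = \<one>\<^bsub>H_Tor ?n ?I\<^esub>"
  proof (rule torus_detect)
    fix K assume K: "K \<subseteq> ?I" "int (card K) = ?n"
    interpret K: comm_group "H_Tor ?n K" by (rule abelian_homology_group)
    have cp: "continuous_map (Top_Tor ?I) (Top_Tor K) (proj K)" by (rule continuous_map_proj) auto
    interpret h: group_hom "H_Tor ?n ?I" "H_Tor ?n K" "map_Tor ?n ?I K (proj K)"
      using hom_induced_empty_hom by (simp add: group_hom_def group_hom_axioms_def)
    have comp: "map_Tor ?n ?I K (proj K) (map_Tor ?n I ?I f ?x) = map_Tor ?n I K (proj K \<circ> f) ?x" 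
      if "continuous_map (Top_Tor I) (Top_Tor ?I) f" for f
      by (rule map_Tor_compose[OF that cp])
    have cc: "continuous_map (Top_Tor I) (Top_Tor K) (proj K \<circ> f)" if "continuous_map (Top_Tor I)
        (Top_Tor ?I) f" for f
      by (rule continuous_map_compose[OF that cp])
    have "map_Tor ?n I K (proj K \<circ> \<Delta>) ?x = map_Tor ?n I K (proj K \<circ> id) ?x
        \<otimes>\<^bsub>H_Tor ?n K\<^esub> map_Tor ?n I K (proj K \<circ> s) ?x"
    proof -
      \<comment> \<open>By its size \<open>K\<close> misses exactly one index \<open>c\<close>. If
        it is \<open>b\<close>, the shifted term \<open>s\<close> dies and the other two agree. If
        it is \<open>a\<close>, the inclusion dies and the other two agree. Otherwise all three maps
        ignore coordinate \<open>c\<close> and die.\<close>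
      have "card ?I = Suc (card K)" using K I by simp
      then have "card (?I - K) = 1" using K I by (simp add: card_Diff_subset finite_subset)
      then obtain c where c: "?I - K = {c}" by (auto simp: card_1_singleton_iff)
      then consider "c = b" | "c = a" | "c \<in> I" "c \<noteq> a" "c \<notin> K" by auto
      then show ?thesis
      proof cases
        case 1
        then have KI: "K = I" using c K I by auto
        then have xK: "?x \<in> carrier (H_Tor ?n K)" using x by simp
        have "map_Tor ?n I K (proj K \<circ> \<Delta>) ?x = ?x" unfolding KI
          by (rule map_Tor_id[OF x]) (use I in \<open>auto simp: proj_def \<Delta>_def Tor_def fun_eq_iff\<close>)
        moreover have "map_Tor ?n I K (proj K \<circ> id) ?x = ?x" unfolding KI
          by (rule map_Tor_id[OF x]) (use I in \<open>auto simp: proj_def Tor_def fun_eq_iff\<close>)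
        moreover have "map_Tor ?n I K (proj K \<circ> s) ?x = \<one>\<^bsub>H_Tor ?n K\<^esub>"
          by (rule map_Tor_indep[OF I(1,2) cc[OF cs] _ x]) (use KI I in \<open>auto simp: proj_def s_def
              fun_eq_iff\<close>)
        ultimately show ?thesis by (simp only: K.r_one[OF xK])
      next
        case 2
        then have KI: "K = insert b (I - {a})" using c K I by auto
        have "map_Tor ?n I K (proj K \<circ> id) ?x = \<one>\<^bsub>H_Tor ?n K\<^esub>"
          by (rule map_Tor_indep[OF I(1,2) cc[OF ci] _ x]) (use KI I in \<open>auto simp: proj_def
              fun_eq_iff\<close>)
        moreover have "map_Tor ?n I K (proj K \<circ> \<Delta>) = map_Tor ?n I K (proj K \<circ> s)"
          by (rule map_Tor_eq) (use KI I in \<open>auto simp: proj_def \<Delta>_def s_def fun_eq_iff\<close>)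
        ultimately show ?thesis by (simp only: K.l_one[OF hom_induced_carrier])
      next
        case 3
        have "map_Tor ?n I K (proj K \<circ> id) ?x = \<one>\<^bsub>H_Tor ?n K\<^esub>"
          by (rule map_Tor_indep[OF I(1) 3(1) cc[OF ci] _ x]) (use 3 in \<open>auto simp: proj_def
              fun_eq_iff\<close>)
        moreover have "map_Tor ?n I K (proj K \<circ> \<Delta>) ?x = \<one>\<^bsub>H_Tor ?n K\<^esub>"
          by (rule map_Tor_indep[OF I(1) 3(1) cc[OF c\<Delta>] _ x]) (use 3 in \<open>auto simp: proj_def
              \<Delta>_def fun_eq_iff\<close>)
        moreover have "map_Tor ?n I K (proj K \<circ> s) ?x = \<one>\<^bsub>H_Tor ?n K\<^esub>"
          by (rule map_Tor_indep[OF I(1) 3(1) cc[OF cs] _ x]) (use 3 in \<open>auto simp: proj_def s_def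
              fun_eq_iff\<close>)
        ultimately show ?thesis by (simp only: K.l_one[OF K.one_closed])
      qed
    qed
    then show "map_Tor ?n ?I K (proj K) (?d \<otimes>\<^bsub>H_Tor ?n ?I\<^esub> inv\<^bsub>H_Tor ?n
        ?I\<^esub> (?i \<otimes>\<^bsub>H_Tor ?n ?I\<^esub> ?s)) = \<one>\<^bsub>H_Tor ?n K\<^esub>"
      using car by (simp add: comp[OF c\<Delta>] comp[OF ci] comp[OF cs] hom_induced_carrier del: o_id id_o)
  qed (use I car in auto)
  from iffD1[OF G.inv_solve_right[OF G.one_closed car(1) G.m_closed[OF car(2,3)]] this[symmetric]]
  have sum: "?d = ?i \<otimes>\<^bsub>H_Tor ?n ?I\<^esub> ?s"
    by (simp only: G.l_one[OF G.m_closed[OF car(2,3)]])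
  let ?h = "orientation_Tor I \<circ> map_Tor ?n ?I I F"
  have "orientation_Tor I \<in> hom (H_Tor ?n I) integer_group" using orientation_Tor[OF I(1)] by (auto
      simp: iso_iff)
  then have "?h \<in> hom (H_Tor ?n ?I) integer_group" by (intro hom_compose[OF hom_induced_hom])
  then have "?h ?d = ?h ?i + ?h ?s" unfolding sum using car by (simp add: hom_def)
  moreover have "?h ?d = deg_Tor I (\<lambda>z. F (z(b := z a)))"
    using map_Tor_compose[OF c\<Delta> F, of ?n ?x] by (simp add: deg_Tor_def o_def \<Delta>_def)
  moreover have "?h ?i = deg_Tor I F"
    using map_Tor_compose[OF ci F, of ?n ?x] by (simp add: deg_Tor_def)
  moreover have "?h ?s = deg_Tor I (\<lambda>z. F (z(a := 1, b := z a)))"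
    using map_Tor_compose[OF cs F, of ?n ?x] by (simp add: deg_Tor_def o_def s_def)
  ultimately show ?thesis by simp
qed

text \<open>The counterpart of \<open>map_Tor_indep\<close> on the output side: the image lies in
  the subtorus where coordinate \<open>c\<close> is 1.\<close>

lemma deg_Tor_indep:
  assumes I: "finite I" "c \<in> I" and g: "continuous_map (Top_Tor I) (Top_Tor I) g" 
    and eq: "\<And>z. z \<in> Tor I \<Longrightarrow> g z c = 1"
  shows "deg_Tor I g = 0"
proof -
  have "g \<in> Tor I \<rightarrow> Tor (I - {c})" using g eq by (auto simp: continuous_map_Top_Tor Tor_def Pi_iff)
  then have "continuous_map (Top_Tor I) (Top_Tor (I - {c})) g" using g by (simp add: continuous_map_Top_Tor)
  from deg_Tor_factor[OF this continuous_map_incl] have "deg_Tor I (id \<circ> g) = 0"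
    using I card_Diff1_less[OF I] by blast
  then show ?thesis by simp
qed

lemma continuous_map_idt: "continuous_map (Top_Tor I) (Top_Tor I) (\<lambda>z. z)"
  using continuous_map_id[of "Top_Tor I"] by (simp add: id_def)

definition shear :: "nat \<Rightarrow> nat \<Rightarrow> int \<Rightarrow> (nat \<Rightarrow> complex)
    \<Rightarrow> nat \<Rightarrow> complex"
  where "shear a b c z = z(b := z b * z a powi c)"

lemma continuous_map_shear: "b \<in> I \<Longrightarrow> continuous_map (Top_Tor I) (Top_Tor I) (shear a b c)"
  unfolding shear_def
  by (rule continuous_map_update[OF continuous_map_idt]) 
    (auto intro!: continuous_intros dest: Tor_nonzero simp: norm_mult norm_power_int Tor_norm)

text \<open>A spare coordinate \<open>b'\<close> supplies the factor \<open>z a powi c\<close>. In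
  the decomposition of \<open>deg_Tor_add\<close> the inclusion gives the identity, and the other
  term has coordinate \<open>a\<close> constantly 1, hence degree 0.\<close>

lemma deg_Tor_shear:
  assumes I: "finite I" "a \<in> I" "b \<in> I" "a \<noteq> b"
  shows "deg_Tor I (shear a b c) = 1"
proof -
  obtain b' where b': "b' \<notin> I" using I(1) ex_new_if_finite infinite_UNIV_nat by blast
  define F where "F z = (proj I z)(b := z b * z b' powi c)" for z
  have cF: "continuous_map (Top_Tor (insert b' I)) (Top_Tor I) F"
    unfolding F_def
    by (rule continuous_map_update[OF continuous_map_proj[of I "insert b' I" I]])
      (use I in \<open>auto intro!: continuous_intros dest: Tor_nonzero simp: norm_mult norm_power_int
          Tor_norm\<close>)
  have "deg_Tor I (shear a b c) = deg_Tor I (\<lambda>z. F (z(b' := z a)))"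
    by (rule deg_Tor_cong) (use I b' in \<open>auto simp: F_def shear_def proj_def Tor_def fun_eq_iff\<close>)
  also have "\<dots> = deg_Tor I F + deg_Tor I (\<lambda>z. F (z(a := 1, b' := z a)))"
    by (rule deg_Tor_add[OF I(1,2) b' cF])
  also have "deg_Tor I F = 1"
    by (rule deg_Tor_id[OF I(1)]) (use I b' in \<open>auto simp: F_def proj_def Tor_def fun_eq_iff\<close>)
  also have "deg_Tor I (\<lambda>z. F (z(a := 1, b' := z a))) = 0"
  proof (rule deg_Tor_indep[OF I(1,2)])
    have "continuous_map (Top_Tor I) (Top_Tor (insert b' I)) (\<lambda>z. z(a := 1, b' := z a))"
      by (rule continuous_map_update[OF continuous_map_update[OF continuous_map_idt, where K=I]]) 
       (use I in \<open>auto intro!: continuous_intros simp: Tor_def\<close>)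
    from continuous_map_compose[OF this cF] show "continuous_map (Top_Tor I) (Top_Tor I) (\<lambda>z. F
        (z(a := 1, b' := z a)))"
      by (simp add: o_def)
    show "F (z(a := 1, b' := z a)) a = 1" for z
      using I b' by (auto simp: F_def proj_def)
  qed
  finally show ?thesis by simp
qed

definition cpow :: "nat \<Rightarrow> int \<Rightarrow> (nat \<Rightarrow> complex) \<Rightarrow> nat
    \<Rightarrow> complex"
  where "cpow a c z = z(a := z a powi c)"

lemma continuous_map_cpow: "a \<in> I \<Longrightarrow> continuous_map (Top_Tor I) (Top_Tor I) (cpow a c)"
  unfolding cpow_def
  by (rule continuous_map_update[OF continuous_map_idt]) 
    (auto intro!: continuous_intros dest: Tor_nonzero simp: norm_mult norm_power_int Tor_norm)

lemma additive_int:
  fixes g :: "int \<Rightarrow> int"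
  assumes add: "\<And>c d. g (c + d) = g c + g d"
  shows "g c = c * g 1"
proof -
  have 0: "g 0 = 0" using add[of 0 0] by simp
  have nat: "g (int n) = int n * g 1" for n
    by (induction n) (auto simp: 0 add algebra_simps)
  show ?thesis
  proof (cases "c \<ge> 0")
    case True
    then show ?thesis using nat[of "nat c"] by simp
  next
    case False
    then have "g (-c) = (-c) * g 1" using nat[of "nat (-c)"] by simp
    then show ?thesis using add[of c "-c"] 0 by simp
  qed
qed

text \<open>With a spare coordinate carrying one part of the exponent, \<open>deg_Tor_add\<close>
  makes the degree additive in \<open>c\<close>; exponent 1 gives the identity.\<close>

lemma deg_Tor_cpow:
  assumes I: "finite I" "a \<in> I"
  shows "deg_Tor I (cpow a c) = c"
proof -
  obtain b' where b': "b' \<notin> I" using I(1) ex_new_if_finite infinite_UNIV_nat by blast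
  have ab: "a \<noteq> b'" using I b' by auto
  have "deg_Tor I (cpow a (c + d)) = deg_Tor I (cpow a c) + deg_Tor I (cpow a d)" for c d
  proof -
    define F where "F z = (proj I z)(a := z a powi c * z b' powi d)" for z
    have cF: "continuous_map (Top_Tor (insert b' I)) (Top_Tor I) F"
      unfolding F_def
      by (rule continuous_map_update[OF continuous_map_proj[of I "insert b' I" I]])
        (use I in \<open>auto intro!: continuous_intros dest: Tor_nonzero simp: norm_mult norm_power_int
            Tor_norm\<close>)
    have "deg_Tor I (cpow a (c + d)) = deg_Tor I (\<lambda>z. F (z(b' := z a)))"
      by (rule deg_Tor_cong) (use I b' ab in \<open>auto simp: F_def cpow_def proj_def Tor_out Tor_nonzero
          fun_eq_iff power_int_add\<close>)
    also have "\<dots> = deg_Tor I F + deg_Tor I (\<lambda>z. F (z(a := 1, b' := z a)))"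
      by (rule deg_Tor_add[OF I(1,2) b' cF])
    also have "deg_Tor I F = deg_Tor I (cpow a c)"
      by (rule deg_Tor_cong) (use I b' in \<open>auto simp: F_def cpow_def proj_def Tor_def fun_eq_iff\<close>)
    also have "deg_Tor I (\<lambda>z. F (z(a := 1, b' := z a))) = deg_Tor I (cpow a d)"
      by (rule deg_Tor_cong) (use I b' ab in \<open>auto simp: F_def cpow_def proj_def Tor_def fun_eq_iff\<close>)
    finally show ?thesis .
  qed
  from additive_int[of "\<lambda>c. deg_Tor I (cpow a c)", OF this] show ?thesis
    using deg_Tor_id[OF I(1), of "cpow a 1"] by (simp add: cpow_def)
qed

text \<open>Written multiplicatively, the torus endomorphism whose lift under the exponential cover
  is the linear map \<open>M\<close>.\<close>

definition lin_Tor :: "nat set \<Rightarrow> (nat \<Rightarrow> nat \<Rightarrow> int) \<Rightarrow> (nat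
    \<Rightarrow> complex) \<Rightarrow> nat \<Rightarrow> complex"
  where "lin_Tor I M z = (\<lambda>i. if i \<in> I then \<Prod>j\<in>I. z j powi M i j else 1)"

lemma continuous_map_lin_Tor_Tor: "continuous_map (Top_Tor I) (Top_Tor I) (lin_Tor I M)"
  unfolding continuous_map_Top_Tor
proof (intro conjI allI)
  show "continuous_on (Tor I) (\<lambda>z. lin_Tor I M z i)" for i
    by (cases "i \<in> I") (auto simp: lin_Tor_def intro!: continuous_intros dest: Tor_nonzero)
  show "lin_Tor I M \<in> Tor I \<rightarrow> Tor I"
    by (auto simp: lin_Tor_def Tor_def norm_power_int simp flip: prod_norm)
qed

lemma prod_power_int:
  fixes f :: "'i \<Rightarrow> 'b::field"
  shows "(\<Prod>j\<in>A. f j) powi c = (\<Prod>j\<in>A. f j powi c)"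
  by (induction A rule: infinite_finite_induct) (auto simp: power_int_mult_distrib)

lemma lin_Tor_rowop:
  assumes "finite I" "a \<in> I" "b \<in> I" "a \<noteq> b" "z \<in> Tor I"
  shows "lin_Tor I (rowop a b c M) z = shear a b c (lin_Tor I M z)"
proof
  fix i
  have "(\<Prod>j\<in>I. z j powi (M b j + c * M a j)) = (\<Prod>j\<in>I. z j powi M b j) *
      (\<Prod>j\<in>I. z j powi M a j) powi c"
    using Tor_nonzero[OF assms(5)] 
    by (simp add: power_int_add power_int_mult prod.distrib mult.commute[of c] prod_power_int)
  then show "lin_Tor I (rowop a b c M) z i = shear a b c (lin_Tor I M z) i"
    using assms by (simp add: lin_Tor_def rowop_def shear_def)
qed

text \<open>The column addition acts on the input: giving \<open>z b\<close> the extra exponent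
  \<open>c * M i a\<close> for every \<open>i\<close> amounts to multiplying \<open>z a\<close> by
  \<open>z b powi c\<close>. Hence the shear goes from \<open>b\<close> to \<open>a\<close>,
  opposite to the row case.\<close>

lemma lin_Tor_colop:
  assumes "finite I" "a \<in> I" "b \<in> I" "a \<noteq> b" "z \<in> Tor I"
  shows "lin_Tor I (colop a b c M) z = lin_Tor I M (shear b a c z)"
proof
  fix i
  have "(\<Prod>j\<in>I. z j powi colop a b c M i j) = (\<Prod>j\<in>I. z j powi M i j * (if j = b then z b
      powi (c * M i a) else 1))"
    using Tor_nonzero[OF assms(5)] by (intro prod.cong) (auto simp: colop_def power_int_add)
  also have "\<dots> = (\<Prod>j\<in>I. z j powi M i j) * z b powi (c * M i a)"
    using assms by (simp add: prod.distrib)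
  also have "\<dots> = (\<Prod>j\<in>I. z j powi M i j * (if j = a then z b powi (c * M i a) else 1))"
    using assms by (simp add: prod.distrib)
  also have "\<dots> = (\<Prod>j\<in>I. shear b a c z j powi M i j)"
    using Tor_nonzero[OF assms(5)] assms(4)
    by (intro prod.cong) (auto simp: shear_def power_int_mult_distrib power_int_mult)
  finally show "lin_Tor I (colop a b c M) z i = lin_Tor I M (shear b a c z) i"
    by (simp add: lin_Tor_def)
qed

text \<open>Shears have degree 1 and additions preserve the determinant, so neither side changes on
  the way to a diagonal matrix, where only powers of single coordinates remain.\<close>

theorem deg_Tor_lin_Tor_Tor:
  assumes I: "finite I"
  shows "deg_Tor I (lin_Tor I M) = int_det I M"
  using I
proof (induction M rule: diagonalize_induct)
  case (diag D)
  \<comment> \<open>One coordinate at a time, so that each step composes with a single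
    \<open>cpow\<close> and degrees multiply.\<close>
  have *: "deg_Tor I (\<lambda>z i. if i \<in> S then z i powi D i i else z i) = (\<Prod>i\<in>S. D i i)"
      if "finite S" "S \<subseteq> I" for S
    using that
  proof (induction S rule: finite_induct)
    case empty
    then show ?case using deg_Tor_id[OF I] by simp
  next
    case (insert a S)
    let ?f = "\<lambda>S z i. if i \<in> S then z i powi D i i else z i"
    have c: "continuous_map (Top_Tor I) (Top_Tor I) (?f S)"
      unfolding continuous_map_Top_Tor
    proof (intro conjI allI)
      show "continuous_on (Tor I) (\<lambda>z. if i \<in> S then z i powi D i i else z i)" for i
        by (cases "i \<in> S") (auto intro!: continuous_intros dest: Tor_nonzero)
    qed (auto simp: Tor_def norm_power_int)
    have "deg_Tor I (?f (insert a S)) = deg_Tor I (cpow a (D a a) \<circ> ?f S)"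
      by (rule deg_Tor_cong) (use insert in \<open>auto simp: cpow_def fun_eq_iff\<close>)
    also have "\<dots> = D a a * (\<Prod>i\<in>S. D i i)"
      using deg_Tor_compose[OF I c continuous_map_cpow] deg_Tor_cpow[OF I] insert by simp
    finally show ?case using insert by simp
  qed
  have "deg_Tor I (lin_Tor I D) = deg_Tor I (\<lambda>z i. if i \<in> I then z i powi D i i else z i)"
  proof (rule deg_Tor_cong, rule ext)
    fix z i assume z: "z \<in> Tor I"
    have "(\<Prod>j\<in>I. z j powi D i j) = (\<Prod>j\<in>{i}. z j powi D i j)" if "i \<in> I"
      using I that diag by (intro prod.mono_neutral_right) auto
    then show "lin_Tor I D z i = (if i \<in> I then z i powi D i i else z i)"
      using z by (auto simp: lin_Tor_def Tor_def)
  qed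
  then show ?case using *[OF I] int_det_diag[OF I, of D] diag by simp
next
  case (row a b c N)
  have "deg_Tor I (lin_Tor I (rowop a b c N)) = deg_Tor I (shear a b c \<circ> lin_Tor I N)"
    by (rule deg_Tor_cong) (use lin_Tor_rowop[OF I row(2-4)] in simp)
  then show ?case
    using deg_Tor_compose[OF I continuous_map_lin_Tor_Tor continuous_map_shear[OF row(3), of a c], of N]
        deg_Tor_shear[OF I row(2-4)] row int_det_rowop[OF I row(2-4)]
    by simp
next
  case (col a b c N)
  have "deg_Tor I (lin_Tor I (colop a b c N)) = deg_Tor I (lin_Tor I N \<circ> shear b a c)"
    by (rule deg_Tor_cong) (use lin_Tor_colop[OF I col(2-4)] in simp)
  then show ?case
    using deg_Tor_compose[OF I continuous_map_shear[OF col(2), of b c] continuous_map_lin_Tor_Tor, of N]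
        deg_Tor_shear[OF I col(3,2)] col int_det_colop[OF I col(2-4)]
    by simp
qed

lemma lefschetz_number_lin_Tor_Tor:
  assumes I: "finite I" and \<theta>: "homeomorphic_maps X (Top_Tor I) \<theta> \<theta>'" and f:
      "continuous_map X X f"
    and hom: "homotopic_with (\<lambda>h. True) (Top_Tor I) (Top_Tor I) (\<theta> \<circ> f \<circ>
        \<theta>') (lin_Tor I A)"
  shows "lefschetz_number X f = int_det I (\<lambda>i j. (if i = j then 1 else 0) - A i j)"
proof -
  have "deg_Tor J (proj J \<circ> \<theta> \<circ> f \<circ> \<theta>') = int_det J A" if J: "J \<subseteq>
      I" for J
  proof -
    have fJ: "finite J" using I J finite_subset by blast
    have "homotopic_with (\<lambda>h. True) (Top_Tor J) (Top_Tor J) ((proj J \<circ> (\<theta> \<circ> f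
        \<circ> \<theta>')) \<circ> id) ((proj J \<circ> lin_Tor I A) \<circ> id)"
      by (intro homotopic_with_compose_continuous_map_right[OF
          homotopic_with_compose_continuous_map_left[OF hom continuous_map_proj]] 
          continuous_map_incl) (use J in auto)
    then have "deg_Tor J (proj J \<circ> \<theta> \<circ> f \<circ> \<theta>') = deg_Tor J (proj J \<circ>
        lin_Tor I A)"
      using deg_Tor_homotopic by (simp add: o_assoc)
    also have "\<dots> = deg_Tor J (lin_Tor J A)"
    proof (rule deg_Tor_cong, rule ext)
      fix z i assume z: "z \<in> Tor J"
      \<comment> \<open>Coordinates outside \<open>J\<close> are 1 on \<open>Tor J\<close>, so
        restricting to it and projecting back cuts out the principal submatrix on
        \<open>J\<close>.\<close>
      have "(\<Prod>j\<in>I. z j powi A i j) = (\<Prod>j\<in>J. z j powi A i j)"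
        using I J z by (intro prod.mono_neutral_right) (auto simp: Tor_def)
      then show "(proj J \<circ> lin_Tor I A) z i = lin_Tor J A z i"
        using J by (auto simp: proj_def lin_Tor_def)
    qed
    finally show ?thesis using deg_Tor_lin_Tor_Tor[OF fJ] by simp
  qed
  then show ?thesis
    unfolding lefschetz_number_torus[OF I \<theta> f] int_det_one_minus[OF I, symmetric] by (intro sum.cong) auto
qed

section \<open>Lifting torus maps\<close>

lemma Tor_PiE: "Tor I = PiE UNIV (\<lambda>i. if i \<in> I then sphere 0 1 else {1})"
  by (auto simp: Tor_def PiE_UNIV_domain Pi_iff split: if_splits) (metis norm_one)

lemma compact_Tor: "compact (Tor I)"
proof -
  have "compactin (product_topology (\<lambda>i. euclidean) UNIV) (Tor I)"
    unfolding Tor_PiE compactin_PiE by auto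
  then show ?thesis by (simp add: euclidean_product_topology)
qed

lemma connected_Tor: "connected (Tor I)"
proof -
  have "connected (sphere (0::complex) 1)" by (rule connected_sphere) simp
  then have "connectedin (product_topology (\<lambda>i. euclidean) UNIV) (Tor I)"
    unfolding Tor_PiE connectedin_PiE by auto
  then show ?thesis by (simp add: euclidean_product_topology)
qed

text \<open>
  By uniform continuity consecutive ratios \<open>r j\<close> lie in the right half-plane, so that the sum of their
  principal arguments is a continuous lift.
\<close>

lemma circle_homotopy_lift:
  fixes k :: "'a::metric_space \<times> real \<Rightarrow> complex"
  assumes S: "compact S" "connected S" and k: "continuous_on (S \<times> {0..1}) k"
    and norm: "\<And>x s. \<lbrakk>x \<in> S; 0 \<le> s; s \<le> 1\<rbrakk> \<Longrightarrow> norm (k (x, s)) = 1"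
    and k0: "\<And>x. x \<in> S \<Longrightarrow> k (x, 0) = 1" and k1: "\<And>x. x \<in> S
        \<Longrightarrow> k (x, 1) = 1"
  obtains \<theta> :: "'a \<times> real \<Rightarrow> real" and n :: int where "continuous_on (S \<times>
      {0..1}) \<theta>"
    "\<And>x s. \<lbrakk>x \<in> S; 0 \<le> s; s \<le> 1\<rbrakk> \<Longrightarrow> k (x, s) = exp (\<i> *
        of_real (\<theta> (x, s)))"
    "\<And>x. x \<in> S \<Longrightarrow> \<theta> (x, 0) = 0" "\<And>x. x \<in> S \<Longrightarrow>
        \<theta> (x, 1) = 2 * pi * of_int n"
proof -
  have "uniformly_continuous_on (S \<times> {0..1}) k"
    by (intro compact_uniformly_continuous k compact_Times S) auto
  then obtain \<delta> where \<delta>: "\<delta> > 0" "\<And>u v. \<lbrakk>u \<in> S \<times> {0..1}; v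
      \<in> S \<times> {0..1}; dist v u < \<delta>\<rbrakk> \<Longrightarrow> dist (k v) (k u) < 1"
    unfolding uniformly_continuous_on_def by (metis zero_less_one)
  obtain N :: nat where N: "N > 0" "1 / real N < \<delta>"
    using \<delta>(1) by (metis nat_approx_posE zero_less_Suc inverse_eq_divide)
  define r where "r j = (\<lambda>xs. k (fst xs, real (Suc j) * snd xs / real N) / k (fst xs, real j * snd
      xs / real N))" for j
  define \<theta> where "\<theta> xs = (\<Sum>j<N. Im (Ln (r j xs)))" for xs
  have in01: "0 \<le> real j * s / real N" "real j * s / real N \<le> 1" if "j \<le> N" "0 \<le> s" "s
      \<le> 1" for j s
  proof -
    have "real j * s \<le> real N * 1" using that by (intro mult_mono) auto
    then show "0 \<le> real j * s / real N" "real j * s / real N \<le> 1" using N that by (auto simp: divide_simps)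
  qed
  have knz: "k (x, s) \<noteq> 0" if "x \<in> S" "0 \<le> s" "s \<le> 1" for x s using norm[OF that] by auto
  have rnorm: "norm (r j (x, s)) = 1" if "j < N" "x \<in> S" "0 \<le> s" "s \<le> 1" for j x s
    using norm[OF that(2) in01] that by (simp add: r_def norm_divide del: of_nat_Suc)
  have rpos: "Re (r j (x, s)) > 0" if j: "j < N" and x: "x \<in> S" "0 \<le> s" "s \<le> 1" for j x s
  proof -
    let ?u = "(x, real j * s / real N)" and ?v = "(x, real (Suc j) * s / real N)"
    have u: "?u \<in> S \<times> {0..1}" "?v \<in> S \<times> {0..1}" using in01[of j s] in01[of "Suc j" s]
        j x by (auto simp del: of_nat_Suc)
    have "dist ?v ?u = \<bar>real (Suc j) * s / real N - real j * s / real N\<bar>"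
      by (simp add: dist_Pair_Pair dist_real_def)
    also have "\<dots> = s / real N" using x by (simp add: divide_simps algebra_simps)
    also have "\<dots> \<le> 1 / real N" using x N by (simp add: divide_simps)
    finally have "dist (k ?v) (k ?u) < 1" using N by (intro \<delta>(2)[OF u]) auto
    moreover have "r j (x, s) - 1 = (k ?v - k ?u) / k ?u"
      using knz[of x "real j * s / real N"] in01[of j s] j x by (simp add: r_def diff_divide_distrib)
    moreover have "norm (k ?u) = 1" using norm u by simp
    ultimately have "norm (r j (x, s) - 1) < 1" by (simp add: norm_divide dist_norm)
    then show ?thesis using abs_Re_le_cmod[of "r j (x, s) - 1"] by simp
  qed
  have contr: "continuous_on (S \<times> {0..1}) (r j)" if "j < N" for j
  proof -
    have c: "continuous_on (S \<times> {0..1}) (\<lambda>xs. k (fst xs, real i * snd xs / real N))" if "i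
        \<le> N" for i
      by (rule continuous_on_compose2[OF k]) (use in01 that N in \<open>auto intro!: continuous_intros\<close>)
    show ?thesis
      unfolding r_def using c[of j] c[of "Suc j"] that knz in01
      by (intro continuous_on_divide) (auto simp del: of_nat_Suc)
  qed
  have cont\<theta>: "continuous_on (S \<times> {0..1}) \<theta>"
    unfolding \<theta>_def
    by (intro continuous_on_sum continuous_on_Im continuous_on_Ln' contr)
      (use rpos in \<open>auto simp: complex_nonpos_Reals_iff\<close>, fastforce dest!: rpos)
  have exp\<theta>: "k (x, s) = exp (\<i> * of_real (\<theta> (x, s)))" if x: "x \<in> S" "0 \<le> s" "s
      \<le> 1" for x s
  proof -
    have e: "exp (\<i> * of_real (Im (Ln (r j (x, s))))) = r j (x, s)" if "j < N" for j
    proof -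
      have nz: "r j (x, s) \<noteq> 0" using rnorm[OF that x] by auto
      then have "Ln (r j (x, s)) = \<i> * of_real (Im (Ln (r j (x, s))))"
        using rnorm[OF that x] by (simp add: complex_eq_iff)
      then show ?thesis using exp_Ln[OF nz] by metis
    qed
    have prod: "(\<Prod>j<m. r j (x, s)) = k (x, real m * s / real N)" if "m \<le> N" for m
      using that
    proof (induction m)
      case 0
      then show ?case using k0[OF x(1)] by simp
    next
      case (Suc m)
      then show ?case using knz[OF x(1) in01[of m s]] x by (simp add: r_def)
    qed
    have "exp (\<i> * of_real (\<theta> (x, s))) = (\<Prod>j<N. exp (\<i> * of_real (Im (Ln (r j (x, s))))))"
      by (simp add: \<theta>_def of_real_sum sum_distrib_left exp_sum)
    also have "\<dots> = (\<Prod>j<N. r j (x, s))" by (intro prod.cong refl e) auto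
    also have "\<dots> = k (x, s)" using prod[of N] N by simp
    finally show ?thesis by simp
  qed
  have \<theta>0: "\<theta> (x, 0) = 0" if "x \<in> S" for x
    using k0[OF that] by (simp add: \<theta>_def r_def)
  have int: "\<exists>n::int. \<theta> (x, 1) = 2 * pi * of_int n" if "x \<in> S" for x
  proof -
    have "exp (\<i> * of_real (\<theta> (x, 1))) = 1" using exp\<theta>[OF that, of 1] k1[OF that] by simp
    then show ?thesis by (auto simp: exp_eq_1)
  qed
  \<comment> \<open>The end values are multiples of \<open>2 * pi\<close>, so distinct ones are at
    least that far apart, and a continuous function of this kind is constant on a connected
    set.\<close>
  have "(\<lambda>x. \<theta> (x, 1)) constant_on S"
  proof (rule continuous_discrete_range_constant[OF S(2)])
    show "continuous_on S (\<lambda>x. \<theta> (x, 1))"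
      by (rule continuous_on_compose2[OF cont\<theta>]) (auto intro!: continuous_intros)
    fix x assume x: "x \<in> S"
    have "2 * pi \<le> norm (\<theta> (y, 1) - \<theta> (x, 1))" if y: "y \<in> S" "\<theta> (y, 1)
        \<noteq> \<theta> (x, 1)" for y
    proof -
      obtain m n :: int where mn: "\<theta> (x, 1) = 2 * pi * of_int m" "\<theta> (y, 1) = 2 * pi * of_int n"
        using int x y by metis
      then have "\<bar>n - m\<bar> \<ge> 1" using y by auto
      then have "\<bar>real_of_int (n - m)\<bar> \<ge> 1" by linarith
      moreover have "norm (\<theta> (y, 1) - \<theta> (x, 1)) = 2 * pi * \<bar>real_of_int (n - m)\<bar>"
        unfolding mn by (simp add: abs_mult flip: right_diff_distrib)
      ultimately show ?thesis by simp
    qed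
    then show "\<exists>e>0. \<forall>y. y \<in> S \<and> \<theta> (y, 1) \<noteq> \<theta> (x, 1)
        \<longrightarrow> e \<le> norm (\<theta> (y, 1) - \<theta> (x, 1))"
      by (intro exI[of _ "2 * pi"]) auto
  qed
  then obtain c where c: "\<And>x. x \<in> S \<Longrightarrow> \<theta> (x, 1) = c" by (auto simp: constant_on_def)
  have "\<exists>n::int. \<forall>x\<in>S. \<theta> (x, 1) = 2 * pi * of_int n"
  proof (cases "S = {}")
    case False
    then obtain x where "x \<in> S" by auto
    then show ?thesis using c int by metis
  qed auto
  then show thesis using that cont\<theta> exp\<theta> \<theta>0 by blast
qed

text \<open>Going once around the new circle from a base point in \<open>Tor I\<close> gives a loop
  whose winding number \<open>n\<close> is the new exponent; it is the same for all base points
  because \<open>Tor I\<close> is connected. After division by that power a continuous angle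
  remains.\<close>

lemma torus_to_circle:
  assumes "finite I" "continuous_on (Tor I) g" "\<And>z. z \<in> Tor I \<Longrightarrow> norm (g z) = 1"
  shows "\<exists>(a::nat \<Rightarrow> int) \<phi>. continuous_on (Tor I) \<phi> \<and>
    (\<forall>z\<in>Tor I. g z = (\<Prod>j\<in>I. z j powi a j) * exp (\<i> * of_real (\<phi> z)))"
  using assms
proof (induction I arbitrary: g rule: finite_induct)
  case empty
  have T: "Tor {} = {\<lambda>_. 1}" by (auto simp: Tor_def)
  have "norm (g (\<lambda>_. 1)) = 1" using empty(2) T by auto
  then obtain t where "g (\<lambda>_. 1) = exp (\<i> * of_real t)" using complex_norm_eq_1_exp by metis
  then show ?case using T by (intro exI[of _ "\<lambda>_. 0"] exI[of _ "\<lambda>_. t"]) auto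
next
  case (insert a I)
  let ?I = "insert a I"
  have sub: "Tor I \<subseteq> Tor ?I" by (rule Tor_mono) auto
  have "continuous_on (Tor I) g" using insert.prems(1) sub by (rule continuous_on_subset)
  then obtain \<alpha> :: "nat \<Rightarrow> int" and \<phi>0 where \<phi>0: "continuous_on (Tor I) \<phi>0"
    "\<And>z. z \<in> Tor I \<Longrightarrow> g z = (\<Prod>j\<in>I. z j powi \<alpha> j) * exp (\<i> *
        of_real (\<phi>0 z))"
    using insert.IH[of g] insert.prems(2) sub by blast
  define q where "q = (\<lambda>xs::(nat \<Rightarrow> complex) \<times> real. (fst xs)(a := exp (2 * pi *
      \<i> * of_real (snd xs))))"
  have contq: "continuous_on (Tor I \<times> {0..1}) q"
    unfolding q_def
  proof (rule continuous_on_coordinatewise_then_product)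
    fix i
    have "continuous_on (Tor I \<times> {0..1::real}) (\<lambda>x. fst x i)"
      by (rule continuous_on_compose2[OF continuous_on_coord[of UNIV i] continuous_on_fst[OF
          continuous_on_id]]) auto
    then show "continuous_on (Tor I \<times> {0..1}) (\<lambda>xs. ((fst xs)(a := exp (2 * pi * \<i> *
        of_real (snd xs)))) i)"
      by (cases "i = a") (auto intro!: continuous_intros)
  qed
  have qT: "q (x, s) \<in> Tor ?I" if "x \<in> Tor I" for x s
    using that by (auto simp: q_def Tor_def norm_exp_eq_Re)
  define k where "k = (\<lambda>xs. g (q xs) / g (fst xs))"
  have gn: "norm (g z) = 1" if "z \<in> Tor ?I" for z using insert.prems(2) that by blast
  obtain \<theta> n where \<theta>: "continuous_on (Tor I \<times> {0..1}) \<theta>"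
    "\<And>x s. \<lbrakk>x \<in> Tor I; 0 \<le> s; s \<le> 1\<rbrakk> \<Longrightarrow> k (x, s) = exp
        (\<i> * of_real (\<theta> (x, s)))"
    "\<And>x. x \<in> Tor I \<Longrightarrow> \<theta> (x, 0) = 0" "\<And>x. x \<in> Tor I
        \<Longrightarrow> \<theta> (x, 1) = 2 * pi * of_int n"
  proof (rule circle_homotopy_lift[OF compact_Tor[of I] connected_Tor[of I], of k])
    have gnz: "g x \<noteq> 0" if "x \<in> Tor I" for x using gn[of x] that sub by auto
    show "continuous_on (Tor I \<times> {0..1}) k"
      unfolding k_def
    proof (intro continuous_on_divide ballI)
      show "continuous_on (Tor I \<times> {0..1}) (\<lambda>xs. g (q xs))"
        by (rule continuous_on_compose2[OF insert.prems(1) contq]) (use qT in auto)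
      show "continuous_on (Tor I \<times> {0..1}) (\<lambda>xs. g (fst xs))"
        by (rule continuous_on_compose2[OF insert.prems(1) continuous_on_fst[OF continuous_on_id]]) (use
            sub in auto)
    qed (use gnz in auto)
    fix x assume x: "x \<in> Tor I"
    have xa: "x a = 1" using x insert.hyps by (simp add: Tor_def)
    have "q (x, 0) = x" "q (x, 1) = x" using xa by (auto simp: q_def fun_eq_iff)
    then show "k (x, 0) = 1" "k (x, 1) = 1" using gnz[OF x] by (auto simp: k_def)
    show "norm (k (x, s)) = 1" for s
      using gn[OF qT[OF x]] gn[of x] x sub by (auto simp: k_def norm_divide)
  qed (rule that, assumption+)
  define s where "s z = Arg2pi (z a) / (2 * pi)" for z :: "nat \<Rightarrow> complex"
  have s: "0 \<le> s z" "s z < 1" "z = q (z(a := 1), s z)" if "z \<in> Tor ?I" for z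
  proof -
    show "0 \<le> s z" "s z < 1" using Arg2pi[of "z a"] by (auto simp: s_def)
    have "z a = exp (\<i> * of_real (Arg2pi (z a)))"
      using Arg2pi_eq[of "z a"] that by (simp add: Tor_def)
    then have "z a = exp (2 * pi * \<i> * of_real (s z))" by (simp add: s_def mult.commute)
    then show "z = q (z(a := 1), s z)" by (auto simp: q_def fun_eq_iff)
  qed
  have zI: "z(a := 1) \<in> Tor I" if "z \<in> Tor ?I" for z using that by (auto simp: Tor_def)
  \<comment> \<open>Subtracting \<open>n\<close> turns makes the lifted angle agree at both ends of
    the parameter interval, so the jump of \<open>Arg2pi\<close> no longer matters.\<close>
  define \<psi> where "\<psi> z = \<theta> (z(a := 1), s z) - 2 * pi * of_int n * s z" for z
  have \<psi>q: "\<psi> (q (x, t)) = \<theta> (x, t) - 2 * pi * of_int n * t" if x: "x \<in> Tor I" and t: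
      "0 \<le> t" "t \<le> 1" for x t
  proof -
    have xa: "x a = 1" using x insert.hyps by (simp add: Tor_def)
    have q1: "(q (x, t))(a := 1) = x" using xa by (auto simp: q_def fun_eq_iff)
    show ?thesis
    proof (cases "t = 1")
      case True
      \<comment> \<open>At the end of the circle the parameter jumps back to 0; the boundary values
        of \<open>\<theta>\<close> are what makes the formula hold there too.\<close>
      then have "s (q (x, t)) = 0" using Arg2pi_unique[of 1 0 1] by (simp add: s_def q_def)
      then show ?thesis using True x \<theta>(3,4) q1 by (simp add: \<psi>_def)
    next
      case False
      have "Arg2pi (exp (2 * pi * \<i> * of_real t)) = 2 * pi * t"
        using Arg2pi_unique[of 1 "2 * pi * t" "exp (2 * pi * \<i> * of_real t)"] False t by (simp add:
            algebra_simps)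
      then have "s (q (x, t)) = t" by (simp add: s_def q_def)
      then show ?thesis using q1 by (simp add: \<psi>_def)
    qed
  qed
  have cont\<psi>: "continuous_on (Tor ?I) \<psi>"
  proof -
    \<comment> \<open>The definition of \<open>\<psi>\<close> goes through the discontinuous
      \<open>s\<close>. Since \<open>q\<close> maps a compact space onto a Hausdorff one, it is a
      quotient map, and it is enough that the composite of \<open>\<psi>\<close> with
      \<open>q\<close> is continuous.\<close>
    have "quotient_map (top_of_set (Tor I \<times> {0..1})) (Top_Tor ?I) q"
    proof (rule continuous_imp_quotient_map)
      show "continuous_map (top_of_set (Tor I \<times> {0..1})) (Top_Tor ?I) q"
        using contq qT by (auto simp: continuous_map_subtopology_eu)
      show "compact_space (top_of_set (Tor I \<times> {0..1::real}))"
        by (simp add: compact_space_subtopology compact_Times compact_Tor)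
      show "Hausdorff_space (Top_Tor ?I)" by (simp add: Hausdorff_space_subtopology Hausdorff_space_euclidean)
      have "z \<in> q ` (Tor I \<times> {0..1})" if "z \<in> Tor ?I" for z
        using s[OF that] zI[OF that] by (intro image_eqI[of _ q "(z(a := 1), s z)"]) auto
      then show "q ` topspace (top_of_set (Tor I \<times> {0..1})) = topspace (Top_Tor ?I)" using qT by auto
    qed
    moreover have "continuous_on (Tor I \<times> {0..1}) (\<lambda>xt. \<theta> xt - 2 * pi * of_int n * snd xt)"
      using \<theta>(1) by (intro continuous_intros)
    then have "continuous_on (Tor I \<times> {0..1}) (\<psi> \<circ> q)"
      by (rule continuous_on_eq) (auto simp: \<psi>q)
    then have "continuous_map (top_of_set (Tor I \<times> {0..1})) euclidean (\<psi> \<circ> q)" by simp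
    ultimately have "continuous_map (Top_Tor ?I) euclidean \<psi>" by (rule continuous_compose_quotient_map)
    then show ?thesis by simp
  qed
  define \<phi> where "\<phi> z = \<phi>0 (z(a := 1)) + \<psi> z" for z
  have "continuous_on (Tor ?I) (\<lambda>z. z(a := 1))"
    using continuous_map_update[OF continuous_map_idt, of ?I "\<lambda>z. 1" a ?I] by (simp add:
        continuous_map_subtopology_eu)
  then have "continuous_on (Tor ?I) \<phi>"
    unfolding \<phi>_def using cont\<psi> zI by (intro continuous_on_add continuous_on_compose2[OF
        \<phi>0(1)]) auto
  moreover have "g z = (\<Prod>j\<in>?I. z j powi (\<alpha>(a := n)) j) * exp (\<i> * of_real (\<phi> z))"
      if z: "z \<in> Tor ?I" for z
  proof -
    let ?x = "z(a := 1)"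
    have "g ?x \<noteq> 0" using gn[of ?x] zI[OF z] sub by auto
    then have "g z = g ?x * k (?x, s z)" unfolding k_def using s(3)[OF z] by simp
    also have "k (?x, s z) = exp (\<i> * of_real (\<theta> (?x, s z)))" using \<theta>(2)[OF zI[OF z]] s[OF
        z] by simp
    also have "\<theta> (?x, s z) = \<psi> z + 2 * pi * of_int n * s z" by (simp add: \<psi>_def)
    also have "exp (\<i> * of_real (\<psi> z + 2 * pi * of_int n * s z)) = exp (\<i> * of_real (\<psi> z))
        * exp (of_int n * (2 * pi * \<i> * of_real (s z)))"
      by (simp add: algebra_simps flip: exp_add)
    also have "exp (of_int n * (2 * pi * \<i> * of_real (s z))) = (z a) powi n"
      using s(3)[OF z] by (subst exp_power_int[symmetric]) (metis fun_upd_same fst_conv snd_conv q_def)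
    also have "g ?x = (\<Prod>j\<in>I. z j powi (\<alpha>(a := n)) j) * exp (\<i> * of_real (\<phi>0 ?x))"
      unfolding \<phi>0(2)[OF zI[OF z]] using insert.hyps by (intro arg_cong2[where f="(*)"] prod.cong) auto
    finally show ?thesis
      using insert.hyps by (simp add: \<phi>_def algebra_simps exp_add)
  qed
  ultimately show ?case by blast
qed

lemma torus_map_lift:
  assumes I: "finite I" and f: "continuous_map (Top_Tor I) (Top_Tor I) f"
  obtains A :: "nat \<Rightarrow> nat \<Rightarrow> int" and \<phi> :: "nat \<Rightarrow> (nat
      \<Rightarrow> complex) \<Rightarrow> real"
  where "\<And>i. i \<in> I \<Longrightarrow> continuous_on (Tor I) (\<phi> i)"
    "\<And>z i. \<lbrakk>z \<in> Tor I; i \<in> I\<rbrakk> \<Longrightarrow> f z i = (\<Prod>j\<in>I. z j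
        powi A i j) * exp (\<i> * of_real (\<phi> i z))"
    "homotopic_with (\<lambda>h. True) (Top_Tor I) (Top_Tor I) f (lin_Tor I A)"
proof -
  have fc: "\<And>i. continuous_on (Tor I) (\<lambda>z. f z i)" and fT: "\<And>z. z \<in> Tor I
      \<Longrightarrow> f z \<in> Tor I"
    using f unfolding continuous_map_Top_Tor by blast+
  have "\<exists>(a::nat \<Rightarrow> int) \<phi>. continuous_on (Tor I) \<phi> \<and>
    (\<forall>z\<in>Tor I. f z i = (\<Prod>j\<in>I. z j powi a j) * exp (\<i> * of_real (\<phi> z)))" for i
    using fT by (intro torus_to_circle I fc) (auto simp: Tor_def)
  then obtain A :: "nat \<Rightarrow> nat \<Rightarrow> int" and \<phi> where A: "\<And>i. continuous_on
      (Tor I) (\<phi> i)"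
    "\<And>i z. z \<in> Tor I \<Longrightarrow> f z i = (\<Prod>j\<in>I. z j powi A i j) * exp (\<i> *
        of_real (\<phi> i z))"
    by metis
  have "homotopic_with (\<lambda>h. True) (Top_Tor I) (Top_Tor I) (lin_Tor I A) f"
  proof (subst homotopic_with, simp, intro exI conjI ballI)
    \<comment> \<open>The homotopy scales all angle functions linearly from 0 to their full
      size.\<close>
    let ?h = "\<lambda>(t::real, z) i. lin_Tor I A z i * (if i \<in> I then exp (\<i> * of_real (t * \<phi>
        i z)) else 1)"
    have "continuous_on ({0..1} \<times> Tor I) ?h"
    proof (rule continuous_on_coordinatewise_then_product)
      fix i
      have "continuous_on ({0..1::real} \<times> Tor I) (\<lambda>x. lin_Tor I A (snd x) i)"
        by (rule continuous_on_compose2[OF _ continuous_on_snd[OF continuous_on_id], of "Tor I"])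
          (use continuous_map_lin_Tor_Tor[of I A, unfolded continuous_map_Top_Tor] in auto)
      moreover have "continuous_on ({0..1::real} \<times> Tor I) (\<lambda>x. \<phi> i (snd x))"
        by (rule continuous_on_compose2[OF A(1) continuous_on_snd[OF continuous_on_id]]) auto
      ultimately show "continuous_on ({0..1} \<times> Tor I) (\<lambda>x. ?h x i)"
        unfolding case_prod_unfold by (cases "i \<in> I") (auto intro!: continuous_intros)
    qed
    moreover have "?h x \<in> Tor I" if "x \<in> {0..1} \<times> Tor I" for x
    proof -
      have "lin_Tor I A (snd x) \<in> Tor I"
        using continuous_map_lin_Tor_Tor[of I A] that by (auto simp: continuous_map_subtopology_eu)
      then show ?thesis by (auto simp: Tor_def case_prod_unfold norm_mult lin_Tor_def)
    qed
    ultimately show "continuous_map (prod_topology (top_of_set {0..1}) (Top_Tor I)) (Top_Tor I) ?h"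
      by (auto simp: continuous_map_subtopology_eu)
    show "?h (0, z) = lin_Tor I A z" if "z \<in> topspace (Top_Tor I)" for z by auto
    show "?h (1, z) = f z" if "z \<in> topspace (Top_Tor I)" for z
    proof
      fix i
      show "?h (1, z) i = f z i" using that A(2) fT[of z] by (cases "i \<in> I") (auto simp: lin_Tor_def Tor_def)
    qed
  qed auto
  then show thesis using that A homotopic_with_symD by blast
qed

section \<open>Perturbed linear systems\<close>

definition Rn :: "nat \<Rightarrow> (nat \<Rightarrow> real) set"
  where "Rn n = {x. \<forall>i\<ge>n. x i = 0}"

lemma Euclidean_space_Rn: "Euclidean_space n = top_of_set (Rn n)"
  by (simp add: Euclidean_space_def Rn_def euclidean_product_topology)

abbreviation Rnorm :: "nat \<Rightarrow> (nat \<Rightarrow> real) \<Rightarrow> real"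
  where "Rnorm n x \<equiv> sqrt (\<Sum>i<n. (x i)\<^sup>2)"

lemma Rnorm_eq_0: "x \<in> Rn n \<Longrightarrow> Rnorm n x = 0 \<longleftrightarrow> x = (\<lambda>i. 0)"
  by (auto simp: Rn_def sum_nonneg_eq_0_iff fun_eq_iff) (metis lessThan_iff linorder_not_less)

definition Rsphere :: "nat \<Rightarrow> (nat \<Rightarrow> real) set"
  where "Rsphere n = {x \<in> Rn n. (\<Sum>i<n. (x i)\<^sup>2) = 1}"

lemma nsphere_Rsphere: "nsphere m = top_of_set (Rsphere (Suc m))"
  unfolding nsphere Rsphere_def Rn_def
  by (rule arg_cong2[where f=subtopology])
    (auto simp: euclidean_product_topology lessThan_Suc_atMost Suc_le_eq)

lemma homotopic_normalized:
  assumes h: "\<And>i. continuous_on ({0..1} \<times> Rsphere (Suc m)) (\<lambda>tx. h tx i)"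
    and hR: "\<And>t x. \<lbrakk>0 \<le> t; t \<le> 1; x \<in> Rsphere (Suc m)\<rbrakk> \<Longrightarrow> h
        (t, x) \<in> Rn (Suc m) \<and> h (t, x) \<noteq> (\<lambda>i. 0)"
  shows "homotopic_with (\<lambda>h. True) (nsphere m) (nsphere m)
    (\<lambda>x i. h (0::real, x) i / Rnorm (Suc m) (h (0, x))) (\<lambda>x i. h (1, x) i / Rnorm (Suc m)
        (h (1, x)))"
proof -
  let ?n = "Suc m"
  let ?g = "\<lambda>tx i. h tx i / Rnorm ?n (h tx)"
  have pos: "Rnorm ?n (h tx) \<noteq> 0" if "tx \<in> {0..1} \<times> Rsphere ?n" for tx
    using hR[of "fst tx" "snd tx"] that Rnorm_eq_0[of "h tx" ?n] by auto
  have "continuous_on ({0..1} \<times> Rsphere ?n) ?g"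
    using pos by (intro continuous_on_coordinatewise_then_product continuous_on_divide h continuous_intros) auto
  moreover have "?g tx \<in> Rsphere ?n" if tx: "tx \<in> {0..1} \<times> Rsphere ?n" for tx
  proof -
    have "(\<Sum>i<?n. (?g tx i)\<^sup>2) = (\<Sum>i<?n. (h tx i)\<^sup>2) / (Rnorm ?n (h tx))\<^sup>2"
      by (simp add: power_divide sum_divide_distrib del: sum.lessThan_Suc)
    also have "(Rnorm ?n (h tx))\<^sup>2 = (\<Sum>i<?n. (h tx i)\<^sup>2)"
      by (rule real_sqrt_pow2) (rule sum_nonneg, simp)
    also have "(\<Sum>i<?n. (h tx i)\<^sup>2) / (\<Sum>i<?n. (h tx i)\<^sup>2) = 1"
      using pos[OF tx] by (metis divide_self real_sqrt_zero)
    finally show ?thesis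
      using hR[of "fst tx" "snd tx"] tx by (auto simp: Rsphere_def Rn_def)
  qed
  ultimately have "continuous_map (prod_topology (top_of_set {0..1}) (nsphere m)) (nsphere m) ?g"
    unfolding nsphere_Rsphere prod_topology_subtopology_eu continuous_map_subtopology_eu by blast
  then show ?thesis
    unfolding homotopic_with_def by (intro exI[of _ ?g]) auto
qed

text \<open>Without a fixed point, \<open>x - F x\<close> has a direction everywhere. On a large
  sphere, shrinking \<open>F\<close> (\<open>h1\<close>) deforms this direction to the identity, and
  shrinking the radius (\<open>h2\<close>) deforms it to a constant, although spheres are not
  contractible.\<close>

lemma brouwer_Rn:
  assumes F: "\<And>i. continuous_on (Rn p) (\<lambda>x. F x i)" and FR: "\<And>x. x \<in> Rn p
      \<Longrightarrow> F x \<in> Rn p"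
    and bound: "\<And>x i. \<lbrakk>x \<in> Rn p; i < p\<rbrakk> \<Longrightarrow> \<bar>F x i\<bar> \<le> C"
  shows "\<exists>x\<in>Rn p. F x = x"
proof (cases p)
  case 0
  then have "(\<lambda>i. 0) \<in> Rn p" "F (\<lambda>i. 0) = (\<lambda>i. 0)" using FR[of "\<lambda>i. 0"]
      by (auto simp: Rn_def)
  then show ?thesis by blast
next
  case (Suc m)
  show ?thesis
  proof (rule ccontr)
    assume no: "\<not> (\<exists>x\<in>Rn p. F x = x)"
    let ?S = "Rsphere (Suc m)"
    \<comment> \<open>Any radius larger than \<open>sqrt p * \<bar>C\<bar>\<close>, the bound on the
      Euclidean norm of \<open>F\<close>, would do; this one avoids the root and is positive even
      for \<open>C = 0\<close>.\<close>
    define R where "R = real p * (\<bar>C\<bar> + 1)"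
    have sR: "(\<lambda>i. c * x i) \<in> Rn p" if "x \<in> ?S" for c x
      using that Suc by (auto simp: Rsphere_def Rn_def)
    have cx: "continuous_on ({0..1::real} \<times> ?S) (\<lambda>tx. snd tx i)" for i
      by (rule continuous_on_compose2[OF continuous_on_coord[of UNIV i] continuous_on_snd[OF
          continuous_on_id]]) auto
    have cF: "continuous_on ({0..1::real} \<times> ?S) (\<lambda>tx. F (\<lambda>j. c (fst tx) * snd tx j) i)"
      if "continuous_on {0..1} c" for c :: "real \<Rightarrow> real" and i
    proof (rule continuous_on_compose2[OF F[of i]])
      have "continuous_on ({0..1::real} \<times> ?S) (\<lambda>tx. c (fst tx))"
        by (rule continuous_on_compose2[OF that continuous_on_fst[OF continuous_on_id]]) auto
      then show "continuous_on ({0..1::real} \<times> ?S) (\<lambda>tx j. c (fst tx) * snd tx j)"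
        by (intro continuous_on_coordinatewise_then_product continuous_on_mult cx)
    qed (use sR in auto)
    define h1 where "h1 = (\<lambda>(t::real, x::nat\<Rightarrow>real) i. R * x i - t * F (\<lambda>j. R * x j) i)"
    define h2 where "h2 = (\<lambda>(t::real, x::nat\<Rightarrow>real) i. t * R * x i - F (\<lambda>j. t *
        R * x j) i)"
    have hom1: "homotopic_with (\<lambda>h. True) (nsphere m) (nsphere m)
      (\<lambda>x i. h1 (0, x) i / Rnorm (Suc m) (h1 (0, x))) (\<lambda>x i. h1 (1, x) i / Rnorm (Suc m)
          (h1 (1, x)))"
    proof (rule homotopic_normalized)
      show "continuous_on ({0..1} \<times> ?S) (\<lambda>tx. h1 tx i)" for i
        unfolding h1_def case_prod_unfold
        by (intro continuous_on_diff continuous_on_mult cx cF[of "\<lambda>t. R" i] continuous_on_fst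
            continuous_on_const continuous_on_id)
      fix t :: real and x assume t: "0 \<le> t" "t \<le> 1" and x: "x \<in> ?S"
      have "h1 (t, x) \<noteq> (\<lambda>i. 0)"
      proof
        assume 0: "h1 (t, x) = (\<lambda>i. 0)"
        have eq: "R * x i = t * F (\<lambda>j. R * x j) i" for i using fun_cong[OF 0, of i] by (simp add: h1_def)
        have "R\<^sup>2 = (\<Sum>i<p. (R * x i)\<^sup>2)"
          using x Suc by (simp add: Rsphere_def power_mult_distrib flip: sum_distrib_left)
        also have "\<dots> \<le> (\<Sum>i<p. C\<^sup>2)"
        proof (rule sum_mono)
          fix i assume "i \<in> {..<p}"
          then have "\<bar>F (\<lambda>j. R * x j) i\<bar> \<le> C" using bound[OF sR[OF x]] by simp
          then have "\<bar>t * F (\<lambda>j. R * x j) i\<bar> \<le> 1 * C"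
            unfolding abs_mult using t by (intro mult_mono) auto
          then have "(t * F (\<lambda>j. R * x j) i)\<^sup>2 \<le> C\<^sup>2" by (intro
              abs_le_square_iff[THEN iffD1]) simp
          then show "(R * x i)\<^sup>2 \<le> C\<^sup>2" by (subst eq)
        qed
        also have "\<dots> = real p * C\<^sup>2" by simp
        also have "\<dots> \<le> (real p)\<^sup>2 * C\<^sup>2" using Suc by (intro mult_right_mono) (auto
            simp: power2_eq_square)
        also have "\<dots> < (real p)\<^sup>2 * (\<bar>C\<bar> + 1)\<^sup>2"
        proof (rule mult_strict_left_mono)
          have "\<bar>C\<bar>\<^sup>2 < (\<bar>C\<bar> + 1)\<^sup>2" by (rule power_strict_mono) auto
          then show "C\<^sup>2 < (\<bar>C\<bar> + 1)\<^sup>2" by simp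
        qed (use Suc in simp)
        also have "\<dots> = R\<^sup>2" by (simp add: R_def power_mult_distrib)
        finally show False by simp
      qed
      then show "h1 (t, x) \<in> Rn (Suc m) \<and> h1 (t, x) \<noteq> (\<lambda>i. 0)"
        using sR[OF x, of R] FR[OF sR[OF x], of R] Suc by (auto simp: h1_def Rn_def)
    qed
    have hom2: "homotopic_with (\<lambda>h. True) (nsphere m) (nsphere m)
      (\<lambda>x i. h2 (0, x) i / Rnorm (Suc m) (h2 (0, x))) (\<lambda>x i. h2 (1, x) i / Rnorm (Suc m)
          (h2 (1, x)))"
    proof (rule homotopic_normalized)
      show "continuous_on ({0..1} \<times> ?S) (\<lambda>tx. h2 tx i)" for i
        unfolding h2_def case_prod_unfold
        by (intro continuous_on_diff continuous_on_mult cx cF[of "\<lambda>t. t * R" i] continuous_on_fst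
            continuous_on_const continuous_on_id)
      fix t :: real and x assume t: "0 \<le> t" "t \<le> 1" and x: "x \<in> ?S"
      let ?y = "\<lambda>i. t * R * x i"
      have y: "?y \<in> Rn p" using sR[OF x, of "t * R"] by simp
      have "h2 (t, x) \<noteq> (\<lambda>i. 0)"
      proof
        assume 0: "h2 (t, x) = (\<lambda>i. 0)"
        have "F ?y = ?y"
        proof
          show "F ?y i = ?y i" for i using fun_cong[OF 0, of i] by (simp add: h2_def)
        qed
        then show False using no y by blast
      qed
      then show "h2 (t, x) \<in> Rn (Suc m) \<and> h2 (t, x) \<noteq> (\<lambda>i. 0)"
        using y FR[OF y] Suc by (auto simp: h2_def Rn_def)
    qed
    \<comment> \<open>Both homotopies end at the direction of \<open>R x - F (R x)\<close>, so they
      can be joined.\<close>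
    have h12: "h1 (1, x) = h2 (1, x)" for x by (simp add: h1_def h2_def)
    have "homotopic_with (\<lambda>h. True) (nsphere m) (nsphere m)
      (\<lambda>x i. h1 (0, x) i / Rnorm (Suc m) (h1 (0, x))) (\<lambda>x i. h2 (0, x) i / Rnorm (Suc m)
          (h2 (0, x)))"
      by (rule homotopic_with_trans[OF hom1[unfolded h12] homotopic_with_symD[OF hom2]])
    note hom = this
    have h10: "(\<lambda>i. h1 (0, x) i / Rnorm (Suc m) (h1 (0, x))) = x" if "x \<in> topspace (nsphere m)" for x
    proof -
      have "R > 0" using Suc by (simp add: R_def add_nonneg_pos)
      have "(\<Sum>i<Suc m. (x i)\<^sup>2) = 1" using that by (simp add: nsphere_Rsphere Rsphere_def)
      then have "Rnorm (Suc m) (\<lambda>i. R * x i) = R"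
        using \<open>R > 0\<close> unfolding power_mult_distrib sum_distrib_left[symmetric] real_sqrt_mult by simp
      then show ?thesis using \<open>R > 0\<close> by (simp add: h1_def del: sum.lessThan_Suc)
    qed
    have "homotopic_with (\<lambda>h. True) (nsphere m) (nsphere m) id (\<lambda>x i. h2 (0, x) i / Rnorm
        (Suc m) (h2 (0, x)))"
      by (rule homotopic_with_eq[OF hom]) (simp_all only: h10 id_apply)
    moreover have "h2 (0, x) = h2 (0, y)" for x y by (simp add: h2_def)
    ultimately have "homotopic_with (\<lambda>h. True) (nsphere m) (nsphere m) id (\<lambda>x i. h2 (0,
        \<lambda>i. 0) i / Rnorm (Suc m) (h2 (0, \<lambda>i. 0)))"
      by (simp only: h2_def case_prod_conv mult_zero_left)
    then show False using non_contractible_space_nsphere[of m] unfolding contractible_space_def by blast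
  qed
qed

text \<open>For a diagonal matrix the system is the fixed point problem of the bounded map with
  coordinates \<open>\<psi> x i / D i i\<close>, which Brouwer's theorem solves.\<close>

lemma solve_integer_system:
  fixes \<psi> :: "(nat \<Rightarrow> real) \<Rightarrow> nat \<Rightarrow> real"
  assumes "int_det {..<p} B \<noteq> 0" and "\<And>i. continuous_on (Rn p) (\<lambda>x. \<psi> x i)"
    and "\<And>x i. \<lbrakk>x \<in> Rn p; i < p\<rbrakk> \<Longrightarrow> \<bar>\<psi> x i\<bar> \<le> C"
  shows "\<exists>x\<in>Rn p. \<forall>i<p. (\<Sum>j<p. of_int (B i j) * x j) = \<psi> x i"
proof -
  have fin: "finite {..<p}" by simp
  \<comment> \<open>The right-hand side and its bound are quantified inside the induction, since row
    additions alter \<open>\<psi>\<close> and column additions precompose it with a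
    substitution.\<close>
  have "int_det {..<p} B \<noteq> 0 \<longrightarrow> (\<forall>(\<psi> :: (nat \<Rightarrow> real)
      \<Rightarrow> nat \<Rightarrow> real) C. (\<forall>i. continuous_on (Rn p) (\<lambda>x. \<psi> x i))
      \<and> (\<forall>x\<in>Rn p. \<forall>i<p. \<bar>\<psi> x i\<bar> \<le> C) \<longrightarrow>
    (\<exists>x\<in>Rn p. \<forall>i<p. (\<Sum>j<p. of_int (B i j) * x j) = \<psi> x i))"
    using fin
  proof (induction B rule: diagonalize_induct)
    case (diag D)
    show ?case
    proof (intro impI allI, elim conjE)
      fix \<psi> :: "(nat \<Rightarrow> real) \<Rightarrow> nat \<Rightarrow> real" and C assume nz:
          "int_det {..<p} D \<noteq> 0" and c: "\<forall>i. continuous_on (Rn p) (\<lambda>x. \<psi> x i)"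
          and b: "\<forall>x\<in>Rn p. \<forall>i<p. \<bar>\<psi> x i\<bar> \<le> C"
      have Dnz: "D i i \<noteq> 0" if "i < p" for i
        using nz that int_det_diag[OF fin, of D] diag by auto
      define F where "F x = (\<lambda>i. if i < p then \<psi> x i / of_int (D i i) else 0)" for x
      have "\<exists>x\<in>Rn p. F x = x"
      proof (rule brouwer_Rn)
        show "continuous_on (Rn p) (\<lambda>x. F x i)" for i
          using c Dnz by (cases "i < p") (auto simp: F_def intro!: continuous_intros)
        show "\<bar>F x i\<bar> \<le> C" if x: "x \<in> Rn p" "i < p" for x i
        proof -
          \<comment> \<open>A nonzero integer has absolute value at least 1, so dividing by it keeps
            the bound \<open>C\<close>.\<close>
          have "\<bar>D i i\<bar> \<ge> 1" using Dnz[OF x(2)] by linarith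
          then have D1: "\<bar>real_of_int (D i i)\<bar> \<ge> 1" by linarith
          have "\<bar>F x i\<bar> = \<bar>\<psi> x i\<bar> / \<bar>real_of_int (D i i)\<bar>" using x by
              (simp add: F_def)
          also have "\<dots> \<le> \<bar>\<psi> x i\<bar> / 1" using D1 by (intro divide_left_mono) auto
          finally show ?thesis using b x by fastforce
        qed
      qed (auto simp: F_def Rn_def)
      then obtain x where x: "x \<in> Rn p" "F x = x" by blast
      have "(\<Sum>j<p. of_int (D i j) * x j) = \<psi> x i" if i: "i < p" for i
      proof -
        have "(\<Sum>j<p. of_int (D i j) * x j) = (\<Sum>j\<in>{i}. of_int (D i j) * x j)"
          using i diag by (intro sum.mono_neutral_right) auto
        also have "\<dots> = of_int (D i i) * F x i" using x by simp
        also have "\<dots> = \<psi> x i" using i Dnz[OF i] by (simp add: F_def)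
        finally show ?thesis .
      qed
      then show "\<exists>x\<in>Rn p. \<forall>i<p. (\<Sum>j<p. of_int (D i j) * x j) = \<psi> x i" using x
          by blast
    qed
  next
    case (row a b c N)
    show ?case
    proof (intro impI allI, elim conjE)
      fix \<psi> :: "(nat \<Rightarrow> real) \<Rightarrow> nat \<Rightarrow> real" and C assume nz:
          "int_det {..<p} (rowop a b c N) \<noteq> 0" and c: "\<forall>i. continuous_on (Rn p) (\<lambda>x.
          \<psi> x i)" and b: "\<forall>x\<in>Rn p. \<forall>i<p. \<bar>\<psi> x i\<bar> \<le> C"
      \<comment> \<open>Row \<open>b\<close> of the new matrix contains \<open>c\<close> times row
        \<open>a\<close>; this multiple is moved to the right-hand side, which enlarges the
        bound.\<close>
      define \<psi>' where "\<psi>' x = (\<psi> x)(b := \<psi> x b - of_int c * \<psi> x a)" for x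
      have "int_det {..<p} N \<noteq> 0" using nz int_det_rowop[OF fin row(2-4)] by simp
      moreover have "\<forall>i. continuous_on (Rn p) (\<lambda>x. \<psi>' x i)"
      proof
        show "continuous_on (Rn p) (\<lambda>x. \<psi>' x i)" for i
          using c by (cases "i = b") (auto simp: \<psi>'_def intro!: continuous_intros)
      qed
      moreover have "\<forall>x\<in>Rn p. \<forall>i<p. \<bar>\<psi>' x i\<bar> \<le> C + \<bar>of_int c\<bar> * C"
      proof (intro ballI allI impI)
        fix x i assume x: "x \<in> Rn p" and i: "i < p"
        have ab: "\<bar>\<psi> x i\<bar> \<le> C" "\<bar>\<psi> x b\<bar> \<le> C" "\<bar>\<psi> x a\<bar>
            \<le> C" using b x i row by auto
        then have "\<bar>of_int c * \<psi> x a\<bar> \<le> \<bar>of_int c\<bar> * C" unfolding abs_mult by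
            (intro mult_left_mono) auto
        then show "\<bar>\<psi>' x i\<bar> \<le> C + \<bar>of_int c\<bar> * C" using ab by (auto simp: \<psi>'_def)
      qed
      ultimately obtain x where x: "x \<in> Rn p" "\<And>i. i < p \<Longrightarrow> (\<Sum>j<p. of_int (N i
          j) * x j) = \<psi>' x i"
        using row(1) by blast
      have "(\<Sum>j<p. of_int (rowop a b c N i j) * x j) = \<psi> x i" if i: "i < p" for i
      proof (cases "i = b")
        case True
        then have "(\<Sum>j<p. of_int (rowop a b c N i j) * x j) = (\<Sum>j<p. of_int (N b j) * x j) +
            of_int c * (\<Sum>j<p. of_int (N a j) * x j)"
          by (simp add: rowop_def algebra_simps sum.distrib sum_distrib_left)
        then show ?thesis using x(2)[of a] x(2)[of b] row True by (simp add: \<psi>'_def)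
      next
        case False
        then show ?thesis using x(2)[OF i] by (simp add: rowop_def \<psi>'_def)
      qed
      then show "\<exists>x\<in>Rn p. \<forall>i<p. (\<Sum>j<p. of_int (rowop a b c N i j) * x j) = \<psi>
          x i" using x by blast
    qed
  next
    case (col a b c N)
    show ?case
    proof (intro impI allI, elim conjE)
      fix \<psi> :: "(nat \<Rightarrow> real) \<Rightarrow> nat \<Rightarrow> real" and C assume nz:
          "int_det {..<p} (colop a b c N) \<noteq> 0" and c: "\<forall>i. continuous_on (Rn p) (\<lambda>x.
          \<psi> x i)" and b: "\<forall>x\<in>Rn p. \<forall>i<p. \<bar>\<psi> x i\<bar> \<le> C"
      \<comment> \<open>The substitution \<open>x = e y\<close> undoes the column addition. It maps
        \<open>Rn p\<close> into itself, so the bound on \<open>\<psi>\<close> carries over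
        unchanged.\<close>
      define e where "e y = y(a := y a - of_int c * y b)" for y :: "nat \<Rightarrow> real"
      have eR: "e y \<in> Rn p" if "y \<in> Rn p" for y using that col by (auto simp: e_def Rn_def)
      have ec: "continuous_on (Rn p) e"
      proof (rule continuous_on_coordinatewise_then_product)
        show "continuous_on (Rn p) (\<lambda>y. e y i)" for i
          by (cases "i = a") (auto simp: e_def intro!: continuous_intros)
      qed
      have "int_det {..<p} N \<noteq> 0" using nz int_det_colop[OF fin col(2-4)] by simp
      moreover have "\<forall>i. continuous_on (Rn p) (\<lambda>y. \<psi> (e y) i)"
        using c eR by (auto intro!: continuous_on_compose2[OF _ ec, of "Rn p"])
      moreover have "\<forall>y\<in>Rn p. \<forall>i<p. \<bar>\<psi> (e y) i\<bar> \<le> C" using b eR by blast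
      ultimately obtain y where y: "y \<in> Rn p" "\<And>i. i < p \<Longrightarrow> (\<Sum>j<p. of_int (N i
          j) * y j) = \<psi> (e y) i"
        using col(1)[rule_format, of "\<lambda>y. \<psi> (e y)" C] by blast
      have "(\<Sum>j<p. of_int (colop a b c N i j) * e y j) = \<psi> (e y) i" if i: "i < p" for i
      proof -
        have "(\<Sum>j<p. of_int (colop a b c N i j) * e y j) = 
          (\<Sum>j<p. of_int (N i j) * y j + (if j = b then of_int c * of_int (N i a) * y b else 0) + (if j
              = a then - (of_int c * of_int (N i a) * y b) else 0))"
          using col(4) by (intro sum.cong) (auto simp: colop_def e_def algebra_simps)
        also have "\<dots> = (\<Sum>j<p. of_int (N i j) * y j)"
          using col(2,3) by (simp add: sum.distrib)
        finally show ?thesis using y(2)[OF i] by simp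
      qed
      then show "\<exists>x\<in>Rn p. \<forall>i<p. (\<Sum>j<p. of_int (colop a b c N i j) * x j) = \<psi>
          x i" using eR[OF y(1)] by blast
    qed
  qed
  then show ?thesis using assms by blast
qed

section \<open>Fixed points of torus maps\<close>

definition torus_cover :: "nat \<Rightarrow> (nat \<Rightarrow> real) \<Rightarrow> nat \<Rightarrow> complex"
  where "torus_cover p x = (\<lambda>i. if i < p then exp (2 * pi * \<i> * of_real (x i)) else 1)"

lemma torus_cover_Tor: "torus_cover p x \<in> Tor {..<p}"
  by (auto simp: torus_cover_def Tor_def norm_exp_eq_Re)

lemma continuous_on_torus_cover: "continuous_on S (torus_cover p)"
proof (rule continuous_on_coordinatewise_then_product)
  show "continuous_on S (\<lambda>x. torus_cover p x i)" for i
    by (cases "i < p") (auto simp: torus_cover_def intro!: continuous_intros)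
qed

lemma torus_cover_eqD:
  assumes "torus_cover p x = torus_cover p y"
  obtains m :: "nat \<Rightarrow> int" where "\<And>i. i < p \<Longrightarrow> x i - y i = of_int (m i)"
proof -
  have "\<exists>m::int. x i - y i = of_int m" if "i < p" for i
  proof -
    have "exp (2 * pi * \<i> * of_real (x i)) = exp (2 * pi * \<i> * of_real (y i))"
      using fun_cong[OF assms, of i] that by (simp add: torus_cover_def)
    then obtain n :: int where "2 * pi * \<i> * of_real (x i) = 2 * pi * \<i> * of_real (y i) + of_int (2 *
        n) * pi * \<i>"
      unfolding exp_eq by auto
    then have "2 * pi * \<i> * (of_real (x i) - of_real (y i) - of_int n) = 0" by (simp add: algebra_simps)
    then have "complex_of_real (x i - y i - of_int n) = 0" by simp
    then have "x i - y i - of_int n = 0" by (simp only: of_real_eq_0_iff)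
    then show ?thesis by auto
  qed
  then show thesis using that by metis
qed

text \<open>A vector \<open>x\<close> lies over a fixed point if
  \<open>B x - \<phi> / (2 * pi)\<close> is an integer vector \<open>k\<close>, and this is solved
  for every \<open>k\<close>. Two solutions over the same point differ by an integer vector
  \<open>m\<close>; as \<open>\<phi>\<close> depends on the point alone, their vectors
  \<open>k\<close> differ by \<open>B m\<close>, so incongruent ones give distinct points.\<close>

lemma torus_fixed_points_ge:
  assumes f: "continuous_map (Top_Tor {..<p}) (Top_Tor {..<p}) f" and fin: "finite {z \<in> Tor {..<p}. f z = z}"
    and \<phi>: "\<And>i. i < p \<Longrightarrow> continuous_on (Tor {..<p}) (\<phi> i)"
    and lift: "\<And>z i. \<lbrakk>z \<in> Tor {..<p}; i < p\<rbrakk> \<Longrightarrow> f z i =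
        (\<Prod>j<p. z j powi A i j) * exp (\<i> * of_real (\<phi> i z))"
  shows "\<bar>int_det {..<p} (\<lambda>i j. (if i = j then 1 else 0) - A i j)\<bar> \<le> int (card {z
      \<in> Tor {..<p}. f z = z})"
proof (cases "int_det {..<p} (\<lambda>i j. (if i = j then 1 else 0) - A i j) = 0")
  case False
  let ?T = "Tor {..<p}"
  define B where "B = (\<lambda>i j. (if i = j then 1 else 0) - A i j)"
  have det: "int_det {..<p} B \<noteq> 0" using False by (simp add: B_def)
  obtain K where K: "finite K" "int (card K) = \<bar>int_det {..<p} B\<bar>"
    "\<forall>k\<in>K. \<forall>k'\<in>K. \<forall>m. (\<forall>i\<in>{..<p}. k i - k' i = (\<Sum>j<p. B i
        j * m j)) \<longrightarrow> k = k'"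
    using incongruent_set[OF finite_lessThan, of p B] by (elim exE conjE) (rule that)
  have "\<exists>C. \<forall>z\<in>?T. \<bar>\<phi> i z\<bar> \<le> C" if "i < p" for i
  proof -
    have "bounded (\<phi> i ` ?T)" by (intro compact_imp_bounded compact_continuous_image \<phi> that compact_Tor)
    then show ?thesis by (auto simp: bounded_real)
  qed
  then obtain C where C: "\<And>i z. \<lbrakk>i < p; z \<in> ?T\<rbrakk> \<Longrightarrow> \<bar>\<phi> i
      z\<bar> \<le> C i" by metis
  have "\<exists>x\<in>Rn p. \<forall>i<p. (\<Sum>j<p. of_int (B i j) * x j) = \<phi> i (torus_cover p x) /
      (2 * pi) + of_int (k i)" for k :: "nat \<Rightarrow> int"
  proof -
    define \<psi> where "\<psi> x i = (if i < p then \<phi> i (torus_cover p x) / (2 * pi) + of_int (k i)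
        else 0)" for x i
    define M where "M = (\<Sum>i<p. \<bar>C i\<bar> + \<bar>of_int (k i)\<bar>)"
    have "\<exists>x\<in>Rn p. \<forall>i<p. (\<Sum>j<p. of_int (B i j) * x j) = \<psi> x i"
    proof (rule solve_integer_system[OF det])
      show "continuous_on (Rn p) (\<lambda>x. \<psi> x i)" for i
      proof (cases "i < p")
        case True
        have "continuous_on (Rn p) (\<lambda>x. \<phi> i (torus_cover p x))"
          by (rule continuous_on_compose2[OF \<phi>[OF True] continuous_on_torus_cover]) (auto simp:
              torus_cover_Tor)
        then show ?thesis using True by (auto simp: \<psi>_def intro!: continuous_intros)
      qed (simp add: \<psi>_def)
      fix x i assume i: "i < p"
      let ?a = "\<phi> i (torus_cover p x)"
      have "1 \<le> 2 * pi" using pi_ge_two by simp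
      then have "\<bar>?a / (2 * pi)\<bar> \<le> \<bar>?a\<bar> / 1" unfolding abs_divide by (intro
          divide_left_mono) auto
      moreover have "\<bar>\<psi> x i\<bar> \<le> \<bar>?a / (2 * pi)\<bar> + \<bar>of_int (k i)\<bar>"
      proof -
        have "\<psi> x i = ?a / (2 * pi) + of_int (k i)" using i by (simp add: \<psi>_def)
        then show ?thesis by (simp only: abs_triangle_ineq)
      qed
      ultimately have "\<bar>\<psi> x i\<bar> \<le> \<bar>C i\<bar> + \<bar>of_int (k i)\<bar>"
        using C[OF i torus_cover_Tor[of p x]] by linarith
      also have "\<dots> \<le> M" unfolding M_def using i by (intro member_le_sum) auto
      finally show "\<bar>\<psi> x i\<bar> \<le> M" .
    qed
    then show ?thesis by (simp add: \<psi>_def)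
  qed
  then obtain x where x: "\<And>k. x k \<in> Rn p"
    "\<And>k i. i < p \<Longrightarrow> (\<Sum>j<p. of_int (B i j) * x k j) = \<phi> i (torus_cover p (x
        k)) / (2 * pi) + of_int (k i)"
    by metis
  define e where "e k = torus_cover p (x k)" for k
  have "inj_on e K"
  proof (rule inj_onI)
    fix k k' assume k: "k \<in> K" "k' \<in> K" and eq: "e k = e k'"
    obtain m where m: "\<And>i. i < p \<Longrightarrow> x k i - x k' i = of_int (m i)"
      using torus_cover_eqD eq unfolding e_def by metis
    have "k i - k' i = (\<Sum>j<p. B i j * m j)" if i: "i < p" for i
    proof -
      have "real_of_int (k i - k' i) = (\<Sum>j<p. of_int (B i j) * x k j) - (\<Sum>j<p. of_int (B i j) * x k' j)"
        using x(2)[OF i, of k] x(2)[OF i, of k'] eq by (simp add: e_def)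
      also have "\<dots> = (\<Sum>j<p. of_int (B i j) * (x k j - x k' j))"
        by (simp add: right_diff_distrib sum_subtractf)
      also have "\<dots> = real_of_int (\<Sum>j<p. B i j * m j)" using m by simp
      finally show ?thesis by (simp only: of_int_eq_iff)
    qed
    then show "k = k'" using K(3) k by blast
  qed
  moreover have "e k \<in> {z \<in> ?T. f z = z}" for k
  proof -
    have "f (e k) i = e k i" for i
    proof (cases "i < p")
      case False
      have "f (e k) \<in> ?T" using f torus_cover_Tor[of p "x k"] by (auto simp:
          continuous_map_subtopology_eu e_def)
      then show ?thesis using False torus_cover_Tor[of p "x k"] by (simp add: Tor_def e_def)
    next
      case i: True
      have "(\<Sum>j<p. of_int (B i j) * x k j) = (\<Sum>j<p. (if i = j then x k j else 0)) - (\<Sum>j<p.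
          of_int (A i j) * x k j)"
        unfolding sum_subtractf[symmetric] by (intro sum.cong) (auto simp: B_def algebra_simps)
      also have "(\<Sum>j<p. (if i = j then x k j else 0)) = x k i" using i by simp
      finally have "(\<Sum>j<p. of_int (A i j) * x k j) = x k i - \<phi> i (e k) / (2 * pi) - of_int (k i)"
        using x(2)[OF i, of k] by (simp add: e_def)
      then have s: "2 * pi * (\<Sum>j<p. of_int (A i j) * x k j) + \<phi> i (e k) = 2 * pi * x k i - 2 * pi
          * of_int (k i)"
        by (simp add: field_simps)
      have "f (e k) i = (\<Prod>j<p. e k j powi A i j) * exp (\<i> * of_real (\<phi> i (e k)))"
        unfolding e_def by (rule lift[OF torus_cover_Tor i])
      also have "(\<Prod>j<p. e k j powi A i j) = (\<Prod>j<p. exp (of_int (A i j) * (2 * pi * \<i> *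
          of_real (x k j))))"
      proof (rule prod.cong[OF refl])
        fix j assume "j \<in> {..<p}"
        then have "e k j = exp (2 * pi * \<i> * of_real (x k j))" by (simp add: e_def torus_cover_def)
        then show "e k j powi A i j = exp (of_int (A i j) * (2 * pi * \<i> * of_real (x k j)))"
          by (simp only: exp_power_int)
      qed
      also have "\<dots> = exp (\<i> * of_real (2 * pi * (\<Sum>j<p. of_int (A i j) * x k j)))"
        by (simp add: exp_sum[symmetric] sum_distrib_left mult_ac)
      also have "\<dots> * exp (\<i> * of_real (\<phi> i (e k))) = exp (\<i> * of_real (2 * pi *
          (\<Sum>j<p. of_int (A i j) * x k j) + \<phi> i (e k)))"
        by (simp add: exp_add[symmetric] distrib_left)
      also have "\<dots> = exp (\<i> * of_real (2 * pi * x k i)) / exp (of_int (k i) * (2 * pi * \<i>))"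
        unfolding s by (simp add: exp_diff[symmetric] algebra_simps)
      also have "exp (of_int (k i) * (2 * pi * \<i>)) = 1" by (simp add: exp_eq_1)
      finally show ?thesis using i by (simp add: e_def torus_cover_def mult_ac)
    qed
    then show ?thesis using torus_cover_Tor[of p "x k"] by (auto simp: e_def)
  qed
  ultimately have "card K \<le> card {z \<in> ?T. f z = z}" using fin by (intro card_inj_on_le[of e]) auto
  then show ?thesis using K(2) by (simp add: B_def)
qed simp

theorem abs_lefschetz_number_le_fixed_points:
  assumes \<theta>: "homeomorphic_maps X (Top_Tor {..<p}) \<theta> \<theta>'" and f: "continuous_map X X f"
    and fin: "finite (fixed_points X f)"
  shows "\<bar>lefschetz_number X f\<bar> \<le> int (card (fixed_points X f))"
proof -
  let ?T = "Tor {..<p}"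
  have c\<theta>: "continuous_map X (Top_Tor {..<p}) \<theta>" "continuous_map (Top_Tor {..<p}) X \<theta>'"
    and inv: "\<And>x. x \<in> topspace X \<Longrightarrow> \<theta>' (\<theta> x) = x" "\<And>z. z \<in>
        ?T \<Longrightarrow> \<theta> (\<theta>' z) = z"
    using \<theta> by (auto simp: homeomorphic_maps_def)
  have im: "\<theta> x \<in> ?T" if "x \<in> topspace X" for x using c\<theta>(1) that by (auto simp:
      continuous_map_def)
  have im': "\<theta>' z \<in> topspace X" if "z \<in> ?T" for z using c\<theta>(2) that by (auto simp:
      continuous_map_def)
  have fim: "f x \<in> topspace X" if "x \<in> topspace X" for x using f that by (auto simp: continuous_map_def)
  let ?F = "\<theta> \<circ> f \<circ> \<theta>'"
  have F: "continuous_map (Top_Tor {..<p}) (Top_Tor {..<p}) ?F"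
    by (rule continuous_map_compose[OF c\<theta>(2) continuous_map_compose[OF f c\<theta>(1)]])
  have fix_eq: "{z \<in> ?T. ?F z = z} = \<theta> ` fixed_points X f"
  proof
    show "{z \<in> ?T. ?F z = z} \<subseteq> \<theta> ` fixed_points X f"
    proof
      fix z assume z: "z \<in> {z \<in> ?T. ?F z = z}"
      then have "\<theta>' (\<theta> (f (\<theta>' z))) = \<theta>' z" by simp
      then have "f (\<theta>' z) = \<theta>' z" using inv(1)[OF fim[OF im'[of z]]] z by auto
      then show "z \<in> \<theta> ` fixed_points X f"
        using z im' inv(2) by (intro image_eqI[of _ _ "\<theta>' z"]) (auto simp: fixed_points_def)
    qed
  qed (auto simp: fixed_points_def inv im)
  have "inj_on \<theta> (fixed_points X f)" by (intro inj_on_inverseI[of _ \<theta>']) (auto simp: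
      fixed_points_def inv)
  then have card: "card {z \<in> ?T. ?F z = z} = card (fixed_points X f)" unfolding fix_eq by (rule card_image)
  obtain A \<phi> where A: "\<And>i. i \<in> {..<p} \<Longrightarrow> continuous_on ?T (\<phi> i)"
    "\<And>z i. \<lbrakk>z \<in> ?T; i \<in> {..<p}\<rbrakk> \<Longrightarrow> ?F z i = (\<Prod>j<p. z j
        powi A i j) * exp (\<i> * of_real (\<phi> i z))"
    "homotopic_with (\<lambda>h. True) (Top_Tor {..<p}) (Top_Tor {..<p}) ?F (lin_Tor {..<p} A)"
    by (rule torus_map_lift[OF finite_lessThan F]) (rule that)
  have "lefschetz_number X f = int_det {..<p} (\<lambda>i j. (if i = j then 1 else 0) - A i j)"
    using lefschetz_number_lin_Tor_Tor[OF _ \<theta> f A(3)] by simp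
  moreover have "\<bar>int_det {..<p} (\<lambda>i j. (if i = j then 1 else 0) - A i j)\<bar> \<le> int
      (card {z \<in> ?T. ?F z = z})"
  proof (rule torus_fixed_points_ge[OF F])
    show "finite {z \<in> ?T. ?F z = z}" unfolding fix_eq using fin by (rule finite_imageI)
    show "continuous_on ?T (\<phi> i)" if "i < p" for i using A(1) that by simp
    show "?F z i = (\<Prod>j<p. z j powi A i j) * exp (\<i> * of_real (\<phi> i z))" if "z \<in> ?T" "i <
        p" for z i
      using A(2)[of z i] that by simp
  qed
  ultimately show ?thesis using card by simp
qed

theorem lefschetz_number_homotopic:
  assumes "homotopic_with (\<lambda>h. True) X X f g"
  shows "lefschetz_number X f = lefschetz_number X g"
  unfolding lefschetz_number_def using homology_homotopy_empty[OF assms] by simp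

section \<open>Collapsing a disk in a torus\<close>

lemma Rnorm_scale: "Rnorm p (\<lambda>i. c * x i) = \<bar>c\<bar> * Rnorm p x"
  by (simp add: power_mult_distrib real_sqrt_mult flip: sum_distrib_left)

lemma Rnorm_nonneg: "0 \<le> Rnorm p x"
  by (simp add: sum_nonneg)

lemma abs_le_Rnorm: "i < p \<Longrightarrow> \<bar>x i\<bar> \<le> Rnorm p x"
  using real_sqrt_le_mono[OF member_le_sum[of i "{..<p}" "\<lambda>i. (x i)\<^sup>2"]] by simp

definition Rball :: "nat \<Rightarrow> real \<Rightarrow> (nat \<Rightarrow> real) set"
  where "Rball p r = {x \<in> Rn p. Rnorm p x \<le> r}"

lemma compact_Rball: "compact (Rball p r)"
proof -
  have "compactin (product_topology (\<lambda>i. euclidean) UNIV) (PiE UNIV (\<lambda>i. if i < p then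
      {-r..r} else {0::real}))"
    unfolding compactin_PiE by auto
  then have "compact (PiE UNIV (\<lambda>i. if i < p then {-r..r} else {0::real}))"
    by (simp add: euclidean_product_topology)
  then have "compact (PiE UNIV (\<lambda>i. if i < p then {-r..r} else {0::real}) \<inter> {x. Rnorm p x \<le> r})"
    by (intro compact_Int_closed closed_Collect_le continuous_intros)
  also have "PiE UNIV (\<lambda>i. if i < p then {-r..r} else {0::real}) \<inter> {x. Rnorm p x \<le> r} =
      Rball p r"
  proof (intro equalityI subsetI)
    fix x assume "x \<in> Rball p r"
    moreover have "- r \<le> x i \<and> x i \<le> r" if "i < p" for i
      using abs_le_Rnorm[OF that, of x] \<open>x \<in> Rball p r\<close> by (auto simp: Rball_def)
    ultimately show "x \<in> PiE UNIV (\<lambda>i. if i < p then {-r..r} else {0::real}) \<inter> {x. Rnorm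
        p x \<le> r}"
      by (auto simp: Rball_def Rn_def)
  next
    fix x assume "x \<in> PiE UNIV (\<lambda>i. if i < p then {-r..r} else {0::real}) \<inter> {x. Rnorm p
        x \<le> r}"
    then have x: "x i \<in> (if i < p then {-r..r} else {0})" "Rnorm p x \<le> r" for i
      using PiE_mem[of x UNIV _ i] by blast+
    have "x i = 0" if "i \<ge> p" for i using x(1)[of i] that by simp
    then show "x \<in> Rball p r" using x(2) by (simp add: Rball_def Rn_def)
  qed
  finally show ?thesis .
qed

text \<open>Logarithms relative to a point \<open>y\<close> form a chart \<open>L\<close> of the
  torus near \<open>y\<close>, in which the Euclidean theorem applies; openness is then checked
  point by point.\<close>

lemma invariance_of_domain_torus:
  assumes e: "continuous_on (Rn p) e" "e \<in> Rn p \<rightarrow> Tor {..<p}" "inj_on e (Rn p)"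
    and U: "openin (top_of_set (Rn p)) U"
  shows "openin (Top_Tor {..<p}) (e ` U)"
proof (subst openin_subopen, rule ballI)
  have UR: "U \<subseteq> Rn p" using U openin_imp_subset by blast
  fix y assume "y \<in> e ` U"
  then obtain x where x: "x \<in> U" "y = e x" by auto
  have yT: "y \<in> Tor {..<p}" using x e(2) UR by auto
  have ynz: "y i \<noteq> 0" for i using Tor_nonzero[OF yT] .
  \<comment> \<open>All coordinates are within a quarter turn of those of \<open>y\<close>, so the
    principal logarithm of the ratio is continuous and determines the point.\<close>
  define W where "W = Tor {..<p} \<inter> (\<Inter>i<p. {z. Re (z i / y i) > 0})"
  have openW: "openin (Top_Tor {..<p}) W"
    unfolding W_def
    by (intro openin_open_Int open_INT ballI open_Collect_less continuous_intros) (auto simp: ynz)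
  define L where "L z = (\<lambda>i. if i < p then Im (Ln (z i / y i)) else 0)" for z :: "nat \<Rightarrow>
      complex"
  have contL: "continuous_on W L"
  proof (rule continuous_on_coordinatewise_then_product)
    fix i
    show "continuous_on W (\<lambda>z. L z i)"
    proof (cases "i < p")
      case True
      have "z i / y i \<notin> \<real>\<^sub>\<le>\<^sub>0" if "z \<in> W" for z
      proof -
        have "Re (z i / y i) > 0" using that True by (simp add: W_def)
        then show ?thesis unfolding complex_nonpos_Reals_iff by linarith
      qed
      then have "continuous_on W (\<lambda>z. Im (Ln (z i / y i)))"
        using ynz by (intro continuous_on_Im continuous_on_Ln' continuous_on_divide continuous_on_coord
            continuous_on_const) auto
      then show ?thesis using True by (simp add: L_def)
    qed (simp add: L_def)
  qed
  have LR: "L z \<in> Rn p" for z by (simp add: L_def Rn_def)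
  have Lexp: "z i = y i * exp (\<i> * of_real (L z i))" if "z \<in> W" "i < p" for z i
  proof -
    have n: "norm (z i / y i) = 1" using that yT by (simp add: W_def Tor_def norm_divide)
    then have nz: "z i / y i \<noteq> 0" by auto
    then have "Ln (z i / y i) = \<i> * of_real (L z i)"
      using n that by (simp add: complex_eq_iff L_def)
    then have "z i / y i = exp (\<i> * of_real (L z i))" using exp_Ln[OF nz] by metis
    then show ?thesis using ynz[of i] by (simp add: field_simps)
  qed
  have injL: "inj_on L W"
  proof (rule inj_onI)
    fix z z' assume z: "z \<in> W" "z' \<in> W" "L z = L z'"
    have "z i = z' i" for i
    proof (cases "i < p")
      case True
      then show ?thesis using Lexp[OF z(1) True] Lexp[OF z(2) True] z(3) by simp
    next
      case False
      then show ?thesis using z by (simp add: W_def Tor_def)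
    qed
    then show "z = z'" by auto
  qed
  define U' where "U' = U \<inter> (Rn p \<inter> e -` W)"
  have openU': "openin (top_of_set (Rn p)) U'"
    unfolding U'_def by (intro openin_Int U continuous_openin_preimage[OF e(1,2) openW])
  have "openin (Euclidean_space p) ((L \<circ> e) ` U')"
  proof (rule invariance_of_domain_Euclidean_space)
    show "openin (Euclidean_space p) U'" using openU' by (simp add: Euclidean_space_Rn)
    have "continuous_on U' (L \<circ> e)"
    proof (rule continuous_on_compose)
      show "continuous_on U' e" using e(1) by (rule continuous_on_subset) (auto simp: U'_def)
      show "continuous_on (e ` U') L" using contL by (rule continuous_on_subset) (auto simp: U'_def)
    qed
    moreover have "subtopology (Euclidean_space p) U' = top_of_set U'"
      unfolding Euclidean_space_Rn subtopology_subtopology by (rule arg_cong[where f=top_of_set]) (auto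
          simp: U'_def)
    ultimately show "continuous_map (subtopology (Euclidean_space p) U') (Euclidean_space p) (L \<circ> e)"
      using LR by (simp add: Euclidean_space_Rn continuous_map_subtopology_eu Pi_iff)
    show "inj_on (L \<circ> e) U'"
    proof (rule comp_inj_on)
      show "inj_on e U'" using e(3) by (rule inj_on_subset) (auto simp: U'_def)
      show "inj_on L (e ` U')" using injL by (rule inj_on_subset) (auto simp: U'_def)
    qed
  qed
  then have "openin (top_of_set W) (W \<inter> L -` ((L \<circ> e) ` U'))"
    using LR by (intro continuous_openin_preimage[OF contL, of "Rn p"]) (auto simp: Euclidean_space_Rn)
  then have "openin (Top_Tor {..<p}) (W \<inter> L -` ((L \<circ> e) ` U'))"
    using openW openin_trans by blast
  moreover have "y \<in> W" using yT ynz by (auto simp: W_def)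
  then have "y \<in> W \<inter> L -` ((L \<circ> e) ` U')" using x UR by (auto simp: U'_def)
  moreover have "W \<inter> L -` ((L \<circ> e) ` U') \<subseteq> e ` U"
  proof
    fix z assume "z \<in> W \<inter> L -` ((L \<circ> e) ` U')"
    then obtain u where u: "u \<in> U'" "z \<in> W" "L z = L (e u)" by auto
    then have "z = e u" using injL by (auto simp: U'_def dest: inj_onD)
    then show "z \<in> e ` U" using u by (auto simp: U'_def)
  qed
  ultimately show "\<exists>V. openin (Top_Tor {..<p}) V \<and> y \<in> V \<and> V \<subseteq> e ` U" by blast
qed

text \<open>Inside the image of \<open>e\<close> the map is radial: radii up to 1 go to 0, the shell
  from 1 to 2 is stretched over the radii from 0 to 2, and beyond 2 nothing moves, so the identity
  extends it to the rest of the torus.\<close>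

lemma torus_collapse:
  assumes e: "continuous_on (Rn p) e" "e \<in> Rn p \<rightarrow> Tor {..<p}" "inj_on e (Rn p)"
  obtains \<kappa> where "continuous_on (Tor {..<p}) \<kappa>" "\<kappa> ` Tor {..<p} = Tor {..<p}"
    "\<And>y. y \<in> e ` Rball p 1 \<Longrightarrow> \<kappa> y = e (\<lambda>i. 0)"
    "\<And>y. y \<in> Tor {..<p} - e ` Rball p 1 \<Longrightarrow> \<kappa> y \<noteq> e (\<lambda>i. 0)"
    "inj_on \<kappa> (Tor {..<p} - e ` Rball p 1)"
proof -
  let ?T = "Tor {..<p}"
  \<comment> \<open>For \<open>s\<close> between 1 and 2 the factor is \<open>2 - 2 / s\<close>,
    which turns radius \<open>s\<close> into \<open>2 * s - 2\<close>; \<open>max\<close> and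
    \<open>min\<close> join this continuously to 0 below and 1 above.\<close>
  define fac where "fac s = min 1 (2 - 2 / max 1 s)" for s :: real
  have fac_nonneg: "0 \<le> fac s" for s by (auto simp: fac_def min_def max_def divide_simps)
  have fac1: "fac s = 0" if "s \<le> 1" for s using that by (simp add: fac_def)
  have fac2: "fac s = 1" if "s \<ge> 2" for s using that by (simp add: fac_def max_def min_def divide_simps)
  have facm: "fac s * s = min s (2 * s - 2)" if "s > 1" for s
    using that by (auto simp: fac_def max_def min_def field_simps)
  define c where "c x = (\<lambda>i. fac (Rnorm p x) * x i)" for x
  have left_arc: "c x \<in> Rn p" if "x \<in> Rn p" for x using that by (simp add: c_def Rn_def)
  have zR: "(\<lambda>i. 0) \<in> Rn p" by (simp add: Rn_def)
  have cnorm: "Rnorm p (c x) = fac (Rnorm p x) * Rnorm p x" for x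
    unfolding c_def Rnorm_scale using fac_nonneg by simp
  have contc: "continuous_on S c" for S
    unfolding c_def fac_def by (intro continuous_on_coordinatewise_then_product continuous_intros) auto
  have bR: "Rball p r \<subseteq> Rn p" for r by (auto simp: Rball_def)
  define \<kappa> where "\<kappa> y = (if y \<in> e ` Rball p 2 then e (c (inv_into (Rn p) e y)) else y)" for y
  have \<kappa>e: "\<kappa> (e x) = e (c x)" if x: "x \<in> Rn p" for x
  proof (cases "x \<in> Rball p 2")
    case True
    then show ?thesis using x e(3) by (simp add: \<kappa>_def)
  next
    case False
    then have "e x \<notin> e ` Rball p 2" using x e(3) bR[of 2] by (auto dest: inj_onD)
    moreover have "c x = x" using False x fac2[of "Rnorm p x"] by (auto simp: Rball_def c_def)
    ultimately show ?thesis by (simp add: \<kappa>_def)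
  qed
  have \<kappa>out: "\<kappa> y = y" if "y \<notin> e ` Rn p" for y
    using that bR[of 2] by (auto simp: \<kappa>_def)
  \<comment> \<open>By invariance of domain the image of the open ball of radius 2 is open, so
    \<open>Q\<close> is closed. It meets the compact ball only at radius 2, where both definitions
    agree.\<close>
  define Q where "Q = ?T - e ` {x \<in> Rn p. Rnorm p x < 2}"
  have "continuous_on ?T \<kappa>"
  proof -
    have T: "?T = e ` Rball p 2 \<union> Q" using e(2) bR[of 2] by (auto simp: Q_def Rball_def)
    have "continuous_on (e ` Rball p 2 \<union> Q) \<kappa>"
      unfolding \<kappa>_def
    proof (rule continuous_on_cases_local)
      have ceb: "continuous_on (Rball p 2) e" using e(1) bR by (rule continuous_on_subset)
      have "compact (e ` Rball p 2)" by (intro compact_continuous_image ceb compact_Rball)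
      then show "closedin (top_of_set (e ` Rball p 2 \<union> Q)) (e ` Rball p 2)"
        by (metis Un_upper1 closed_subset compact_imp_closed)
      have "{x \<in> Rn p. Rnorm p x < 2} = Rn p \<inter> {x. Rnorm p x < 2}" by auto
      moreover have "open {x. Rnorm p x < 2}" by (intro open_Collect_less continuous_intros)
      ultimately have "openin (top_of_set (Rn p)) {x \<in> Rn p. Rnorm p x < 2}"
        by (simp add: openin_open_Int)
      then have "openin (Top_Tor {..<p}) (e ` {x \<in> Rn p. Rnorm p x < 2})" by (rule
          invariance_of_domain_torus[OF e])
      then have "closedin (Top_Tor {..<p}) Q" unfolding Q_def using closedin_diff[OF closedin_topspace[of
          "Top_Tor {..<p}"]] by simp
      then show "closedin (top_of_set (e ` Rball p 2 \<union> Q)) Q" using T by simp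
      have inv: "continuous_on (e ` Rball p 2) (inv_into (Rn p) e)"
        by (rule continuous_on_inv[OF ceb compact_Rball]) (use bR[of 2] e(3) in auto)
      have im: "inv_into (Rn p) e y \<in> Rn p" if "y \<in> e ` Rball p 2" for y
        using that bR[of 2] by (intro inv_into_into) auto
      show "continuous_on (e ` Rball p 2) (\<lambda>y. e (c (inv_into (Rn p) e y)))"
        by (rule continuous_on_compose2[OF e(1) continuous_on_compose2[OF contc[of UNIV] inv]]) (use im
            left_arc in auto)
      show "continuous_on Q (\<lambda>y. y)" by (rule continuous_on_id)
      fix y assume "y \<in> e ` Rball p 2 \<and> y \<notin> e ` Rball p 2 \<or> y \<in> Q \<and> y \<in> e
          ` Rball p 2"
      then obtain x where x: "x \<in> Rball p 2" "y = e x" "y \<in> Q" by auto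
      then have "Rnorm p x = 2" by (auto simp: Q_def Rball_def)
      then have "c x = x" using fac2[of 2] by (simp add: c_def)
      then show "e (c (inv_into (Rn p) e y)) = y" using x e(3) bR[of 2] by auto
    qed
    then show ?thesis using T by simp
  qed
  moreover have "\<kappa> ` ?T = ?T"
  proof (intro equalityI subsetI)
    fix w assume "w \<in> \<kappa> ` ?T"
    then obtain y where y: "y \<in> ?T" "w = \<kappa> y" by auto
    then show "w \<in> ?T" using \<kappa>e \<kappa>out left_arc e(2) by (cases "y \<in> e ` Rn p") auto
  next
    fix w assume w: "w \<in> ?T"
    show "w \<in> \<kappa> ` ?T"
    proof (cases "w \<in> e ` Rn p")
      case False
      then show ?thesis using w \<kappa>out by (metis imageI)
    next
      case True
      then obtain x where x: "x \<in> Rn p" "w = e x" by auto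
      define s where "s = Rnorm p x"
      \<comment> \<open>A preimage at radius \<open>r\<close> below 2 needs
        \<open>2 * r - 2 = s\<close>, hence \<open>r = s / 2 + 1\<close> and the factor
        \<open>1/2 + 1/s\<close>; for \<open>s\<close> at least 2 the maximum selects 1.\<close>
      define x' where "x' = (\<lambda>i. (if s = 0 then 1 else max 1 (1/2 + 1/s)) * x i)"
      have x'R: "x' \<in> Rn p" using x by (simp add: x'_def Rn_def)
      have "c x' = x"
      proof (cases "s = 0")
        case True
        then have "x = (\<lambda>i. 0)" using Rnorm_eq_0[OF x(1)] unfolding s_def by blast
        then show ?thesis by (simp add: c_def x'_def)
      next
        case False
        then have s: "s > 0" using Rnorm_nonneg[of x p] unfolding s_def by linarith
        define m where "m = max 1 (1/2 + 1/s)"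
        have "Rnorm p x' = m * s" using False unfolding x'_def Rnorm_scale s_def[symmetric] by (simp add: m_def)
        moreover have "fac (m * s) * m = 1"
        proof (cases "s \<ge> 2")
          case True
          then have "m = 1" by (simp add: m_def max_def divide_simps)
          then show ?thesis using True fac2 by simp
        next
          case sl: False
          then have m: "m = 1/2 + 1/s" using s by (simp add: m_def max_def divide_simps)
          then have ms: "m * s = s / 2 + 1" using s by (simp add: field_simps)
          have "fac (m * s) * (m * s) = min (m * s) (2 * (m * s) - 2)" using s by (intro facm) (simp add: ms)
          also have "\<dots> = s" using sl ms by simp
          finally show ?thesis using s by simp
        qed
        ultimately have "fac (Rnorm p x') * (m * x i) = x i" for i by (simp flip: mult.assoc)
        then show ?thesis using False by (simp add: c_def x'_def m_def fun_eq_iff)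
      qed
      then have "\<kappa> (e x') = w" using \<kappa>e[OF x'R] x by simp
      then show ?thesis using e(2) x'R by blast
    qed
  qed
  moreover have "\<kappa> y = e (\<lambda>i. 0)" if y: "y \<in> e ` Rball p 1" for y
  proof -
    obtain x where x: "x \<in> Rball p 1" "y = e x" using y by auto
    then have "c x = (\<lambda>i. 0)" using fac1 by (simp add: c_def Rball_def)
    then show ?thesis using \<kappa>e[of x] x bR by auto
  qed
  moreover have big: "Rnorm p x > 1" if "x \<in> Rn p" "e x \<notin> e ` Rball p 1" for x
    using that by (auto simp: Rball_def)
  have "\<kappa> y \<noteq> e (\<lambda>i. 0)" if y: "y \<in> ?T - e ` Rball p 1" for y
  proof (cases "y \<in> e ` Rn p")
    case True
    then obtain x where x: "x \<in> Rn p" "y = e x" by auto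
    have r: "Rnorm p x > 1" using big x y by auto
    have "min (Rnorm p x) (2 * Rnorm p x - 2) > 0" using r by linarith
    then have "Rnorm p (c x) \<noteq> 0" unfolding cnorm facm[OF r] by linarith
    then have "c x \<noteq> (\<lambda>i. 0)" using Rnorm_eq_0[OF left_arc[OF x(1)]] by blast
    then show ?thesis using \<kappa>e[OF x(1)] x e(3) left_arc zR by (auto dest: inj_onD)
  next
    case False
    then show ?thesis using \<kappa>out zR by auto
  qed
  moreover have "inj_on \<kappa> (?T - e ` Rball p 1)"
  proof (rule inj_onI)
    fix y y' assume y: "y \<in> ?T - e ` Rball p 1" "y' \<in> ?T - e ` Rball p 1" and eq: "\<kappa> y =
        \<kappa> y'"
    have iff: "\<kappa> y \<in> e ` Rn p \<longleftrightarrow> y \<in> e ` Rn p" for y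
      using \<kappa>e \<kappa>out[of y] left_arc by (cases "y \<in> e ` Rn p") auto
    show "y = y'"
    proof (cases "y \<in> e ` Rn p")
      case True
      then have "y' \<in> e ` Rn p" using eq iff by metis
      then obtain x x' where x: "x \<in> Rn p" "y = e x" "x' \<in> Rn p" "y' = e x'" using True by auto
      have r: "Rnorm p x > 1" "Rnorm p x' > 1" using big x y by auto
      have ceq: "c x = c x'" using eq \<kappa>e x e(3) left_arc by (auto dest: inj_onD)
      then have "min (Rnorm p x) (2 * Rnorm p x - 2) = min (Rnorm p x') (2 * Rnorm p x' - 2)"
        using cnorm[of x] cnorm[of x'] facm[OF r(1)] facm[OF r(2)] by simp
      then have req: "Rnorm p x = Rnorm p x'" using r by linarith
      have "fac (Rnorm p x) \<noteq> 0" using facm[OF r(1)] r(1) by (auto simp del: real_sqrt_gt_1_iff)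
      then have "x i = x' i" for i using fun_cong[OF ceq, of i] req by (simp add: c_def)
      then have "x = x'" by (rule ext)
      then show ?thesis using x by simp
    next
      case False
      then have "y' \<notin> e ` Rn p" using eq iff by metis
      then show ?thesis using False eq \<kappa>out by simp
    qed
  qed
  ultimately show thesis using that by blast
qed

section \<open>Compactified summands\<close>

lemma torus_homeomorphic_Top_Tor:
  "homeomorphic_maps (torus p) (Top_Tor {..<p}) (\<lambda>z i. if i < p then z i else 1) (\<lambda>z.
      restrict z {..<p})"
  unfolding homeomorphic_maps_def
proof (intro conjI ballI)
  have "continuous_map (torus p) euclidean (\<lambda>z i. if i < p then z i else 1)"
    unfolding euclidean_product_topology[symmetric] continuous_map_componentwise_UNIV
  proof
    fix i
    show "continuous_map (torus p) euclidean (\<lambda>z. if i < p then z i else 1)"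
    proof (cases "i < p")
      case True
      then have "continuous_map (torus p) circle (\<lambda>z. z i)"
        unfolding torus_def by (intro continuous_map_product_projection) simp
      then show ?thesis using True by (simp add: continuous_map_in_subtopology)
    qed simp
  qed
  moreover have "(\<lambda>z i. if i < p then z i else 1) \<in> topspace (torus p) \<rightarrow> Tor {..<p}"
    by (auto simp: torus_def Tor_def PiE_iff)
  ultimately show "continuous_map (torus p) (Top_Tor {..<p}) (\<lambda>z i. if i < p then z i else 1)"
    by (auto simp: continuous_map_in_subtopology)
  show "continuous_map (Top_Tor {..<p}) (torus p) (\<lambda>z. restrict z {..<p})"
    unfolding torus_def continuous_map_componentwise
    by (auto simp: continuous_map_in_subtopology Tor_def intro!: continuous_intros)
qed (auto simp: torus_def Tor_def fun_eq_iff PiE_iff extensional_def)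

text \<open>Undoing \<open>h\<close> and then collapsing the disk sends the boundary sphere
  \<open>S\<close> to one point and \<open>T\<close> injectively to the rest of the torus.\<close>

lemma punctured_torus_quotient:
  assumes pt: "punctured_torus p X T S" and TS: "T \<inter> S = {}" "T \<union> S \<subseteq> topspace X"
      and p: "p > 0"
  obtains \<kappa> z0 where "continuous_map (subtopology X (T \<union> S)) (Top_Tor {..<p}) \<kappa>"
      "\<kappa> ` (T \<union> S) = Tor {..<p}"
    "inj_on \<kappa> T" "\<And>x. x \<in> S \<Longrightarrow> \<kappa> x = z0" "\<And>x. x \<in> T
        \<Longrightarrow> \<kappa> x \<noteq> z0"
    "compact_space (subtopology X (T \<union> S))" "S \<subseteq> X closure_of T"
proof -
  obtain e0 h where e0: "embedding_map (Euclidean_space p) (torus p) e0"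
    and h: "homeomorphic_map (subtopology (torus p) (topspace (torus p) - e0 ` open_disk p)) (subtopology X
        (T \<union> S)) h"
    and hS: "h ` e0 ` disk_boundary p = S"
    using pt by (auto simp: punctured_torus_def)
  define \<tau> where "\<tau> = (\<lambda>(z::nat\<Rightarrow>complex) i. if i < p then z i else 1)"
  have \<tau>: "homeomorphic_map (torus p) (Top_Tor {..<p}) \<tau>"
    using torus_homeomorphic_Top_Tor[of p] homeomorphic_map_maps unfolding \<tau>_def by blast
  have \<tau>c: "continuous_map (torus p) (Top_Tor {..<p}) \<tau>" using \<tau>
      homeomorphic_imp_continuous_map by blast
  have \<tau>b: "\<tau> ` topspace (torus p) = Tor {..<p}" "inj_on \<tau> (topspace (torus p))"
    using homeomorphic_imp_surjective_map[OF \<tau>] homeomorphic_imp_injective_map[OF \<tau>] by auto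
  define e where "e = \<tau> \<circ> e0"
  have e0c: "continuous_map (Euclidean_space p) (torus p) e0" using homeomorphic_imp_continuous_map[OF
      e0[unfolded embedding_map_def]] by (simp add: continuous_map_in_subtopology)
  have e0i: "inj_on e0 (Rn p)"
    using homeomorphic_imp_injective_map[OF e0[unfolded embedding_map_def]] by (simp add: Euclidean_space_Rn)
  have e0R: "e0 x \<in> topspace (torus p)" if "x \<in> Rn p" for x
    using e0c that by (auto simp: continuous_map_def Euclidean_space_Rn)
  have "continuous_map (Euclidean_space p) (Top_Tor {..<p}) e"
    unfolding e_def by (rule continuous_map_compose[OF e0c \<tau>c])
  then have e: "continuous_on (Rn p) e" "e \<in> Rn p \<rightarrow> Tor {..<p}"
    by (auto simp: Euclidean_space_Rn continuous_map_subtopology_eu)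
  have ei: "inj_on e (Rn p)"
    unfolding e_def using e0i e0R \<tau>b(2) by (intro comp_inj_on) (auto intro: inj_on_subset)
  note e = e ei
  have od: "open_disk p = {x \<in> Rn p. (\<Sum>i<p. (x i)\<^sup>2) < 1}" and bd: "disk_boundary p = {x
      \<in> Rn p. (\<Sum>i<p. (x i)\<^sup>2) = 1}"
    by (auto simp: open_disk_def disk_boundary_def Euclidean_space_Rn)
  have ball: "Rball p 1 = open_disk p \<union> disk_boundary p"
    by (auto simp: od bd Rball_def)
  obtain \<kappa>' where \<kappa>': "continuous_on (Tor {..<p}) \<kappa>'" "\<kappa>' ` Tor {..<p} = Tor {..<p}"
    "\<And>y. y \<in> e ` Rball p 1 \<Longrightarrow> \<kappa>' y = e (\<lambda>i. 0)"
    "\<And>y. y \<in> Tor {..<p} - e ` Rball p 1 \<Longrightarrow> \<kappa>' y \<noteq> e (\<lambda>i. 0)"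
    "inj_on \<kappa>' (Tor {..<p} - e ` Rball p 1)"
    using torus_collapse[OF e] by blast
  let ?P = "topspace (torus p) - e0 ` open_disk p"
  obtain h' where h': "homeomorphic_maps (subtopology (torus p) ?P) (subtopology X (T \<union> S)) h h'"
    using h homeomorphic_map_maps by blast
  have topP: "topspace (subtopology (torus p) ?P) = ?P" by auto
  have topX: "topspace (subtopology X (T \<union> S)) = T \<union> S" using TS by auto
  have hc: "continuous_map (subtopology (torus p) ?P) (subtopology X (T \<union> S)) h"
    and h'c: "continuous_map (subtopology X (T \<union> S)) (subtopology (torus p) ?P) h'"
    and h'h: "\<And>y. y \<in> ?P \<Longrightarrow> h' (h y) = y" and hh': "\<And>x. x \<in> T \<union> S
        \<Longrightarrow> h (h' x) = x"
    using h' topP topX by (auto simp: homeomorphic_maps_def)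
  have him: "h y \<in> T \<union> S" if "y \<in> ?P" for y using hc that topP topX by (auto simp:
      continuous_map_def)
  have h'im: "h' x \<in> ?P" if "x \<in> T \<union> S" for x using h'c that topP topX by (auto simp:
      continuous_map_def)
  have bdP: "e0 ` disk_boundary p \<subseteq> ?P"
    using e0i e0R by (auto simp: od bd dest: inj_onD)
  have h'S: "h' x \<in> e0 ` disk_boundary p" if xS: "x \<in> S" for x
  proof -
    obtain y where "y \<in> e0 ` disk_boundary p" "x = h y" using xS hS by auto
    then show ?thesis using h'h bdP by auto
  qed
  have h'T: "h' x \<notin> e0 ` disk_boundary p" if "x \<in> T" for x
  proof
    assume "h' x \<in> e0 ` disk_boundary p"
    then have "h (h' x) \<in> S" using hS by blast
    then show False using hh' that TS by auto
  qed
  have etau: "\<tau> y \<in> e ` U \<longleftrightarrow> y \<in> e0 ` U" if "y \<in> topspace (torus p)" "U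
      \<subseteq> Rn p" for y U
    using that \<tau>b(2) e0R by (auto simp: e_def dest!: inj_onD)
  have bR: "Rball p 1 \<subseteq> Rn p" "open_disk p \<subseteq> Rn p" by (auto simp: Rball_def od)
  define \<kappa> where "\<kappa> = \<kappa>' \<circ> \<tau> \<circ> h'"
  have \<kappa>'c: "continuous_map (Top_Tor {..<p}) (Top_Tor {..<p}) \<kappa>'"
    using \<kappa>'(1,2) by (auto simp: continuous_map_subtopology_eu)
  have "continuous_map (subtopology X (T \<union> S)) (torus p) h'"
    using h'c by (simp add: continuous_map_in_subtopology)
  then have "continuous_map (subtopology X (T \<union> S)) (Top_Tor {..<p}) \<kappa>"
    unfolding \<kappa>_def by (rule continuous_map_compose[OF _ continuous_map_compose[OF \<tau>c \<kappa>'c]])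
  moreover have \<kappa>S: "\<kappa> x = e (\<lambda>i. 0)" if "x \<in> S" for x
  proof -
    have "\<tau> (h' x) \<in> e ` Rball p 1"
      using etau[of "h' x" "Rball p 1"] h'S[OF that] h'im[of x] that bR ball by auto
    then show ?thesis using \<kappa>'(3) by (simp add: \<kappa>_def)
  qed
  moreover have T': "\<tau> (h' x) \<in> Tor {..<p} - e ` Rball p 1" if "x \<in> T" for x
  proof -
    have hx: "h' x \<in> ?P" using h'im that by auto
    then have "h' x \<notin> e0 ` Rball p 1" using h'T[OF that] ball by auto
    then show ?thesis using etau[of "h' x" "Rball p 1"] hx bR \<tau>b(1) by auto
  qed
  then have "\<And>x. x \<in> T \<Longrightarrow> \<kappa> x \<noteq> e (\<lambda>i. 0)" using \<kappa>'(4)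
      by (simp add: \<kappa>_def)
  moreover have "inj_on \<kappa> T"
  proof (rule inj_onI)
    fix x y assume xy: "x \<in> T" "y \<in> T" "\<kappa> x = \<kappa> y"
    then have "\<tau> (h' x) = \<tau> (h' y)" using \<kappa>'(5) T' by (auto simp: \<kappa>_def dest: inj_onD)
    then have "h' x = h' y" using \<tau>b(2) h'im[of x] h'im[of y] xy by (auto dest: inj_onD)
    then show "x = y" using hh' xy by (metis UnI1)
  qed
  moreover have "\<kappa> ` (T \<union> S) = Tor {..<p}"
  proof (intro equalityI subsetI)
    fix w assume "w \<in> \<kappa> ` (T \<union> S)"
    then obtain x where "x \<in> T \<union> S" "w = \<kappa> x" by auto
    then show "w \<in> Tor {..<p}" using h'im[of x] \<tau>b(1) \<kappa>'(2) by (auto simp: \<kappa>_def)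
  next
    fix w assume "w \<in> Tor {..<p}"
    then obtain v where v: "v \<in> Tor {..<p}" "w = \<kappa>' v" using \<kappa>'(2) by blast
    \<comment> \<open>The open disk does not belong to the summand, so the collapse point has to be
      attained on \<open>S\<close>; a unit vector provides a point of \<open>S\<close>.\<close>
    define b where "b = (\<lambda>i::nat. if i = 0 then 1 else 0 :: real)"
    have "(\<Sum>i<p. (b i)\<^sup>2) = (\<Sum>i\<in>{0}. (b i)\<^sup>2)"
      using p by (intro sum.mono_neutral_right) (auto simp: b_def)
    then have b: "b \<in> disk_boundary p" using p by (auto simp: bd Rn_def b_def)
    show "w \<in> \<kappa> ` (T \<union> S)"
    proof (cases "v \<in> e ` Rball p 1")
      case True
      have "h (e0 b) \<in> S" using b hS by auto
      then show ?thesis using \<kappa>S[of "h (e0 b)"] \<kappa>'(3)[OF True] v by (auto intro!: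
          image_eqI[of _ _ "h (e0 b)"])
    next
      case False
      obtain y where y: "y \<in> topspace (torus p)" "v = \<tau> y" using v \<tau>b(1) by blast
      then have "y \<notin> e0 ` Rball p 1" using False etau[of y "Rball p 1"] bR by auto
      then have yP: "y \<in> ?P" using y ball by auto
      then have "w = \<kappa> (h y)" using h'h v y by (simp add: \<kappa>_def)
      then show ?thesis using him[OF yP] by blast
    qed
  qed
  moreover have "compact_space (subtopology X (T \<union> S))"
  proof -
    have "open_disk p = Rn p \<inter> {x. (\<Sum>i<p. (x i)\<^sup>2) < 1}" by (auto simp: od)
    moreover have "open {x::nat\<Rightarrow>real. (\<Sum>i<p. (x i)\<^sup>2) < 1}" by (intro
        open_Collect_less continuous_intros)
    ultimately have "openin (top_of_set (Rn p)) (open_disk p)" by (simp add: openin_open_Int)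
    \<comment> \<open>Invariance of domain makes the removed disk open in the torus, so what remains
      is closed in a compact space.\<close>
    then have "openin (Top_Tor {..<p}) (e ` open_disk p)" by (rule invariance_of_domain_torus[OF e])
    from openin_continuous_map_preimage[OF \<tau>c this]
    have "openin (torus p) {y \<in> topspace (torus p). \<tau> y \<in> e ` open_disk p}" .
    moreover have "{y \<in> topspace (torus p). \<tau> y \<in> e ` open_disk p} = e0 ` open_disk p"
      using etau[OF _ bR(2)] e0R bR by auto
    ultimately have "closedin (torus p) ?P" by (simp add: closedin_diff)
    moreover have "compact_space (torus p)"
      unfolding torus_def by (simp add: compact_space_product_topology compact_space_subtopology)
    ultimately have "compact_space (subtopology (torus p) ?P)"
      by (simp add: closedin_compact_space compact_space_subtopology)
    then show ?thesis using h homeomorphic_compact_space homeomorphic_map_imp_homeomorphic_space by blast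
  qed
  moreover have "S \<subseteq> X closure_of T"
  proof
    fix s assume "s \<in> S"
    then obtain x where x: "x \<in> disk_boundary p" "s = h (e0 x)" using hS by auto
    \<comment> \<open>The embedding continues past the unit sphere, so the radial path that starts
      at the given boundary point lies in \<open>T\<close> at all later times.\<close>
    define \<gamma> where "\<gamma> t = h (e0 (\<lambda>i. t * x i))" for t :: real
    have xR: "(\<lambda>i. t * x i) \<in> Rn p" for t using x by (auto simp: bd Rn_def)
    have sq: "(\<Sum>i<p. (t * x i)\<^sup>2) = t\<^sup>2" for t
      using x by (simp add: bd power_mult_distrib flip: sum_distrib_left)
    have out: "e0 (\<lambda>i. t * x i) \<in> ?P" if "t \<ge> 1" for t
    proof -
      have "(\<lambda>i. t * x i) \<notin> open_disk p" using that sq[of t] by (simp add: od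
          power2_eq_square) (smt (verit) mult_le_cancel_left1)
      then show ?thesis using e0R[OF xR] e0i xR bR by (auto dest: inj_onD)
    qed
    have "continuous_map (top_of_set {1..2::real}) (Euclidean_space p) (\<lambda>t i. t * x i)"
      unfolding Euclidean_space_Rn continuous_map_subtopology_eu using xR
      by (auto intro!: continuous_on_coordinatewise_then_product continuous_intros)
    then have "continuous_map (top_of_set {1..2::real}) (torus p) (\<lambda>t. e0 (\<lambda>i. t * x i))"
      using continuous_map_compose[OF _ e0c] by (simp add: o_def)
    then have "continuous_map (top_of_set {1..2::real}) (subtopology (torus p) ?P) (\<lambda>t. e0
        (\<lambda>i. t * x i))"
      unfolding continuous_map_in_subtopology using out by auto
    from continuous_map_compose[OF this hc] have "continuous_map (top_of_set {1..2::real}) (subtopology X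
        (T \<union> S)) \<gamma>"
      by (simp add: o_def \<gamma>_def[abs_def])
    then have \<gamma>c: "continuous_map (top_of_set {1..2::real}) X \<gamma>" by (simp add:
        continuous_map_in_subtopology)
    have "\<gamma> ` {1<..2} \<subseteq> T"
    proof
      fix y assume "y \<in> \<gamma> ` {1<..2}"
      then obtain t where t: "1 < t" "t \<le> 2" "y = h (e0 (\<lambda>i. t * x i))" by (auto simp: \<gamma>_def)
      have P: "e0 (\<lambda>i. t * x i) \<in> ?P" using out t by simp
      have "(\<lambda>i. t * x i) \<notin> disk_boundary p" using t sq[of t] by (simp add: bd
          power2_eq_square) (smt (verit) mult_le_cancel_left1)
      then have "e0 (\<lambda>i. t * x i) \<notin> e0 ` disk_boundary p" using e0i xR by (auto simp: bd
          dest: inj_onD)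
      then have "y \<notin> S" using h'S[of y] h'h[OF P] t by auto
      then show "y \<in> T" using him[OF P] t by auto
    qed
    moreover have "1 \<in> top_of_set {1..2::real} closure_of {1<..2}"
    proof -
      have "closure {1<..2::real} = {1..2}" by simp
      then show ?thesis by (simp add: closure_of_subtopology Int_absorb1
          greaterThanAtMost_subseteq_atLeastAtMost_iff)
    qed
    then have "\<gamma> 1 \<in> X closure_of (\<gamma> ` {1<..2})"
      using continuous_map_image_closure_subset[OF \<gamma>c, of "{1<..2}"] by blast
    moreover have "\<gamma> 1 = s" using x by (simp add: \<gamma>_def)
    ultimately show "s \<in> X closure_of T" using closure_of_mono by blast
  qed
  ultimately show thesis using that by blast
qed

text \<open>Stages of a homotopy may move points of \<open>T\<close> onto the sphere, which has
  become the point at infinity; \<open>map_option u\<close> would leave the compactification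
  there.\<close>

definition collapse_map :: "'a set \<Rightarrow> ('a \<Rightarrow> 'a) \<Rightarrow> 'a option
    \<Rightarrow> 'a option"
  where "collapse_map T u c = (case c of None \<Rightarrow> None | Some x \<Rightarrow> if u x \<in> T then
      Some (u x) else None)"

text \<open>Closed subsets of the compact summand that avoid \<open>S\<close> are compact in
  \<open>T\<close>, so their complements are neighbourhoods of infinity and \<open>\<kappa>\<close>
  induces a continuous bijection from a compact space to the Hausdorff torus. Being Hausdorff, the
  compactification is then a quotient of the closed summand.\<close>

lemma Alexandroff_punctured_torus:
  assumes \<kappa>: "continuous_map (subtopology X (T \<union> S)) (Top_Tor {..<p}) \<kappa>" "\<kappa> `
      (T \<union> S) = Tor {..<p}"
    "inj_on \<kappa> T" "\<And>x. x \<in> S \<Longrightarrow> \<kappa> x = z0" "\<And>x. x \<in> T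
        \<Longrightarrow> \<kappa> x \<noteq> z0"
    and comp: "compact_space (subtopology X (T \<union> S))"
    and TS: "T \<inter> S = {}" "T \<union> S \<subseteq> topspace X" "openin X T" "S \<noteq> {}"
  defines "C \<equiv> Alexandroff_compactification (subtopology X T)"
  obtains \<theta> \<theta>' where "homeomorphic_maps C (Top_Tor {..<p}) \<theta> \<theta>'"
    "quotient_map (subtopology X (T \<union> S)) C (\<lambda>x. if x \<in> T then Some x else None)"
        "Hausdorff_space C"
proof -
  let ?A = "subtopology X (T \<union> S)"
  have topA: "topspace ?A = T \<union> S" using TS by auto
  have topT: "topspace (subtopology X T) = T" using TS by auto
  have z0: "z0 \<in> Tor {..<p}" using \<kappa>(2,4) TS(4) by fastforce
  define \<theta> where "\<theta> c = (case c of None \<Rightarrow> z0 | Some x \<Rightarrow> \<kappa> x)" for c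
  have contC: "continuous_map C (Top_Tor {..<p}) \<theta>"
    unfolding continuous_map_def
  proof (intro conjI allI impI)
    show "\<theta> \<in> topspace C \<rightarrow> topspace (Top_Tor {..<p})"
      using \<kappa>(2) z0 topT by (auto simp: C_def \<theta>_def)
    fix V assume V: "openin (Top_Tor {..<p}) V"
    have pre: "openin ?A {x \<in> T \<union> S. \<kappa> x \<in> V}"
      using openin_continuous_map_preimage[OF \<kappa>(1) V] unfolding topA .
    show "openin C {c \<in> topspace C. \<theta> c \<in> V}"
    proof (cases "z0 \<in> V")
      case False
      have "{x \<in> T \<union> S. \<kappa> x \<in> V} = {x \<in> T. \<kappa> x \<in> V}" using False
          \<kappa>(4) by auto
      then have "openin ?A {x \<in> T. \<kappa> x \<in> V}" using pre by simp
      then obtain W where W: "openin X W" "{x \<in> T. \<kappa> x \<in> V} = W \<inter> (T \<union> S)" by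
          (auto simp: openin_subtopology)
      then have "{x \<in> T. \<kappa> x \<in> V} = W \<inter> T" by auto
      then have "openin (subtopology X T) {x \<in> T. \<kappa> x \<in> V}" using W by (auto simp:
          openin_subtopology)
      moreover have "{c \<in> topspace C. \<theta> c \<in> V} = Some ` {x \<in> T. \<kappa> x \<in> V}"
        using False topT by (auto simp: C_def \<theta>_def)
      ultimately show ?thesis by (simp add: C_def)
    next
      case True
      define K where "K = {x \<in> T. \<kappa> x \<notin> V}"
      have KA: "K = topspace ?A - {x \<in> T \<union> S. \<kappa> x \<in> V}" unfolding topA K_def using
          True \<kappa>(4) by auto
      then have "closedin ?A K" using pre by (metis closedin_diff closedin_topspace)
      then have "compactin ?A K" using comp closedin_compact_space by blast
      then have cK: "compactin (subtopology X T) K" by (auto simp: compactin_subtopology K_def)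
      obtain W where W: "closedin X W" "K = W \<inter> (T \<union> S)" using \<open>closedin ?A K\<close>
          by (auto simp: closedin_subtopology)
      then have "K = W \<inter> T" by (auto simp: K_def)
      then have "closedin (subtopology X T) K" using W by (auto simp: closedin_subtopology)
      moreover have "{c \<in> topspace C. \<theta> c \<in> V} = insert None (Some ` (topspace (subtopology
          X T) - K))"
        unfolding topT using True topT by (auto simp: C_def \<theta>_def K_def)
      ultimately show ?thesis using cK unfolding C_def openin_Alexandroff_compactification by blast
    qed
  qed
  have haus: "Hausdorff_space (Top_Tor {..<p})" by (simp add: Hausdorff_space_subtopology)
  have "homeomorphic_map C (Top_Tor {..<p}) \<theta>"
  proof (rule continuous_imp_homeomorphic_map[OF contC _ haus])
    show "compact_space C" by (simp add: C_def)
    show "\<theta> ` topspace C = topspace (Top_Tor {..<p})"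
    proof (intro equalityI subsetI)
      fix w assume "w \<in> topspace (Top_Tor {..<p})"
      then obtain x where x: "x \<in> T \<union> S" "w = \<kappa> x" using \<kappa>(2) by force
      then show "w \<in> \<theta> ` topspace C"
      proof (cases "x \<in> T")
        case True
        then show ?thesis using x topT by (intro image_eqI[of _ _ "Some x"]) (auto simp: C_def \<theta>_def)
      next
        case False
        then show ?thesis using x \<kappa>(4) by (intro image_eqI[of _ _ None]) (auto simp: C_def \<theta>_def)
      qed
    qed (use contC in \<open>auto simp: continuous_map_def\<close>)
    show "inj_on \<theta> (topspace C)"
      unfolding C_def topspace_Alexandroff_compactification topT
      using \<kappa>(3,5) by (auto simp: inj_on_def \<theta>_def)
  qed
  then obtain \<theta>' where \<theta>': "homeomorphic_maps C (Top_Tor {..<p}) \<theta> \<theta>'" using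
      homeomorphic_map_maps by blast
  have hausC: "Hausdorff_space C"
    using haus homeomorphic_Hausdorff_space homeomorphic_maps_imp_homeomorphic_space \<theta>'
        homeomorphic_space_def by blast
  have "continuous_map ?A C (\<lambda>x. if x \<in> T then Some x else None)"
  proof (rule continuous_map_eq)
    show "continuous_map ?A C (\<theta>' \<circ> \<kappa>)"
      using \<kappa>(1) \<theta>' by (auto intro: continuous_map_compose simp: homeomorphic_maps_def)
    fix x assume x: "x \<in> topspace ?A"
    let ?q = "if x \<in> T then Some x else None"
    have "?q \<in> topspace C" "\<theta> ?q = \<kappa> x" using x topA topT \<kappa>(4) by (auto simp:
        C_def \<theta>_def)
    then show "(\<theta>' \<circ> \<kappa>) x = ?q" using \<theta>' by (auto simp: homeomorphic_maps_def)
  qed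
  moreover have "(\<lambda>x. if x \<in> T then Some x else None) ` topspace ?A = topspace C"
    unfolding topA C_def topspace_Alexandroff_compactification topT using TS by force
  ultimately have "quotient_map ?A C (\<lambda>x. if x \<in> T then Some x else None)"
    using comp hausC by (intro continuous_imp_quotient_map) auto
  then show thesis using that \<theta>' hausC by blast
qed

text \<open>The collapse remains a quotient map after taking the product with the interval, again as
  a map from a compact to a Hausdorff space. The homotopy descends because each stage keeps
  \<open>S\<close> in \<open>S\<close>, so that infinity stays fixed.\<close>

lemma homotopic_collapse_map:
  assumes quot: "quotient_map (subtopology X (T \<union> S)) C (\<lambda>x. if x \<in> T then Some x else None)"
    and hausC: "Hausdorff_space C" and comp: "compact_space (subtopology X (T \<union> S))"
    and TS: "T \<inter> S = {}" "T \<union> S \<subseteq> topspace X"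
    and hom: "homotopic_with (\<lambda>h. h ` (T \<union> S) \<subseteq> T \<union> S \<and> h ` S
        \<subseteq> S) X X f g"
  shows "homotopic_with (\<lambda>h. True) C C (collapse_map T f) (collapse_map T g)"
proof -
  let ?A = "subtopology X (T \<union> S)" and ?I = "top_of_set {0..1::real}"
  let ?q = "\<lambda>x. if x \<in> T then Some x else None"
  have topA: "topspace ?A = T \<union> S" using TS by auto
  obtain h where h: "continuous_map (prod_topology ?I X) X h" "\<And>x. h (0, x) = f x" "\<And>x. h (1, x) = g x"
    "\<And>t. t \<in> {0..1} \<Longrightarrow> (\<lambda>x. h (t, x)) ` (T \<union> S) \<subseteq> T
        \<union> S \<and> (\<lambda>x. h (t, x)) ` S \<subseteq> S"
    using hom unfolding homotopic_with_def by auto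
  have qc: "continuous_map ?A C ?q" and qs: "?q ` (T \<union> S) = topspace C"
    using quot topA by (auto simp: quotient_map_def quotient_imp_continuous_map[OF quot])
  define H where "H = (\<lambda>(t, c). collapse_map T (\<lambda>x. h (t, x)) c)"
  have "quotient_map (prod_topology ?I ?A) (prod_topology ?I C) (\<lambda>(t, x). (t, ?q x))"
  proof (rule continuous_imp_quotient_map)
    show "continuous_map (prod_topology ?I ?A) (prod_topology ?I C) (\<lambda>(t, x). (t, ?q x))"
      unfolding continuous_map_prod_top using qc by (auto simp: id_def)
    show "compact_space (prod_topology ?I ?A)"
      using comp by (simp add: compact_space_prod_topology compact_space_subtopology)
    show "Hausdorff_space (prod_topology ?I C)"
      using hausC by (simp add: Hausdorff_space_prod_topology Hausdorff_space_subtopology)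
    show "(\<lambda>(t, x). (t, ?q x)) ` topspace (prod_topology ?I ?A) = topspace (prod_topology ?I C)"
      unfolding topspace_prod_topology topA qs[symmetric] by force
  qed
  moreover have "continuous_map (prod_topology ?I ?A) C (H \<circ> (\<lambda>(t, x). (t, ?q x)))"
  proof (rule continuous_map_eq)
    have "prod_topology ?I ?A = subtopology (prod_topology ?I X) ({0..1} \<times> (T \<union> S))"
      by (simp add: prod_topology_subtopology(2))
    then have "continuous_map (prod_topology ?I ?A) X h"
      using h(1) by (simp add: continuous_map_from_subtopology)
    then have "continuous_map (prod_topology ?I ?A) ?A h"
      unfolding continuous_map_in_subtopology topspace_prod_topology topA using h(4) by fastforce
    then show "continuous_map (prod_topology ?I ?A) C (?q \<circ> h)" using qc by (rule continuous_map_compose)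
    fix u assume u: "u \<in> topspace (prod_topology ?I ?A)"
    then obtain t x where tx: "u = (t, x)" "t \<in> {0..1}" "x \<in> T \<union> S" unfolding
        topspace_prod_topology topA by auto
    show "(?q \<circ> h) u = (H \<circ> (\<lambda>(t, x). (t, ?q x))) u"
    proof (cases "x \<in> T")
      case True
      then show ?thesis using tx by (simp add: H_def collapse_map_def)
    next
      case False
      then have "h (t, x) \<in> S" using tx h(4)[OF tx(2)] by auto
      then show ?thesis using tx False TS by (auto simp: H_def collapse_map_def)
    qed
  qed
  ultimately have "continuous_map (prod_topology ?I C) C H"
    by (rule continuous_compose_quotient_map)
  then show ?thesis
    unfolding homotopic_with_def using h(2,3) by (intro exI[of _ H]) (auto simp: H_def)
qed

text \<open>The \<open>+ 1\<close> is the point at infinity, always fixed by the induced map without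
  having to come from a fixed point of \<open>g\<close>.\<close>

lemma abs_compactified_lefschetz_number_le:
  assumes pt: "punctured_torus p X T S" and p: "p > 0"
    and TS: "T \<inter> S = {}" "T \<union> S \<subseteq> topspace X" "openin X T"
    and fT: "f ` T \<subseteq> T"
    and hom: "homotopic_with (\<lambda>h. h ` (T \<union> S) \<subseteq> T \<union> S \<and> h ` S
        \<subseteq> S) X X f g"
    and fin: "finite {x \<in> T. g x = x}"
  shows "\<bar>compactified_lefschetz_number X T f\<bar> \<le> int (card {x \<in> T. g x = x}) + 1"
proof -
  define C where "C = Alexandroff_compactification (subtopology X T)"
  obtain \<kappa> z0 where \<kappa>: "continuous_map (subtopology X (T \<union> S)) (Top_Tor {..<p})
      \<kappa>" "\<kappa> ` (T \<union> S) = Tor {..<p}"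
    "inj_on \<kappa> T" "\<And>x. x \<in> S \<Longrightarrow> \<kappa> x = z0" "\<And>x. x \<in> T
        \<Longrightarrow> \<kappa> x \<noteq> z0"
    "compact_space (subtopology X (T \<union> S))" 
    by (rule punctured_torus_quotient[OF pt TS(1,2) p]) (rule that)
  have "S \<noteq> {}"
  proof
    assume "S = {}"
    then have "disk_boundary p = {}" using pt by (auto simp: punctured_torus_def)
    moreover have "(\<Sum>i<p. (if i = 0 then 1 else 0 :: real)\<^sup>2) = (\<Sum>i\<in>{0::nat}. (if i = 0
        then 1 else 0)\<^sup>2)"
      using p by (intro sum.mono_neutral_right) auto
    then have "(\<lambda>i. if i = 0 then 1 else 0) \<in> disk_boundary p"
      using p by (auto simp: disk_boundary_def Euclidean_space_Rn Rn_def)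
    ultimately show False by simp
  qed
  then obtain \<theta> \<theta>' where \<theta>: "homeomorphic_maps C (Top_Tor {..<p}) \<theta> \<theta>'"
    and quot: "quotient_map (subtopology X (T \<union> S)) C (\<lambda>x. if x \<in> T then Some x else
        None)" and hausC: "Hausdorff_space C"
    using Alexandroff_punctured_torus[OF \<kappa> TS] unfolding C_def by blast
  have topT: "topspace (subtopology X T) = T" using TS by auto
  have homC: "homotopic_with (\<lambda>h. True) C C (collapse_map T f) (collapse_map T g)"
    by (rule homotopic_collapse_map[OF quot hausC \<kappa>(6) TS(1,2) hom])
  \<comment> \<open>As \<open>f\<close> maps \<open>T\<close> into itself, it sends no point of
    \<open>T\<close> to infinity, and its collapsed map is the \<open>map_option f\<close> of the
    definition.\<close>
  have "homotopic_with (\<lambda>h. True) C C (map_option f) (collapse_map T g)"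
    by (rule homotopic_with_eq[OF homC]) (use fT in \<open>auto simp: C_def topT collapse_map_def\<close>)
  then have "compactified_lefschetz_number X T f = lefschetz_number C (collapse_map T g)"
    unfolding compactified_lefschetz_number_def C_def by (rule lefschetz_number_homotopic)
  moreover have fix_eq: "fixed_points C (collapse_map T g) = insert None (Some ` {x \<in> T. g x = x})"
  proof (rule Set.set_eqI)
    have topC: "topspace C = insert None (Some ` T)"
      unfolding C_def topspace_Alexandroff_compactification topT ..
    show "c \<in> fixed_points C (collapse_map T g) \<longleftrightarrow> c \<in> insert None (Some ` {x
        \<in> T. g x = x})" for c
      by (cases c) (auto simp: fixed_points_def topC collapse_map_def)
  qed
  have "\<bar>lefschetz_number C (collapse_map T g)\<bar> \<le> int (card (fixed_points C (collapse_map T g)))"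
    by (rule abs_lefschetz_number_le_fixed_points[OF \<theta>])
      (use homC fin in \<open>auto simp: fix_eq dest: homotopic_with_imp_continuous_maps\<close>)
  moreover have "card (fixed_points C (collapse_map T g)) = Suc (card {x \<in> T. g x = x})"
    unfolding fix_eq using fin by (subst card_insert_disjoint) (auto simp: card_image)
  ultimately show ?thesis by simp
qed

theorem theorem4p6:
  fixes p :: nat
    and X :: "'a topology"
    and T1 S T2 :: "'a set"
    and f :: "'a \<Rightarrow> 'a"
  assumes "p \<ge> 3"
    and "connected_sum_of_tori p X T1 S T2"
    and "continuous_map X X f"
    and "f ` T1 \<subseteq> T1" and "f ` T2 \<subseteq> T2" and "f ` S \<subseteq> S"
  shows "ereal_of_enat (triad_nielsen_number X (X closure_of T1) (X closure_of T2) f)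
    \<ge> ereal (of_int (\<bar>compactified_lefschetz_number X T1 f\<bar>
                      + \<bar>compactified_lefschetz_number X T2 f\<bar> - 3))"
proof -
  have p: "p > 0" using assms(1) by simp
  have X: "topspace X = T1 \<union> S \<union> T2" "T1 \<inter> S = {}" "T2 \<inter> S = {}" "T1 \<inter> T2 = {}"
    "openin X T1" "openin X T2" "punctured_torus p X T1 S" "punctured_torus p X T2 S"
    using assms(2) by (auto simp: connected_sum_of_tori_def)
  \<comment> \<open>The union with the sphere is closed because the other summand is open, and the
    collar shows that \<open>T\<close> comes arbitrarily close to every point of
    \<open>S\<close>.\<close>
  have cl: "X closure_of T = T \<union> S"
    if "topspace X = T \<union> S \<union> T'" "T \<inter> T' = {}" "T' \<inter> S = {}" "T \<inter> S =
        {}" "openin X T'" "punctured_torus p X T S" for T T'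
  proof
    have "T \<union> S = topspace X - T'" using that by auto
    then have "closedin X (T \<union> S)" using that(5) by (simp add: closedin_diff)
    then show "X closure_of T \<subseteq> T \<union> S" by (intro closure_of_minimal) auto
    have sub: "T \<union> S \<subseteq> topspace X" using that by auto
    have "S \<subseteq> X closure_of T"
      by (rule punctured_torus_quotient[OF that(6,4) sub p])
    then show "T \<union> S \<subseteq> X closure_of T" using closure_of_subset[of T X] sub by auto
  qed
  have cl1: "X closure_of T1 = T1 \<union> S" by (rule cl[of T1 T2]) (use X in auto)
  have cl2: "X closure_of T2 = T2 \<union> S" by (rule cl[of T2 T1]) (use X in auto)
  let ?L = "\<bar>compactified_lefschetz_number X T1 f\<bar> + \<bar>compactified_lefschetz_number X T2
      f\<bar> - 3"
  have bound: "?L \<le> int (card (fixed_points X g))"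
    if hom: "homotopic_with (\<lambda>h. h ` (T1 \<union> S) \<subseteq> T1 \<union> S \<and> h ` (T2
        \<union> S) \<subseteq> T2 \<union> S) X X f g"
      and fin: "finite (fixed_points X g)" for g
  proof -
    \<comment> \<open>\<open>S\<close> is the intersection of the two closed summands, so every
      stage of a triad homotopy preserves it.\<close>
    have S: "h ` S \<subseteq> S" if "h ` (T1 \<union> S) \<subseteq> T1 \<union> S" "h ` (T2 \<union> S)
        \<subseteq> T2 \<union> S" for h :: "'a \<Rightarrow> 'a"
      using that X by fast
    have hom1: "homotopic_with (\<lambda>h. h ` (T1 \<union> S) \<subseteq> T1 \<union> S \<and> h ` S
        \<subseteq> S) X X f g"
      using hom by (rule homotopic_with_mono) (use S in blast)
    have hom2: "homotopic_with (\<lambda>h. h ` (T2 \<union> S) \<subseteq> T2 \<union> S \<and> h ` S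
        \<subseteq> S) X X f g"
      using hom by (rule homotopic_with_mono) (use S in blast)
    have sub: "{x \<in> T1. g x = x} \<union> {x \<in> T2. g x = x} \<subseteq> fixed_points X g"
      using X(1) by (auto simp: fixed_points_def)
    then have fin12: "finite {x \<in> T1. g x = x}" "finite {x \<in> T2. g x = x}" using fin finite_subset by auto
    have "card {x \<in> T1. g x = x} + card {x \<in> T2. g x = x} = card ({x \<in> T1. g x = x} \<union> {x
        \<in> T2. g x = x})"
      using fin12 X(4) by (subst card_Un_disjoint) auto
    also have "\<dots> \<le> card (fixed_points X g)" using sub fin by (rule card_mono[rotated])
    finally have "int (card {x \<in> T1. g x = x}) + int (card {x \<in> T2. g x = x}) \<le> int (card
        (fixed_points X g))" by simp
    moreover have "\<bar>compactified_lefschetz_number X T1 f\<bar> \<le> int (card {x \<in> T1. g x = x}) + 1"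
      by (rule abs_compactified_lefschetz_number_le[OF X(7) p X(2) _ X(5) assms(4) hom1 fin12(1)]) (use X in auto)
    moreover have "\<bar>compactified_lefschetz_number X T2 f\<bar> \<le> int (card {x \<in> T2. g x = x}) + 1"
      by (rule abs_compactified_lefschetz_number_le[OF X(8) p X(3) _ X(6) assms(5) hom2 fin12(2)]) (use X in auto)
    \<comment> \<open>Adding the two inequalities loses 2, one for each point at infinity, which
      leaves a margin of 1 under the stated 3.\<close>
    ultimately show ?thesis by simp
  qed
  \<comment> \<open>Truncation by \<open>nat\<close> is harmless, since a negative \<open>?L\<close>
    makes the claim trivial.\<close>
  have "enat (nat ?L) \<le> triad_nielsen_number X (X closure_of T1) (X closure_of T2) f"
    unfolding triad_nielsen_number_def cl1 cl2
  proof (rule INF_greatest)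
    fix g assume "g \<in> {g. homotopic_with (\<lambda>h. h ` (T1 \<union> S) \<subseteq> T1 \<union> S
        \<and> h ` (T2 \<union> S) \<subseteq> T2 \<union> S) X X f g}"
    then show "enat (nat ?L) \<le> (if finite (fixed_points X g) then enat (card (fixed_points X g)) else
        \<infinity>)"
      using bound[of g] by auto
  qed
  then have "ereal_of_enat (enat (nat ?L)) \<le> ereal_of_enat (triad_nielsen_number X (X closure_of T1) (X
      closure_of T2) f)"
    by (simp only: ereal_of_enat_le_iff)
  moreover have "ereal (of_int ?L) \<le> ereal_of_enat (enat (nat ?L))" by simp
  ultimately show ?thesis by (rule order_trans[rotated])
qed

end
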